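(* Let $R$ be a standard graded ring over an infinite field $k$ and let $I\subset R$ be a $d$-equigenerated homogeneous ideal. If $f_1,\ldots,f_l\in[I]_d$ are forms such that $f_1,\ldots,f_l$ is a regular sequence in $k[[I]_d]$, then, for any $1\le i\le l$, the subset $\{f_1,\ldots,f_i\}$ is $i$-adjusted. In particular, if the special fiber $\mathcal{F}(I)$ is Cohen--Macaulay then every set of forms $\{f_1,\ldots,f_\ell\}\subset[I]_d$, with $\ell=\ell(I)$, generating a minimal reduction $J$ of $I$ is analytically adjusted.
   Context: A standard graded ring over a field $k$ is a commutative graded $k$-algebra $R=\bigoplus_{i\ge 0}[R]_i$ with $[R]_0=k$, generated by finitely many elements of degree $1$; $\mathfrak{m}=([R]_1)$. A homogeneous ideal $I\subset\mathfrak m$ is $d$-equigenerated if it is minimally generated by forms all of the same degree $d$, i.e. $I=([I]_d)$, where $[\,\cdot\,]_j$ is the degree $j$ piece. The special fiber is $\mathcal{F}(I)=\mathcal{R}_R(I)/\mathfrak{m}\mathcal{R}_R(I)$, where $\mathcal{R}_R(I)=\bigoplus_{i\ge 0}I^it^i$; for $d$-equigenerated $I$ it is isomorphic to the $k$-subalgebra $k[[I]_d]=\bigoplus_{n\ge 0}[I^n]_{nd}\subset R$. The analytic spread is $\ell(I)=\dim\mathcal{F}(I)$. $\mu(\cdot)$ denotes the minimal number of generators. Definition. A set $\{f_1,\ldots,f_l\}\subset[I]_d$ of $k$-linearly independent forms is $l$-adjusted if $\mu(IJ)=l\,\mu(I)-\binom{l}{2}$, where $J=(f_1,\ldots,f_l)$.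 If $l=\ell(I)$, an $l$-adjusted set is called analytically adjusted. *)

theory Defs
  imports "HOL-Algebra.Algebra" "HOL-Library.Extended_Nat"
begin

section \<open>Commutative algebra\<close>

primrec ideal_power :: "('a, 'm) ring_scheme \<Rightarrow> 'a set \<Rightarrow> nat \<Rightarrow> 'a set" where
  "ideal_power R I 0 = carrier R"
| "ideal_power R I (Suc n) = I \<cdot>\<^bsub>R\<^esub> ideal_power R I n"

text \<open>The value is meaningful only for finitely generated ideals.\<close>

definition min_gens :: "('a, 'm) ring_scheme \<Rightarrow> 'a set \<Rightarrow> nat" where
  "min_gens R I = (LEAST n. \<exists>B. B \<subseteq> carrier R \<and> finite B \<and> card B = n \<and> I = Idl\<^bsub>R\<^esub> B)"

text \<open>The middle conjunct says that the \<open>i\<close>-th element is a nonzerodivisor modulo the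
  ideal generated by its predecessors.\<close>

definition regular_sequence :: "('a, 'm) ring_scheme \<Rightarrow> 'a list \<Rightarrow> bool" where
  "regular_sequence R fs \<longleftrightarrow>
     set fs \<subseteq> carrier R \<and>
     (\<forall>i < length fs. \<forall>x \<in> carrier R.
        (fs ! i) \<otimes>\<^bsub>R\<^esub> x \<in> Idl\<^bsub>R\<^esub> (set (take i fs)) \<longrightarrow> x \<in> Idl\<^bsub>R\<^esub> (set (take i fs))) \<and>
     Idl\<^bsub>R\<^esub> (set fs) \<noteq> carrier R"

definition prime_chain :: "('a, 'm) ring_scheme \<Rightarrow> nat \<Rightarrow> (nat \<Rightarrow> 'a set) \<Rightarrow> bool" where
  "prime_chain R n P \<longleftrightarrow> (\<forall>i \<le> n. primeideal (P i) R) \<and> (\<forall>i < n. P i \<subset> P (Suc i))"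

definition krull_dim :: "('a, 'm) ring_scheme \<Rightarrow> enat" where
  "krull_dim R = Sup {enat n | n. \<exists>P. prime_chain R n P}"

definition height :: "('a, 'm) ring_scheme \<Rightarrow> 'a set \<Rightarrow> enat" where
  "height R Q = Sup {enat n | n. \<exists>P. prime_chain R n P \<and> P n = Q}"

definition depth :: "('a, 'm) ring_scheme \<Rightarrow> 'a set \<Rightarrow> enat" where
  "depth R Q = Sup {enat (length fs) | fs. set fs \<subseteq> Q \<and> regular_sequence R fs}"

text \<open>Here \<open>depth R Q\<close> is the length of a longest regular sequence in \<open>Q\<close>. Eisenbud
  (Commutative Algebra, Section 18.2) defines Cohen--Macaulay rings, not necessarily local,
  by this condition on the maximal ideals.\<close>

definition cohen_macaulay :: "('a, 'm) ring_scheme \<Rightarrow> bool" where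
  "cohen_macaulay R \<longleftrightarrow> cring R \<and> noetherian_ring R \<and>
     (\<forall>Q. maximalideal Q R \<longrightarrow> depth R Q = height R Q)"


section \<open>Standard graded rings\<close>

text \<open>The piece \<open>[R]\<^sub>i\<close> is \<open>G i\<close>, and for an ideal \<open>I\<close> the piece \<open>[I]\<^sub>i\<close> is \<open>I \<inter> G i\<close>. The
  coefficient field is a subset of the ring, as \<open>[R]\<^sub>0 = k\<close> suggests. A subring containing
  \<open>K\<close> is the same thing as a \<open>K\<close>-subalgebra.\<close>

locale standard_graded_ring = cring R for R :: "('a, 'm) ring_scheme" (structure) +
  fixes K :: "'a set" and G :: "nat \<Rightarrow> 'a set"
  assumes subfield_K: "subfield K R"
    and piece_subgroup: "\<And>i. additive_subgroup (G i) R"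
    and piece_mult: "\<And>i j a b. a \<in> G i \<Longrightarrow> b \<in> G j \<Longrightarrow> a \<otimes> b \<in> G (i + j)"
    and piece_decomp: "\<And>x. x \<in> carrier R \<Longrightarrow>
      \<exists>!c. (\<forall>i. c i \<in> G i) \<and> finite {i. c i \<noteq> \<zero>} \<and> x = (\<Oplus>i\<in>{i. c i \<noteq> \<zero>}. c i)"
    and piece_0: "G 0 = K"
    and generated_deg1: "\<exists>B. finite B \<and> B \<subseteq> G 1 \<and> carrier R = generate_ring R (K \<union> B)"

definition irrelevant_ideal :: "('a, 'm) ring_scheme \<Rightarrow> (nat \<Rightarrow> 'a set) \<Rightarrow> 'a set" where
  "irrelevant_ideal R G = Idl\<^bsub>R\<^esub> (G 1)"

definition homogeneous_ideal :: "('a, 'm) ring_scheme \<Rightarrow> (nat \<Rightarrow> 'a set) \<Rightarrow> 'a set \<Rightarrow> bool" where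
  "homogeneous_ideal R G I \<longleftrightarrow> ideal I R \<and> I = Idl\<^bsub>R\<^esub> (I \<inter> (\<Union>i. G i))"

definition equigenerated ::
  "('a, 'm) ring_scheme \<Rightarrow> (nat \<Rightarrow> 'a set) \<Rightarrow> nat \<Rightarrow> 'a set \<Rightarrow> bool" where
  "equigenerated R G d I \<longleftrightarrow>
     homogeneous_ideal R G I \<and> I \<subseteq> irrelevant_ideal R G \<and> I = Idl\<^bsub>R\<^esub> (I \<inter> G d)"

text \<open>The algebra \<open>k[[I]\<^sub>d]\<close> inside \<open>R\<close>.\<close>

definition fiber_subalgebra ::
  "('a, 'm) ring_scheme \<Rightarrow> 'a set \<Rightarrow> (nat \<Rightarrow> 'a set) \<Rightarrow> nat \<Rightarrow> 'a set \<Rightarrow> ('a, 'm) ring_scheme" where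
  "fiber_subalgebra R K G d I = R\<lparr>carrier := generate_ring R (K \<union> (I \<inter> G d))\<rparr>"


section \<open>Rees algebra, special fiber, reductions\<close>

text \<open>The Rees algebra as the subring of \<open>R[t]\<close> of the polynomials whose \<open>i\<close>-th coefficient
  lies in \<open>I\<^sup>i\<close>.\<close>

definition rees_algebra :: "('a, 'm) ring_scheme \<Rightarrow> 'a set \<Rightarrow> ('a, nat \<Rightarrow> 'a) up_ring" where
  "rees_algebra R I =
     (UP R)\<lparr>carrier := {p \<in> carrier (UP R). \<forall>i. coeff (UP R) p i \<in> ideal_power R I i}\<rparr>"

definition special_fiber ::
  "('a, 'm) ring_scheme \<Rightarrow> (nat \<Rightarrow> 'a set) \<Rightarrow> 'a set \<Rightarrow> (nat \<Rightarrow> 'a) set ring" where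
  "special_fiber R G I =
     rees_algebra R I Quot
       (Idl\<^bsub>rees_algebra R I\<^esub> ((\<lambda>a. monom (UP R) a 0) ` irrelevant_ideal R G))"

definition analytic_spread ::
  "('a, 'm) ring_scheme \<Rightarrow> (nat \<Rightarrow> 'a set) \<Rightarrow> 'a set \<Rightarrow> enat" where
  "analytic_spread R G I = krull_dim (special_fiber R G I)"

definition reduction :: "('a, 'm) ring_scheme \<Rightarrow> 'a set \<Rightarrow> 'a set \<Rightarrow> bool" where
  "reduction R I J \<longleftrightarrow> ideal J R \<and> J \<subseteq> I \<and>
     (\<exists>n. ideal_power R I (Suc n) = J \<cdot>\<^bsub>R\<^esub> ideal_power R I n)"

text \<open>Minimality is tested against homogeneous reductions, as usual in the graded setting. For
  a homogeneous ideal this is implied by minimality among all reductions, but not conversely: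
  away from the irrelevant ideal an inhomogeneous reduction may be smaller.\<close>

definition minimal_reduction ::
  "('a, 'm) ring_scheme \<Rightarrow> (nat \<Rightarrow> 'a set) \<Rightarrow> 'a set \<Rightarrow> 'a set \<Rightarrow> bool" where
  "minimal_reduction R G I J \<longleftrightarrow>
     homogeneous_ideal R G J \<and> reduction R I J \<and>
     (\<forall>J'. homogeneous_ideal R G J' \<and> reduction R I J' \<and> J' \<subseteq> J \<longrightarrow> J' = J)"


section \<open>Adjusted sets\<close>

definition independent_set :: "('a, 'm) ring_scheme \<Rightarrow> 'a set \<Rightarrow> 'a set \<Rightarrow> bool" where
  "independent_set R K S \<longleftrightarrow> (\<exists>us. distinct us \<and> set us = S \<and> ring.independent R K us)"

text \<open>The count is an equation of integers, so that the subtraction is not truncated.\<close>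

definition adjusted ::
  "('a, 'm) ring_scheme \<Rightarrow> 'a set \<Rightarrow> (nat \<Rightarrow> 'a set) \<Rightarrow> nat \<Rightarrow> 'a set \<Rightarrow> nat \<Rightarrow> 'a set \<Rightarrow> bool" where
  "adjusted R K G d I l S \<longleftrightarrow>
     finite S \<and> card S = l \<and> S \<subseteq> I \<inter> G d \<and> independent_set R K S \<and>
     int (min_gens R (I \<cdot>\<^bsub>R\<^esub> (Idl\<^bsub>R\<^esub> S))) = int l * int (min_gens R I) - int (l choose 2)"

definition analytically_adjusted ::
  "('a, 'm) ring_scheme \<Rightarrow> 'a set \<Rightarrow> (nat \<Rightarrow> 'a set) \<Rightarrow> nat \<Rightarrow> 'a set \<Rightarrow> 'a set \<Rightarrow> bool" where
  "analytically_adjusted R K G d I S \<longleftrightarrow>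
     (\<exists>l. enat l = analytic_spread R G I \<and> adjusted R K G d I l S)"

end

theory Submission
  imports Defs
begin

text \<open>Write \<open>V\<close> for the degree \<open>d\<close> piece of \<open>I\<close>, \<open>A\<close> for the algebra \<open>k[V]\<close>, \<open>m = \<mu>(I) = dim V\<close>, and let
\<open>J\<close> be generated by \<open>f\<^sub>1, \<dots>, f\<^sub>l \<in> V\<close>. The ideal \<open>I J\<close> is generated in degree \<open>2 d\<close> by the vector space
\<open>E\<^sub>l = f\<^sub>1 V + \<dots> + f\<^sub>l V\<close>, so \<open>\<mu>(I J) = dim E\<^sub>l\<close> (\<open>prod_genideal\<close>, \<open>min_gens_genideal\<close>). Passing from
\<open>E\<^sub>i\<^sub>-\<^sub>1\<close> to \<open>E\<^sub>i\<close> adds \<open>m\<close> minus the dimension of the space of all \<open>v \<in> V\<close> with \<open>f\<^sub>i v \<in> E\<^sub>i\<^sub>-\<^sub>1\<close>. By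
commutativity this space contains \<open>f\<^sub>1, \<dots>, f\<^sub>i\<^sub>-\<^sub>1\<close>. If the \<open>f\<^sub>i\<close> are independent and it is never larger
than their span, the dimensions add up to \<open>m + (m - 1) + \<dots> + (m - l + 1) = l m - (l choose 2)\<close>
(\<open>adjusted_if_no_extra_relations\<close>). If the \<open>f\<^sub>i\<close> form a regular sequence in \<open>A\<close>, then
\<open>f\<^sub>i v \<in> E\<^sub>i\<^sub>-\<^sub>1\<close> forces \<open>v\<close> into the ideal of \<open>A\<close> generated by \<open>f\<^sub>1, \<dots>, f\<^sub>i\<^sub>-\<^sub>1\<close>, whose part of degree \<open>d\<close>
is the span in question. This is \<open>regular_sequence_adjusted\<close>.

For the second claim the special fiber is identified with \<open>A\<close> (\<open>special_fiber_iso\<close>). Let \<open>\<ell>\<close> be its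
dimension, and let \<open>x\<^sub>1, \<dots>, x\<^sub>\<ell> \<in> V\<close> generate a reduction. Then every element of the maximal ideal \<open>A\<^sub>+\<close> of
elements without constant term has a power in \<open>(x\<^sub>1, \<dots>, x\<^sub>\<ell>)\<close>
(\<open>positive_part_nilpotent_mod_reduction\<close>). Every chain of primes of \<open>A\<close> can be exchanged for one
of the same length that ends in \<open>A\<^sub>+\<close> (\<open>prime_chain_to_positive_part\<close>), so \<open>A\<^sub>+\<close> has height at least \<open>\<ell>\<close>
and, \<open>A\<close> being Cohen--Macaulay, contains a regular sequence \<open>y\<^sub>1, \<dots>, y\<^sub>\<ell>\<close>. It may well be
inhomogeneous and need not lie in the span of the \<open>x\<^sub>i\<close>. The two systems are compared through the Koszul
complex of \<open>x\<close>: since powers of the \<open>y\<^sub>j\<close> lie in \<open>(x)\<close>, a descending induction along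
\<open>A, A/(y\<^sub>1), A/(y\<^sub>1, y\<^sub>2), \<dots>\<close> shows that its first homology over \<open>A\<close> vanishes (\<open>koszul_acyclic\<close>).
So every relation among the \<open>x\<^sub>i\<close> has the form \<open>a\<^sub>i = \<Sum>\<^sub>j c\<^sub>i\<^sub>j x\<^sub>j\<close> with \<open>c\<close> alternating. For constant
\<open>a\<^sub>i\<close> this gives independence, because \<open>A\<^sub>+\<close> contains no nonzero constant. For
\<open>a\<^sub>i \<in> V\<close> the \<open>c\<^sub>i\<^sub>j\<close> may be taken constant, and the relation is one of those already counted above (\<open>parameters_adjusted\<close>).\<close>

section \<open>Koszul homology\<close>

context cring
begin

text \<open>A chain is a function on subsets of the index set, encoded as lists of booleans. With this
encoding the complex of \<open>x # xs\<close> is visibly the mapping cone of multiplication by \<open>x\<close> on the complex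
of \<open>xs\<close>: the two halves of a chain are its values on the lists starting with \<open>False\<close> and with \<open>True\<close>.
The signs are those of the cone, so facts about the complex follow by induction on the list.\<close>

primrec koszul_d :: "'a list \<Rightarrow> (bool list \<Rightarrow> 'a) \<Rightarrow> bool list \<Rightarrow> 'a" where
  "koszul_d [] z L = \<zero>"
| "koszul_d (x # xs) z L = (case L of [] \<Rightarrow> \<zero> | b # M \<Rightarrow>
     if b then \<ominus> koszul_d xs (\<lambda>N. z (True # N)) M
     else koszul_d xs (\<lambda>N. z (False # N)) M \<oplus> x \<otimes> z (True # M))"

text \<open>Exterior multiplication by the element with coordinates \<open>rs\<close>.\<close>

primrec koszul_h :: "'a list \<Rightarrow> (bool list \<Rightarrow> 'a) \<Rightarrow> bool list \<Rightarrow> 'a" where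
  "koszul_h [] z L = \<zero>"
| "koszul_h (r # rs) z L = (case L of [] \<Rightarrow> \<zero> | b # M \<Rightarrow>
     if b then r \<otimes> z (False # M) \<ominus> koszul_h rs (\<lambda>N. z (True # N)) M
     else koszul_h rs (\<lambda>N. z (False # N)) M)"

primrec dot :: "'a list \<Rightarrow> 'a list \<Rightarrow> 'a" where
  "dot [] rs = \<zero>"
| "dot (x # xs) rs = (case rs of [] \<Rightarrow> \<zero> | r # ss \<Rightarrow> x \<otimes> r \<oplus> dot xs ss)"

lemma koszul_d_closed [simp]:
  assumes "set xs \<subseteq> carrier R" "\<And>L. z L \<in> carrier R"
  shows "koszul_d xs z L \<in> carrier R"
  using assms by (induction xs arbitrary: z L) (auto split: list.split)

lemma koszul_h_closed [simp]:
  assumes "set rs \<subseteq> carrier R" "\<And>L. z L \<in> carrier R"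
  shows "koszul_h rs z L \<in> carrier R"
  using assms by (induction rs arbitrary: z L) (auto split: list.split)

lemma dot_closed [simp]:
  "set xs \<subseteq> carrier R \<Longrightarrow> set rs \<subseteq> carrier R \<Longrightarrow> dot xs rs \<in> carrier R"
  by (induction xs arbitrary: rs) (auto split: list.split)

lemma koszul_d_add:
  assumes "set xs \<subseteq> carrier R" "\<And>L. z L \<in> carrier R" "\<And>L. w L \<in> carrier R"
  shows "koszul_d xs (\<lambda>L. z L \<oplus> w L) L = koszul_d xs z L \<oplus> koszul_d xs w L"
  using assms
proof (induction xs arbitrary: z w L)
  case (Cons x xs)
  then show ?case by (auto split: list.split simp: minus_add r_distr a_ac)
qed simp

lemma koszul_d_smult:
  assumes "set xs \<subseteq> carrier R" "\<And>L. z L \<in> carrier R" "c \<in> carrier R"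
  shows "koszul_d xs (\<lambda>L. c \<otimes> z L) L = c \<otimes> koszul_d xs z L"
  using assms
proof (induction xs arbitrary: z L)
  case (Cons x xs)
  then show ?case by (auto split: list.split simp: r_distr r_minus m_lcomm)
qed simp

lemma koszul_d_uminus:
  assumes "set xs \<subseteq> carrier R" "\<And>L. z L \<in> carrier R"
  shows "koszul_d xs (\<lambda>L. \<ominus> z L) L = \<ominus> koszul_d xs z L"
  using assms
proof (induction xs arbitrary: z L)
  case (Cons x xs)
  then show ?case by (auto split: list.split simp: minus_add r_minus)
qed simp

lemma koszul_d_d:
  assumes "set xs \<subseteq> carrier R" "\<And>L. z L \<in> carrier R"
  shows "koszul_d xs (koszul_d xs z) L = \<zero>"
  using assms
proof (induction xs arbitrary: z L)
  case (Cons x xs)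
  show ?case
  proof (cases L)
    case (Cons b M)
    then show ?thesis
      using Cons.IH Cons.prems
      by (auto simp: koszul_d_add koszul_d_smult koszul_d_uminus a_assoc r_minus r_neg)
  qed simp
qed simp

lemma koszul_h_add:
  assumes "set xs \<subseteq> carrier R" "\<And>L. z L \<in> carrier R" "\<And>L. w L \<in> carrier R"
  shows "koszul_h xs (\<lambda>L. z L \<oplus> w L) L = koszul_h xs z L \<oplus> koszul_h xs w L"
  using assms
proof (induction xs arbitrary: z w L)
  case (Cons x xs)
  then show ?case by (auto split: list.split simp: minus_add minus_eq r_distr a_ac)
qed simp

lemma koszul_h_smult:
  assumes "set xs \<subseteq> carrier R" "\<And>L. z L \<in> carrier R" "c \<in> carrier R"
  shows "koszul_h xs (\<lambda>L. c \<otimes> z L) L = c \<otimes> koszul_h xs z L"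
  using assms
proof (induction xs arbitrary: z L)
  case (Cons x xs)
  then show ?case by (auto split: list.split simp: r_distr r_minus minus_eq m_lcomm)
qed simp

lemma koszul_h_uminus:
  assumes "set xs \<subseteq> carrier R" "\<And>L. z L \<in> carrier R"
  shows "koszul_h xs (\<lambda>L. \<ominus> z L) L = \<ominus> koszul_h xs z L"
  using assms
proof (induction xs arbitrary: z L)
  case (Cons x xs)
  then show ?case by (auto split: list.split simp: minus_add minus_eq r_minus)
qed simp

text \<open>Cartan's formula. It makes Koszul homology a module annihilated by the ideal of \<open>xs\<close>.\<close>

lemma koszul_homotopy:
  assumes "set xs \<subseteq> carrier R" "set rs \<subseteq> carrier R" "\<And>L. z L \<in> carrier R"
    and "length rs = length xs" "length L = length xs"
  shows "koszul_d xs (koszul_h rs z) L \<oplus> koszul_h rs (koszul_d xs z) L = dot xs rs \<otimes> z L"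
  using assms
proof (induction xs arbitrary: rs z L)
  case (Cons x xs rs0 z L0)
  obtain r rs where rs0: "rs0 = r # rs" using Cons.prems by (cases rs0) auto
  obtain b L where L0: "L0 = b # L" using Cons.prems by (cases L0) auto
  have c: "x \<in> carrier R" "set xs \<subseteq> carrier R" "r \<in> carrier R" "set rs \<subseteq> carrier R"
    "\<And>L. z L \<in> carrier R" "length rs = length xs" "length L = length xs"
    using Cons.prems rs0 L0 by auto
  note IH = Cons.IH[OF c(2,4) _ c(6,7)]
  show ?case
  proof (cases b)
    case True
    let ?z0 = "\<lambda>N. z (False # N)" and ?z1 = "\<lambda>N. z (True # N)"
    define A where "A = koszul_d xs (koszul_h rs ?z1) L"
    define B where "B = koszul_h rs (koszul_d xs ?z1) L"
    define C where "C = koszul_d xs ?z0 L"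
    have car: "A \<in> carrier R" "B \<in> carrier R" "C \<in> carrier R"
      unfolding A_def B_def C_def using c by auto
    have AB: "A \<oplus> B = dot xs rs \<otimes> z (True # L)" unfolding A_def B_def using IH c by auto
    have 1: "koszul_d (x # xs) (koszul_h (r # rs) z) (True # L) = \<ominus> (r \<otimes> C \<ominus> A)"
      using c by (simp add: minus_eq koszul_d_add koszul_d_smult koszul_d_uminus A_def C_def)
    have 2: "koszul_h (r # rs) (koszul_d (x # xs) z) (True # L) = r \<otimes> (C \<oplus> x \<otimes> z (True # L)) \<oplus> B"
      using c by (simp add: minus_eq koszul_h_uminus B_def C_def)
    have "\<ominus> (r \<otimes> C \<ominus> A) \<oplus> (r \<otimes> (C \<oplus> x \<otimes> z (True # L)) \<oplus> B)
      = r \<otimes> (x \<otimes> z (True # L)) \<oplus> (A \<oplus> B)"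
      using car c by algebra
    also have "\<dots> = (x \<otimes> r \<oplus> dot xs rs) \<otimes> z (True # L)"
      unfolding AB using c dot_closed[OF c(2,4)] by algebra
    finally show ?thesis using True rs0 L0 1 2 by simp
  next
    case False
    let ?z0 = "\<lambda>N. z (False # N)" and ?z1 = "\<lambda>N. z (True # N)"
    define A where "A = koszul_d xs (koszul_h rs ?z0) L"
    define B where "B = koszul_h rs (koszul_d xs ?z0) L"
    define C where "C = koszul_h rs ?z1 L"
    have car: "A \<in> carrier R" "B \<in> carrier R" "C \<in> carrier R"
      unfolding A_def B_def C_def using c by auto
    have AB: "A \<oplus> B = dot xs rs \<otimes> z (False # L)" unfolding A_def B_def using IH c by auto
    have 1: "koszul_d (x # xs) (koszul_h (r # rs) z) (False # L) = A \<oplus> x \<otimes> (r \<otimes> z (False # L) \<ominus> C)"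
      using c by (simp add: A_def C_def)
    have 2: "koszul_h (r # rs) (koszul_d (x # xs) z) (False # L) = B \<oplus> x \<otimes> C"
      using c by (simp add: koszul_h_add koszul_h_smult B_def C_def)
    have "(A \<oplus> x \<otimes> (r \<otimes> z (False # L) \<ominus> C)) \<oplus> (B \<oplus> x \<otimes> C)
      = x \<otimes> (r \<otimes> z (False # L)) \<oplus> (A \<oplus> B)"
      using car c by algebra
    also have "\<dots> = (x \<otimes> r \<oplus> dot xs rs) \<otimes> z (False # L)"
      unfolding AB using c dot_closed[OF c(2,4)] by algebra
    finally show ?thesis using False rs0 L0 1 2 by simp
  qed
qed simp

text \<open>The basis elements of degree \<open>p\<close>; a chain is used as a \<open>p\<close>-chain when only its values on these
matter.\<close>

abbreviation cells :: "nat \<Rightarrow> nat \<Rightarrow> bool list set" where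
  "cells n p \<equiv> {L. length L = n \<and> length (filter (\<lambda>b. b) L) = p}"

lemma koszul_d_in_ideal:
  assumes "ideal Y R" "set xs \<subseteq> carrier R" "L \<in> cells (length xs) p"
    and "\<And>M. M \<in> cells (length xs) (Suc p) \<Longrightarrow> z M \<in> Y"
  shows "koszul_d xs z L \<in> Y"
  using assms(2-)
proof (induction xs arbitrary: z L p)
  case Nil
  then show ?case using assms(1) by (simp add: additive_subgroup.zero_closed ideal.axioms(1))
next
  case (Cons x xs z L0 p)
  interpret Y: ideal Y R by fact
  obtain b L where L0: "L0 = b # L" using Cons.prems by (cases L0) auto
  show ?case
  proof (cases b)
    case True
    define p' where "p' = p - 1"
    have p: "p = Suc p'" "L \<in> cells (length xs) p'"
      using Cons.prems(2) L0 True unfolding p'_def by auto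
    have "koszul_d xs (\<lambda>N. z (True # N)) L \<in> Y"
      by (rule Cons.IH[of _ p']) (use p Cons.prems in auto)
    then show ?thesis using True L0 by (simp add: Y.a_inv_closed)
  next
    case False
    have "koszul_d xs (\<lambda>N. z (False # N)) L \<in> Y"
      by (rule Cons.IH[of _ p]) (use False L0 Cons.prems in auto)
    moreover have "z (True # L) \<in> Y" using False L0 Cons.prems by auto
    ultimately show ?thesis using False L0 Cons.prems(1) by (simp add: Y.I_l_closed)
  qed
qed

lemma koszul_h_in_ideal:
  assumes "ideal Y R" "set rs \<subseteq> carrier R" "L \<in> cells (length rs) (Suc p)"
    and "\<And>M. M \<in> cells (length rs) p \<Longrightarrow> z M \<in> Y"
  shows "koszul_h rs z L \<in> Y"
  using assms(2-)
proof (induction rs arbitrary: z L p)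
  case Nil
  then show ?case using assms(1) by (simp add: additive_subgroup.zero_closed ideal.axioms(1))
next
  case (Cons x xs z L0 p)
  interpret Y: ideal Y R by fact
  obtain b L where L0: "L0 = b # L" using Cons.prems by (cases L0) auto
  show ?case
  proof (cases b)
    case True
    have "koszul_h xs (\<lambda>N. z (True # N)) L \<in> Y"
    proof (cases p)
      case 0
      have "koszul_h rs z' (replicate (length rs) False) = \<zero>" for rs and z' :: "bool list \<Rightarrow> 'a"
        by (induction rs arbitrary: z') auto
      moreover have "L = replicate (length xs) False"
        using Cons.prems(2) True L0 0
        by (auto simp: filter_empty_conv intro!: replicate_eqI)
      ultimately show ?thesis by simp
    next
      case (Suc p')
      show ?thesis by (rule Cons.IH[of _ p']) (use Suc True L0 Cons.prems in auto)
    qed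
    moreover have "z (False # L) \<in> Y" using True L0 Cons.prems by auto
    ultimately show ?thesis using True L0 Cons.prems(1)
      by (simp add: Y.I_l_closed minus_eq Y.a_inv_closed)
  next
    case False
    have "koszul_h xs (\<lambda>N. z (False # N)) L \<in> Y"
      by (rule Cons.IH[of _ p]) (use False L0 Cons.prems in auto)
    then show ?thesis using False L0 by simp
  qed
qed

text \<open>Let \<open>Y q\<close> be the ideal generated by the first \<open>q\<close> members of the regular sequence \<open>y\<close>. The claim is
that the homology of degree \<open>q + 1\<close> with coefficients modulo \<open>Y q\<close> vanishes. There are no chains of
degree above the number of elements \<open>xs\<close>, which starts a descending induction on \<open>q\<close>. In the step,
multiplication by \<open>y q\<close> is injective modulo \<open>Y q\<close>, so the long exact sequence makes the homology of degree
\<open>q + 2\<close> modulo \<open>Y (q + 1)\<close> surject onto the kernel of \<open>y q\<close> on the homology of degree \<open>q + 1\<close> modulo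
\<open>Y q\<close>. The former vanishes, so \<open>y q\<close> acts injectively on the latter; but some power of it acts as zero.\<close>

lemma koszul_acyclic:
  fixes Y :: "nat \<Rightarrow> 'a set" and y :: "nat \<Rightarrow> 'a"
  assumes xs: "set xs \<subseteq> carrier R"
    and Y: "\<And>i. i \<le> length xs \<Longrightarrow> ideal (Y i) R"
    and y: "\<And>i. i < length xs \<Longrightarrow> y i \<in> carrier R"
    and mono: "\<And>i. i < length xs \<Longrightarrow> Y i \<subseteq> Y (Suc i)"
    and yY: "\<And>i. i < length xs \<Longrightarrow> y i \<in> Y (Suc i)"
    and Ysplit: "\<And>i a. i < length xs \<Longrightarrow> a \<in> Y (Suc i) \<Longrightarrow>
       \<exists>u\<in>carrier R. a \<ominus> y i \<otimes> u \<in> Y i"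
    and nzd: "\<And>i a. i < length xs \<Longrightarrow> a \<in> carrier R \<Longrightarrow> y i \<otimes> a \<in> Y i \<Longrightarrow> a \<in> Y i"
    and pow: "\<And>i. i < length xs \<Longrightarrow> \<exists>n rs. set rs \<subseteq> carrier R \<and> length rs = length xs \<and>
        y i [^] (n::nat) = dot xs rs"
    and q: "q \<le> length xs"
    and z: "\<And>L. z L \<in> carrier R"
    and cyc: "\<And>L. L \<in> cells (length xs) q \<Longrightarrow> koszul_d xs z L \<in> Y q"
  shows "\<exists>w. (\<forall>L. w L \<in> carrier R) \<and>
     (\<forall>L \<in> cells (length xs) (Suc q). z L \<ominus> koszul_d xs w L \<in> Y q)"
  using q z cyc
proof (induction q arbitrary: z rule: inc_induct)
  case base
  have "\<not> length (filter (\<lambda>b. b) L) = Suc (length xs)" if "length L = length xs" for L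
    using length_filter_le[of "\<lambda>b. b" L] that by linarith
  then have "cells (length xs) (Suc (length xs)) = {}" by blast
  then have "\<forall>L \<in> cells (length xs) (Suc (length xs)). z L \<ominus> koszul_d xs (\<lambda>_. \<zero>) L \<in> Y (length xs)"
    by blast
  then show ?case by (intro exI[of _ "\<lambda>_. \<zero>"] conjI allI zero_closed)
next
  case (step q)
  have ql: "q < length xs" using step by simp
  interpret Yq: ideal "Y q" R using Y ql by simp
  interpret Yq': ideal "Y (Suc q)" R using Y ql by simp
  note [simp] = y[OF ql]
  \<comment> \<open>The snake argument: whenever \<open>y q ^ (t + 1)\<close> times the cycle \<open>z\<close> bounds, so does \<open>y q ^ t\<close> times \<open>z\<close>.\<close>
  have descend: "\<exists>w. (\<forall>L. w L \<in> carrier R) \<and>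
     (\<forall>L \<in> cells (length xs) (Suc q). z L \<ominus> koszul_d xs w L \<in> Y q)"
    if "\<And>L. h L \<in> carrier R"
      "\<And>L. L \<in> cells (length xs) (Suc q) \<Longrightarrow> y q [^] (t::nat) \<otimes> z L \<ominus> koszul_d xs h L \<in> Y q"
    for t h
    using that
  proof (induction t arbitrary: h)
    case 0
    then show ?case using step.prems(1) by (intro exI[of _ h]) auto
  next
    case (Suc t h)
    note zc = step.prems(1)
    have dh: "koszul_d xs h L \<in> Y (Suc q)" if "L \<in> cells (length xs) (Suc q)" for L
    proof -
      define a b where "a = y q [^] t \<otimes> z L" and "b = koszul_d xs h L"
      have c: "a \<in> carrier R" "b \<in> carrier R" using zc Suc.prems xs by (auto simp: a_def b_def)
      have "y q \<otimes> a \<ominus> b \<in> Y (Suc q)"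
        using Suc.prems(2)[OF that] mono[OF ql] zc[of L] by (auto simp: a_def b_def m_ac)
      moreover have "y q \<otimes> a \<in> Y (Suc q)" using yY[OF ql] c by (simp add: Yq'.I_r_closed)
      ultimately have "y q \<otimes> a \<ominus> (y q \<otimes> a \<ominus> b) \<in> Y (Suc q)"
        by (simp add: minus_eq Yq'.a_inv_closed)
      moreover have "y q \<otimes> a \<ominus> (y q \<otimes> a \<ominus> b) = b" using c y[OF ql] by algebra
      ultimately show ?thesis by (simp add: b_def)
    qed
    obtain w where w: "\<And>L. w L \<in> carrier R"
      "\<And>L. L \<in> cells (length xs) (Suc (Suc q)) \<Longrightarrow> h L \<ominus> koszul_d xs w L \<in> Y (Suc q)"
      using step.IH[of h] Suc.prems(1) dh by blast
    have "\<forall>L. \<exists>u. u \<in> carrier R \<and> (L \<in> cells (length xs) (Suc (Suc q)) \<longrightarrow>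
      h L \<ominus> koszul_d xs w L \<ominus> y q \<otimes> u \<in> Y q)"
    proof
      fix L
      show "\<exists>u. u \<in> carrier R \<and> (L \<in> cells (length xs) (Suc (Suc q)) \<longrightarrow>
        h L \<ominus> koszul_d xs w L \<ominus> y q \<otimes> u \<in> Y q)"
        using Ysplit[OF ql w(2)[of L]] by (cases "L \<in> cells (length xs) (Suc (Suc q))") auto
    qed
    from choice[OF this] obtain u where u: "\<And>L. u L \<in> carrier R"
      "\<And>L. L \<in> cells (length xs) (Suc (Suc q)) \<Longrightarrow> h L \<ominus> koszul_d xs w L \<ominus> y q \<otimes> u L \<in> Y q"
      by blast
    have "y q [^] t \<otimes> z L \<ominus> koszul_d xs u L \<in> Y q" if L: "L \<in> cells (length xs) (Suc q)" for L
    proof -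
      have "koszul_d xs (\<lambda>L. h L \<ominus> koszul_d xs w L \<ominus> y q \<otimes> u L) L \<in> Y q"
        by (rule koszul_d_in_ideal[OF Yq.ideal_axioms xs L u(2)])
      moreover have "koszul_d xs (\<lambda>L. h L \<ominus> koszul_d xs w L \<ominus> y q \<otimes> u L) L
        = koszul_d xs h L \<ominus> y q \<otimes> koszul_d xs u L"
        using xs Suc.prems(1) w(1) u(1)
        by (simp add: minus_eq koszul_d_add koszul_d_uminus koszul_d_smult koszul_d_d)
      ultimately have 1: "koszul_d xs h L \<ominus> y q \<otimes> koszul_d xs u L \<in> Y q" by simp
      define a b c where "a = y q [^] t \<otimes> z L" and "b = koszul_d xs h L" and "c = koszul_d xs u L"
      have car: "a \<in> carrier R" "b \<in> carrier R" "c \<in> carrier R"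
        using zc Suc.prems xs u by (auto simp: a_def b_def c_def)
      have "y q \<otimes> a \<ominus> b \<in> Y q"
        using Suc.prems(2)[OF L] zc[of L] y[OF ql] by (simp only: a_def b_def nat_pow_Suc m_assoc m_comm m_lcomm nat_pow_closed)
      then have "(y q \<otimes> a \<ominus> b) \<oplus> (b \<ominus> y q \<otimes> c) \<in> Y q"
        using 1 unfolding b_def c_def by (rule Yq.a_closed)
      moreover have "(y q \<otimes> a \<ominus> b) \<oplus> (b \<ominus> y q \<otimes> c) = y q \<otimes> (a \<ominus> c)"
        using car y[OF ql] by algebra
      ultimately have "y q \<otimes> (a \<ominus> c) \<in> Y q" by (simp only:)
      from nzd[OF ql minus_closed[OF car(1,3)] this] show ?thesis unfolding a_def c_def .
    qed
    then show ?case using Suc.IH[of u] u(1) by blast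
  qed
  \<comment> \<open>By the homotopy formula the power of \<open>y q\<close> that lies in the ideal of \<open>xs\<close> turns \<open>z\<close> into a boundary.\<close>
  obtain n rs where rs: "set rs \<subseteq> carrier R" "length rs = length xs" "y q [^] (n::nat) = dot xs rs"
    using pow[OF ql] by blast
  show ?case
  proof (rule descend[of "koszul_h rs z" n])
    show "koszul_h rs z L \<in> carrier R" for L using rs step.prems by simp
    fix L assume L: "L \<in> cells (length xs) (Suc q)"
    have "koszul_h rs (koszul_d xs z) L \<in> Y q"
      by (rule koszul_h_in_ideal[OF Yq.ideal_axioms rs(1), where p=q]) (use L rs step.prems in auto)
    moreover have "y q [^] n \<otimes> z L \<ominus> koszul_d xs (koszul_h rs z) L = koszul_h rs (koszul_d xs z) L"
    proof -
      have "koszul_d xs (koszul_h rs z) L \<oplus> koszul_h rs (koszul_d xs z) L = y q [^] n \<otimes> z L"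
        using koszul_homotopy[OF xs rs(1) step.prems(1) rs(2), of L] L rs(3) by simp
      moreover have "koszul_d xs (koszul_h rs z) L \<in> carrier R" "koszul_h rs (koszul_d xs z) L \<in> carrier R"
        using xs rs step.prems by auto
      ultimately show ?thesis
        by (metis add.inv_solve_right add.m_comm minus_eq a_closed)
    qed
    ultimately show "y q [^] n \<otimes> z L \<ominus> koszul_d xs (koszul_h rs z) L \<in> Y q" by simp
  qed
qed

text \<open>The singleton subset \<open>{i}\<close> of an index set with \<open>n\<close> elements.\<close>

abbreviation cell :: "nat \<Rightarrow> nat \<Rightarrow> bool list" where
  "cell n i \<equiv> (replicate n False)[i := True]"

lemma koszul_d_vertex:
  assumes "set xs \<subseteq> carrier R" "\<And>L. z L \<in> carrier R"
  shows "koszul_d xs z (replicate (length xs) False)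
    = dot xs (map (\<lambda>j. z (cell (length xs) j)) [0..<length xs])"
  using assms
proof (induction xs arbitrary: z)
  case (Cons x xs)
  have upt: "[0..<length (x # xs)] = 0 # map Suc [0..<length xs]"
    by (metis length_Cons map_Suc_upt upt_conv_Cons zero_less_Suc)
  have IH: "koszul_d xs (\<lambda>N. z (False # N)) (replicate (length xs) False)
    = dot xs (map (\<lambda>j. z (False # cell (length xs) j)) [0..<length xs])"
    using Cons by simp
  have "set (map (\<lambda>j. z (False # cell (length xs) j)) [0..<length xs]) \<subseteq> carrier R"
    using Cons.prems by auto
  then have "dot xs (map (\<lambda>j. z (False # cell (length xs) j)) [0..<length xs]) \<in> carrier R"
    using Cons.prems by simp
  then show ?case unfolding upt using Cons.prems IH by (simp add: comp_def a_comm)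
qed simp

lemma dot_uminus:
  assumes "set xs \<subseteq> carrier R" "\<And>i. f i \<in> carrier R"
  shows "dot xs (map (\<lambda>i. \<ominus> f i) js) = \<ominus> dot xs (map f js)"
  using assms
proof (induction xs arbitrary: js)
  case (Cons x xs)
  have "dot xs (map f js) \<in> carrier R" for js
    using Cons.prems by (intro dot_closed) auto
  then show ?case using Cons by (auto split: list.split simp: minus_add r_minus)
qed simp

text \<open>A boundary of degree one is a combination of the trivial relations \<open>x\<^sub>j e\<^sub>i - x\<^sub>i e\<^sub>j\<close>; up to sign, the
coefficient \<open>c i j\<close> is the value of \<open>w\<close> at the subset \<open>{i, j}\<close>.\<close>

lemma koszul_d_edge:
  assumes "set xs \<subseteq> carrier R" "\<And>L. w L \<in> carrier R"
  shows "\<exists>c. (\<forall>i j. c i j \<in> carrier R) \<and> (\<forall>i. c i i = \<zero>) \<and> (\<forall>i j. c i j = \<ominus> c j i) \<and>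
    (\<forall>i < length xs. koszul_d xs w (cell (length xs) i) = dot xs (map (c i) [0..<length xs]))"
  using assms
proof (induction xs arbitrary: w)
  case Nil
  show ?case by (intro exI[of _ "\<lambda>i j. \<zero>"]) auto
next
  case (Cons x xs)
  let ?n = "length xs"
  let ?v = "\<lambda>j. w (True # cell ?n j)"
  obtain c where c: "\<And>i j. c i j \<in> carrier R" "\<And>i. c i i = \<zero>" "\<And>i j. c i j = \<ominus> c j i"
    "\<And>i. i < ?n \<Longrightarrow> koszul_d xs (\<lambda>N. w (False # N)) (cell ?n i) = dot xs (map (c i) [0..<?n])"
  proof -
    have "set xs \<subseteq> carrier R" "\<And>L. w (False # L) \<in> carrier R" using Cons.prems by auto
    from Cons.IH[of "\<lambda>N. w (False # N)", OF this] show ?thesis using that by blast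
  qed
  \<comment> \<open>Index 0 belongs to the new element \<open>x\<close>; its row and column come from the \<open>True\<close> half of \<open>w\<close>.\<close>
  define c' where "c' i j = (case i of 0 \<Rightarrow> (case j of 0 \<Rightarrow> \<zero> | Suc j \<Rightarrow> \<ominus> ?v j)
    | Suc i \<Rightarrow> (case j of 0 \<Rightarrow> ?v i | Suc j \<Rightarrow> c i j))" for i j
  have upt: "[0..<length (x # xs)] = 0 # map Suc [0..<?n]"
    by (metis length_Cons map_Suc_upt upt_conv_Cons zero_less_Suc)
  have 1: "koszul_d (x # xs) w (cell (length (x # xs)) i) = dot (x # xs) (map (c' i) [0..<length (x # xs)])"
    if "i < length (x # xs)" for i
  proof (cases i)
    case 0
    have "koszul_d (x # xs) w (cell (length (x # xs)) i) = \<ominus> dot xs (map ?v [0..<?n])"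
      using 0 using Cons.prems by (simp add: koszul_d_vertex)
    also have "\<dots> = dot (x # xs) (map (c' i) [0..<length (x # xs)])"
    proof -
      have "dot xs (map ?v [0..<?n]) \<in> carrier R" using Cons.prems by (intro dot_closed) auto
      then show ?thesis unfolding upt using 0 Cons.prems by (simp add: c'_def comp_def dot_uminus)
    qed
    finally show ?thesis .
  next
    case (Suc k)
    have k: "k < ?n" using Suc that by simp
    have "koszul_d (x # xs) w (cell (length (x # xs)) i) = dot xs (map (c k) [0..<?n]) \<oplus> x \<otimes> ?v k"
      using Suc c(4)[OF k] by simp
    also have "\<dots> = x \<otimes> ?v k \<oplus> dot xs (map (c k) [0..<?n])"
    proof (rule a_comm)
      have "set (map (c k) [0..<?n]) \<subseteq> carrier R" using c(1) by auto
      then show "dot xs (map (c k) [0..<?n]) \<in> carrier R" using Cons.prems by simp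
    qed (use Cons.prems in auto)
    also have "\<dots> = dot (x # xs) (map (c' i) [0..<length (x # xs)])"
      unfolding upt using Suc by (simp add: c'_def comp_def)
    finally show ?thesis .
  qed
  have 2: "c' i j \<in> carrier R" for i j
    using c(1) Cons.prems by (auto simp: c'_def split: nat.split)
  have 3: "c' i i = \<zero>" for i
    using c(2) by (auto simp: c'_def split: nat.split)
  have 4: "c' i j = \<ominus> c' j i" for i j
  proof (cases i; cases j)
    fix k l assume "i = Suc k" "j = Suc l"
    then show ?thesis using c(3)[of k l] by (simp add: c'_def)
  qed (use Cons.prems in \<open>auto simp: c'_def\<close>)
  show ?case by (intro exI[of _ c'] conjI allI impI) (rule 2, rule 3, rule 4, rule 1)
qed

lemma koszul_relation:
  assumes xs: "set xs \<subseteq> carrier R" and as: "set as \<subseteq> carrier R" "length as = length xs"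
    and rel: "dot xs as = \<zero>"
    and exact: "\<And>z. (\<And>L. z L \<in> carrier R) \<Longrightarrow>
      (\<And>L. L \<in> cells (length xs) 0 \<Longrightarrow> koszul_d xs z L = \<zero>) \<Longrightarrow>
      \<exists>w. (\<forall>L. w L \<in> carrier R) \<and>
     (\<forall>L \<in> cells (length xs) (Suc 0). z L = koszul_d xs w L)"
  shows "\<exists>c. (\<forall>i j. c i j \<in> carrier R) \<and> (\<forall>i. c i i = \<zero>) \<and> (\<forall>i j. c i j = \<ominus> c j i) \<and>
    (\<forall>i < length xs. as ! i = dot xs (map (c i) [0..<length xs]))"
proof -
  let ?n = "length xs"
  define z where "z L = (let i = length (takeWhile Not L) in if i < ?n then as ! i else \<zero>)" for L
  have tw: "length (takeWhile Not (cell n j)) = j" if "j < n" for n j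
    using that
  proof (induction n arbitrary: j)
    case (Suc n j)
    then show ?case by (cases j) auto
  qed simp
  have zc: "z (cell ?n j) = as ! j" if "j < ?n" for j
    using tw[OF that] that by (simp add: z_def)
  have zcl: "z L \<in> carrier R" for L
    using as by (auto simp: z_def Let_def)
  have "L = replicate ?n False" if "L \<in> cells ?n 0" for L
    using that by (auto simp: filter_empty_conv intro!: replicate_eqI)
  moreover have "koszul_d xs z (replicate ?n False) = \<zero>"
  proof -
    have "map (\<lambda>j. z (cell ?n j)) [0..<?n] = as"
      using zc as(2) by (intro nth_equalityI) auto
    then show ?thesis using xs zcl by (simp add: koszul_d_vertex rel)
  qed
  ultimately obtain w where w: "\<And>L. w L \<in> carrier R"
     "\<And>L. L \<in> cells ?n (Suc 0) \<Longrightarrow> z L = koszul_d xs w L"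
    using exact[of z] zcl by blast
  have "cell n i \<in> cells n (Suc 0)" if "i < n" for n i
    using that
  proof (induction n arbitrary: i)
    case (Suc n i)
    have "filter (\<lambda>b. b) (replicate n False) = []" by simp
    then show ?case using Suc by (cases i) auto
  qed simp
  then have eq: "as ! i = koszul_d xs w (cell ?n i)" if "i < ?n" for i
    using w(2)[of "cell ?n i"] zc[OF that] that by simp
  obtain c where c: "\<forall>i j. c i j \<in> carrier R" "\<forall>i. c i i = \<zero>" "\<forall>i j. c i j = \<ominus> c j i"
    "\<forall>i < ?n. koszul_d xs w (cell ?n i) = dot xs (map (c i) [0..<?n])"
    using koszul_d_edge[of xs w, OF xs w(1)] by blast
  have "\<forall>i < ?n. as ! i = dot xs (map (c i) [0..<?n])" using eq c(4) by simp
  with c(1-3) show ?thesis by (intro exI[of _ c] conjI)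
qed

text \<open>Used to reduce statements about all elements of an ideal to its generators.\<close>

lemma colon_ideal:
  assumes J: "ideal J R" and u: "u \<in> carrier R"
  shows "ideal {r \<in> carrier R. u \<otimes> r \<in> J} R"
proof (rule idealI)
  interpret J: ideal J R by fact
  show "ring R" by unfold_locales
  show "subgroup {r \<in> carrier R. u \<otimes> r \<in> J} (add_monoid R)"
    by (rule add.subgroupI)
      (use u J.a_inv_closed in \<open>auto simp: r_distr r_minus a_inv_def[symmetric] intro!: exI[of _ \<zero>]\<close>)
  fix a x assume "a \<in> {r \<in> carrier R. u \<otimes> r \<in> J}" "x \<in> carrier R"
  then show "x \<otimes> a \<in> {r \<in> carrier R. u \<otimes> r \<in> J}" "a \<otimes> x \<in> {r \<in> carrier R. u \<otimes> r \<in> J}"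
    using u J.I_l_closed[of "u \<otimes> a" x] by (auto simp: m_ac)
qed

lemma genideal_insert_split:
  assumes "M \<subseteq> carrier R" "y \<in> carrier R" "a \<in> Idl (insert y M)"
  shows "\<exists>u\<in>carrier R. a \<ominus> y \<otimes> u \<in> Idl M"
proof -
  interpret MI: ideal "Idl M" R by (rule genideal_ideal[OF assms(1)])
  interpret I: ideal "PIdl y <+>\<^bsub>R\<^esub> Idl M" R
    by (rule add_ideals[OF cgenideal_ideal[OF assms(2)] genideal_ideal[OF assms(1)]])
  have "y \<in> PIdl y" "\<zero> \<in> Idl M" "\<zero> \<in> PIdl y"
    using assms cgenideal_self MI.zero_closed
      additive_subgroup.zero_closed[OF ideal.axioms(1)[OF cgenideal_ideal[OF assms(2)]]] by auto
  then have "y \<oplus> \<zero> \<in> PIdl y <+>\<^bsub>R\<^esub> Idl M" "\<And>b. b \<in> M \<Longrightarrow> \<zero> \<oplus> b \<in> PIdl y <+>\<^bsub>R\<^esub> Idl M"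
    using genideal_self[OF assms(1)] unfolding set_add_def' by blast+
  then have "insert y M \<subseteq> PIdl y <+>\<^bsub>R\<^esub> Idl M" using assms by fastforce
  then have "a \<in> PIdl y <+>\<^bsub>R\<^esub> Idl M"
    using genideal_minimal[OF I.ideal_axioms] assms by blast
  then obtain r b where rb: "r \<in> carrier R" "b \<in> Idl M" "a = r \<otimes> y \<oplus> b"
    unfolding set_add_def' cgenideal_def by blast
  then have "a \<ominus> y \<otimes> r = b" using assms MI.Icarr[OF rb(2)] by algebra
  then have "a \<ominus> y \<otimes> r \<in> Idl M" using rb(2) by (simp only:)
  then show ?thesis using rb(1) by blast
qed

lemma genideal_finite_dot:
  assumes "set xs \<subseteq> carrier R" "a \<in> Idl (set xs)"
  shows "\<exists>rs. set rs \<subseteq> carrier R \<and> length rs = length xs \<and> a = dot xs rs"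
  using assms
proof (induction xs arbitrary: a)
  case Nil
  then show ?case using genideal_minimal[OF zeroideal, of "{}"] by auto
next
  case (Cons x xs)
  have c: "x \<in> carrier R" "set xs \<subseteq> carrier R" "set (x # xs) \<subseteq> carrier R" using Cons.prems by auto
  have ac: "a \<in> carrier R" using ideal.Icarr[OF genideal_ideal[OF c(3)]] Cons.prems(2) .
  obtain u where u: "u \<in> carrier R" "a \<ominus> x \<otimes> u \<in> Idl (set xs)"
    using genideal_insert_split[OF c(2,1)] Cons.prems(2) by auto
  obtain rs where rs: "set rs \<subseteq> carrier R" "length rs = length xs" "a \<ominus> x \<otimes> u = dot xs rs"
    using Cons.IH[OF c(2) u(2)] by blast
  have "a = x \<otimes> u \<oplus> (a \<ominus> x \<otimes> u)" using ac c(1) u(1) by algebra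
  then have "a = dot (x # xs) (u # rs)" unfolding rs(3) by simp
  then show ?case using u(1) rs by (intro exI[of _ "u # rs"]) auto
qed

text \<open>The vanishing of the first Koszul homology, read as a statement about relations. The comparison of
\<open>xs\<close> with the regular sequence goes through powers only, so it covers inhomogeneous \<open>ys\<close>.\<close>

lemma regular_sequence_koszul_relation:
  assumes ys: "regular_sequence R ys" "length xs \<le> length ys"
    and xs: "set xs \<subseteq> carrier R"
    and pow: "\<And>y. y \<in> set ys \<Longrightarrow> \<exists>n::nat. y [^] n \<in> Idl (set xs)"
    and as: "set as \<subseteq> carrier R" "length as = length xs" and rel: "dot xs as = \<zero>"
  shows "\<exists>c. (\<forall>i j. c i j \<in> carrier R) \<and> (\<forall>i. c i i = \<zero>) \<and> (\<forall>i j. c i j = \<ominus> c j i) \<and>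
    (\<forall>i < length xs. as ! i = dot xs (map (c i) [0..<length xs]))"
proof (rule koszul_relation[OF xs as rel])
  fix z :: "bool list \<Rightarrow> 'a"
  assume z: "\<And>L. z L \<in> carrier R"
    and cyc: "\<And>L. L \<in> cells (length xs) 0 \<Longrightarrow> koszul_d xs z L = \<zero>"
  have ysc: "set ys \<subseteq> carrier R" using ys(1) by (simp add: regular_sequence_def)
  define Y where "Y i = Idl (set (take i ys))" for i
  have tk: "set (take i ys) \<subseteq> carrier R" for i using ysc set_take_subset[of i ys] by blast
  have Y0: "Y 0 = {\<zero>}" using genideal_minimal[OF zeroideal, of "{}"] genideal_ideal[of "{}"]
    by (auto simp: Y_def additive_subgroup.zero_closed ideal.axioms(1))
  have step: "set (take (Suc i) ys) = insert (ys ! i) (set (take i ys))" if "i < length xs" for i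
    using that ys(2) by (simp add: take_Suc_conv_app_nth)
  have "\<exists>w. (\<forall>L. w L \<in> carrier R) \<and>
     (\<forall>L \<in> cells (length xs) (Suc 0). z L \<ominus> koszul_d xs w L \<in> Y 0)"
  proof (rule koszul_acyclic[OF xs, where y="\<lambda>i. ys ! i"])
    fix i
    show "ideal (Y i) R" unfolding Y_def by (rule genideal_ideal[OF tk])
    assume i: "i < length xs"
    then have i': "i < length ys" using ys(2) by simp
    show yi: "ys ! i \<in> carrier R" using i' ysc by auto
    show "Y i \<subseteq> Y (Suc i)" unfolding Y_def step[OF i]
      using subset_Idl_subset[of "insert (ys ! i) (set (take i ys))"] tk[of i] yi by auto
    show "ys ! i \<in> Y (Suc i)" unfolding Y_def using genideal_self[OF tk[of "Suc i"]] step[OF i] by blast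
    show "\<exists>u\<in>carrier R. a \<ominus> ys ! i \<otimes> u \<in> Y i" if "a \<in> Y (Suc i)" for a
      using genideal_insert_split[OF tk yi, of a i] that unfolding Y_def step[OF i] by blast
    show "a \<in> Y i" if "a \<in> carrier R" "ys ! i \<otimes> a \<in> Y i" for a
      using ys(1) i' that by (simp add: regular_sequence_def Y_def)
    show "\<exists>n rs. set rs \<subseteq> carrier R \<and> length rs = length xs \<and> ys ! i [^] (n::nat) = dot xs rs"
      using genideal_finite_dot[OF xs] pow[of "ys ! i"] i' by (meson nth_mem)
  qed (use z cyc Y0 in auto)
  then obtain w where w: "\<And>L. w L \<in> carrier R"
    "\<And>L. L \<in> cells (length xs) (Suc 0) \<Longrightarrow> z L \<ominus> koszul_d xs w L = \<zero>"
    unfolding Y0 by blast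
  have "z L = koszul_d xs w L" if "L \<in> cells (length xs) (Suc 0)" for L
    using w(2)[OF that] r_right_minus_eq[OF z koszul_d_closed[OF xs w(1)]] by simp
  then show "\<exists>w. (\<forall>L. w L \<in> carrier R) \<and>
     (\<forall>L \<in> cells (length xs) (Suc 0). z L = koszul_d xs w L)"
    using w(1) by blast
qed

end

section \<open>Graded rings\<close>

text \<open>The grading is described by its component functions instead of by decompositions into finite
sums. All axioms then pass verbatim to a subring that is closed under taking components, which is how
the algebra \<open>k[V]\<close> becomes graded.\<close>

locale graded_ring = cring R for R :: "('a, 'm) ring_scheme" (structure) +
  fixes G :: "nat \<Rightarrow> 'a set" and cmp :: "nat \<Rightarrow> 'a \<Rightarrow> 'a"
  assumes G_subgroup: "\<And>i. additive_subgroup (G i) R"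
    and G_mult: "\<And>i j a b. a \<in> G i \<Longrightarrow> b \<in> G j \<Longrightarrow> a \<otimes> b \<in> G (i + j)"
    and one_G: "\<one> \<in> G 0"
    and cmp_G: "\<And>i x. x \<in> carrier R \<Longrightarrow> cmp i x \<in> G i"
    and cmp_add: "\<And>i x y. x \<in> carrier R \<Longrightarrow> y \<in> carrier R \<Longrightarrow> cmp i (x \<oplus> y) = cmp i x \<oplus> cmp i y"
    and cmp_piece: "\<And>i j x. x \<in> G i \<Longrightarrow> cmp j x = (if j = i then x else \<zero>)"
    and cmp_bounded: "\<And>x. x \<in> carrier R \<Longrightarrow> \<exists>N. \<forall>i\<ge>N. cmp i x = \<zero>"
    and cmp_eq_zero: "\<And>x. x \<in> carrier R \<Longrightarrow> (\<And>i. cmp i x = \<zero>) \<Longrightarrow> x = \<zero>"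
begin

lemma G_carrier [simp]: "a \<in> G i \<Longrightarrow> a \<in> carrier R"
  using G_subgroup additive_subgroup.a_Hcarr by metis

lemma cmp_closed [simp]: "x \<in> carrier R \<Longrightarrow> cmp i x \<in> carrier R"
  by (rule G_carrier[OF cmp_G])

lemma zero_G [simp]: "\<zero> \<in> G i"
  using G_subgroup additive_subgroup.zero_closed by metis

lemma cmp_zero [simp]: "cmp i \<zero> = \<zero>"
  using cmp_piece[OF zero_G, of i i] by simp

lemma cmp_uminus:
  assumes "x \<in> carrier R" shows "cmp i (\<ominus> x) = \<ominus> cmp i x"
proof -
  have "cmp i (\<ominus> x) \<oplus> cmp i x = \<zero>"
    using cmp_add[of "\<ominus> x" x i] assms by (simp add: l_neg)
  then show ?thesis using assms by (simp add: minus_equality)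
qed

lemma cmp_minus:
  "x \<in> carrier R \<Longrightarrow> y \<in> carrier R \<Longrightarrow> cmp i (x \<ominus> y) = cmp i x \<ominus> cmp i y"
  by (simp add: minus_eq cmp_add cmp_uminus)

text \<open>Induction on the number of possibly nonzero components, split off from the top.\<close>

lemma graded_induct [consumes 1, case_names zero add piece]:
  assumes x: "x \<in> carrier R"
    and zero: "P \<zero>"
    and add: "\<And>x y. x \<in> carrier R \<Longrightarrow> y \<in> carrier R \<Longrightarrow> P x \<Longrightarrow> P y \<Longrightarrow> P (x \<oplus> y)"
    and piece: "\<And>i. P (cmp i x)"
  shows "P x"
proof -
  have "P x" if "x \<in> carrier R" "\<forall>i\<ge>N. cmp i x = \<zero>" "\<And>i. P (cmp i x)" for N x
    using that
  proof (induction N arbitrary: x)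
    case 0
    then show ?case using cmp_eq_zero[of x] zero by auto
  next
    case (Suc N x)
    let ?x = "x \<ominus> cmp N x"
    have c: "cmp i ?x = (if i = N then \<zero> else cmp i x)" for i
      using Suc.prems(1) cmp_piece[OF cmp_G[of x N], of i] by (auto simp: cmp_add cmp_uminus minus_eq r_neg)
    have "P ?x"
    proof (rule Suc.IH)
      show "\<forall>i\<ge>N. cmp i ?x = \<zero>"
        using c Suc.prems(2) by (metis Suc_leI le_neq_implies_less)
    qed (use c Suc.prems zero in auto)
    then have "P (?x \<oplus> cmp N x)" using Suc.prems by (intro add) auto
    moreover have "?x \<oplus> cmp N x = x" using Suc.prems(1) cmp_closed[OF Suc.prems(1), of N] by algebra
    ultimately show ?case by simp
  qed
  then show ?thesis using cmp_bounded[OF x] x piece by blast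
qed

lemma cmp_mult_piece:
  assumes a: "a \<in> G i" and y: "y \<in> carrier R"
  shows "cmp n (a \<otimes> y) = (if i \<le> n then a \<otimes> cmp (n - i) y else \<zero>)"
  using y
proof (induction rule: graded_induct)
  case zero
  then show ?case using a by simp
next
  case (add x y)
  then show ?case using a by (simp add: r_distr cmp_add)
next
  case (piece j)
  have "cmp n (a \<otimes> cmp j y) = (if n = i + j then a \<otimes> cmp j y else \<zero>)"
    by (rule cmp_piece[OF G_mult[OF a cmp_G[OF y]]])
  moreover have "cmp (n - i) (cmp j y) = (if n - i = j then cmp j y else \<zero>)"
    by (rule cmp_piece[OF cmp_G[OF y]])
  ultimately show ?case using a by auto
qed

lemma cmp_mult:
  assumes x: "x \<in> carrier R" and y: "y \<in> carrier R"
  shows "cmp n (x \<otimes> y) = (\<Oplus>i\<in>{..n}. cmp i x \<otimes> cmp (n - i) y)"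
  using x
proof (induction rule: graded_induct)
  case zero
  then show ?case using y by simp
next
  case (add a b)
  then show ?case using y by (simp add: l_distr cmp_add finsum_addf Pi_def)
next
  case (piece j)
  have c: "cmp i (cmp j x) = (if i = j then cmp j x else \<zero>)" for i
    by (rule cmp_piece[OF cmp_G[OF x]])
  have "(\<Oplus>i\<in>{..n}. cmp i (cmp j x) \<otimes> cmp (n - i) y)
      = (\<Oplus>i\<in>{..n}. if j = i then cmp j x \<otimes> cmp (n - i) y else \<zero>)"
    by (rule add.finprod_cong') (use c x y in auto)
  also have "\<dots> = (if j \<le> n then cmp j x \<otimes> cmp (n - j) y else \<zero>)"
  proof (cases "j \<le> n")
    case True
    then show ?thesis
      using add.finprod_singleton[of j "{..n}" "\<lambda>i. cmp j x \<otimes> cmp (n - i) y"] x y by simp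
  next
    case False
    then have "(\<Oplus>i\<in>{..n}. if j = i then cmp j x \<otimes> cmp (n - i) y else \<zero>) = (\<Oplus>i\<in>{..n}. \<zero>)"
      by (intro add.finprod_cong') auto
    then show ?thesis using False by simp
  qed
  finally show ?case using cmp_mult_piece[OF cmp_G[OF x] y] by simp
qed

lemma cmp_finsum:
  assumes "finite A" "\<And>i. i \<in> A \<Longrightarrow> f i \<in> carrier R"
  shows "cmp n (\<Oplus>i\<in>A. f i) = (\<Oplus>i\<in>A. cmp n (f i))"
  using assms
proof (induction A rule: finite_induct)
  case (insert x F)
  then have "f \<in> F \<rightarrow> carrier R" "(\<lambda>i. cmp n (f i)) \<in> F \<rightarrow> carrier R" by auto
  with insert show ?case by (simp add: finsum_insert cmp_add)
qed simp

text \<open>The elements whose difference with their constant term lies in \<open>J\<close> form a subring. This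
covers both the ring itself, generated in degree one, and the algebra generated by \<open>V\<close>.\<close>

lemma minus_cmp0_generated:
  assumes J: "ideal J R" and H: "H \<subseteq> J" "\<And>h. h \<in> H \<Longrightarrow> cmp 0 h = \<zero>"
    and x: "x \<in> generate_ring R (G 0 \<union> H)"
  shows "x \<ominus> cmp 0 x \<in> J"
proof -
  interpret J: ideal J R by fact
  have gen: "G 0 \<union> H \<subseteq> carrier R" using H(1) J.a_Hcarr by auto
  note carr = generate_ring_in_carrier[OF gen]
  show ?thesis using x
  proof (induction rule: generate_ring.induct)
    case one
    then show ?case using cmp_piece[OF one_G, of 0] by (simp add: minus_eq r_neg)
  next
    case (incl h)
    then show ?case
    proof
      assume "h \<in> G 0"
      then show ?thesis using cmp_piece[of h 0 0] by (simp add: minus_eq r_neg)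
    next
      assume "h \<in> H"
      then show ?thesis using H J.a_Hcarr[of h] by (auto simp: minus_eq)
    qed
  next
    case (a_inv x)
    have "\<ominus> x \<ominus> cmp 0 (\<ominus> x) = \<ominus> (x \<ominus> cmp 0 x)"
      using carr[OF a_inv(1)] by (simp add: cmp_uminus minus_eq minus_add)
    then show ?case using a_inv by (simp add: J.a_inv_closed)
  next
    case (eng_add x y)
    have "x \<oplus> y \<ominus> cmp 0 (x \<oplus> y) = (x \<ominus> cmp 0 x) \<oplus> (y \<ominus> cmp 0 y)"
      using carr[OF eng_add(1)] carr[OF eng_add(2)] by (simp add: cmp_add minus_eq minus_add a_ac)
    then show ?case using eng_add by simp
  next
    case (eng_mult x y)
    let ?a = "cmp 0 x" and ?b = "cmp 0 y"
    have xy: "x \<in> carrier R" "y \<in> carrier R" using carr eng_mult by blast+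
    then have c: "?a \<in> carrier R" "?b \<in> carrier R" by auto
    have "cmp 0 (x \<otimes> y) = ?a \<otimes> ?b" using cmp_mult[OF xy, of 0] c by simp
    then have "x \<otimes> y \<ominus> cmp 0 (x \<otimes> y) = x \<otimes> (y \<ominus> ?b) \<oplus> ?b \<otimes> (x \<ominus> ?a)"
      using xy c by algebra
    then show ?case using eng_mult xy c by (simp add: J.I_l_closed)
  qed
qed

text \<open>Elements of order at least \<open>e\<close> whose component of degree \<open>e\<close> lies in \<open>W\<close>. For a subspace \<open>W\<close> this
is an ideal, so an inclusion of an ideal in it can be checked on generators; it extracts the
information about lowest degree parts from equations between ideals.\<close>

definition initial_in :: "nat \<Rightarrow> 'a set \<Rightarrow> 'a set" where
  "initial_in e W = {x \<in> carrier R. (\<forall>i<e. cmp i x = \<zero>) \<and> cmp e x \<in> W}"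

lemma initial_in_mult:
  assumes x: "x \<in> initial_in e V" and y: "y \<in> initial_in f W"
    and VW: "\<And>a b. a \<in> V \<Longrightarrow> b \<in> W \<Longrightarrow> a \<in> G e \<Longrightarrow> b \<in> G f \<Longrightarrow> a \<otimes> b \<in> U"
  shows "x \<otimes> y \<in> initial_in (e + f) U"
proof -
  have c: "x \<in> carrier R" "y \<in> carrier R" using x y by (auto simp: initial_in_def)
  have lo: "cmp i x = \<zero>" if "i < e" for i using x that by (simp add: initial_in_def)
  have lo': "cmp i y = \<zero>" if "i < f" for i using y that by (simp add: initial_in_def)
  have 1: "cmp n (x \<otimes> y) = \<zero>" if "n < e + f" for n
  proof -
    have "cmp i x \<otimes> cmp (n - i) y = \<zero>" if "i \<le> n" for i
      using lo[of i] lo'[of "n - i"] \<open>n < e + f\<close> that c by (cases "i < e") auto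
    then have "(\<Oplus>i\<in>{..n}. cmp i x \<otimes> cmp (n - i) y) = (\<Oplus>i\<in>{..n}. \<zero>)"
      by (intro add.finprod_cong') auto
    then show ?thesis using cmp_mult c by simp
  qed
  have "cmp i x \<otimes> cmp (e + f - i) y = (if e = i then cmp e x \<otimes> cmp f y else \<zero>)" if "i \<le> e + f" for i
    using lo[of i] lo'[of "e + f - i"] that c by (cases i e rule: linorder_cases) auto
  then have "(\<Oplus>i\<in>{..e + f}. cmp i x \<otimes> cmp (e + f - i) y)
     = (\<Oplus>i\<in>{..e + f}. if e = i then cmp e x \<otimes> cmp f y else \<zero>)"
    using c by (intro add.finprod_cong') auto
  also have "\<dots> = cmp e x \<otimes> cmp f y"
    using add.finprod_singleton[of e "{..e + f}" "\<lambda>i. cmp e x \<otimes> cmp f y"] c by simp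
  finally have "cmp (e + f) (x \<otimes> y) = cmp e x \<otimes> cmp f y" using c cmp_mult by simp
  moreover have "cmp e x \<otimes> cmp f y \<in> U"
    using x y cmp_G c by (intro VW) (auto simp: initial_in_def)
  ultimately show ?thesis using 1 c by (simp add: initial_in_def)
qed

lemma carrier_eq_initial_in: "carrier R = initial_in 0 (G 0)"
  using cmp_G by (auto simp: initial_in_def)

lemma initial_in_ideal:
  assumes W: "additive_subgroup W R"
    and KW: "\<And>k w. k \<in> G 0 \<Longrightarrow> w \<in> W \<Longrightarrow> k \<otimes> w \<in> W"
  shows "ideal (initial_in e W) R"
proof (rule idealI)
  interpret W: additive_subgroup W R by fact
  show "ring R" by unfold_locales
  show "subgroup (initial_in e W) (add_monoid R)"
  proof (rule add.subgroupI)
    show "initial_in e W \<noteq> {}" using W.zero_closed by (auto simp: initial_in_def intro!: exI[of _ \<zero>])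
  qed (auto simp: initial_in_def cmp_add cmp_uminus a_inv_def[symmetric] W.a_inv_closed)
  fix a x assume ax: "a \<in> initial_in e W" "x \<in> carrier R"
  then have "x \<in> initial_in 0 (G 0)" using carrier_eq_initial_in by simp
  from initial_in_mult[OF this ax(1) KW] show "x \<otimes> a \<in> initial_in e W" by simp
  then show "a \<otimes> x \<in> initial_in e W" using ax by (simp add: m_comm initial_in_def)
qed

lemma piece_in_initial_in: "a \<in> G e \<Longrightarrow> a \<in> W \<Longrightarrow> a \<in> initial_in e W"
  by (auto simp: initial_in_def cmp_piece)

lemma piece_initial_in_iff: "a \<in> G e \<Longrightarrow> a \<in> initial_in e W \<Longrightarrow> a \<in> W"
  by (auto simp: initial_in_def cmp_piece)

end

section \<open>Prime chains in graded rings\<close>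

lemma prime_chain_extend:
  assumes "prime_chain R n P" "primeideal I R" "P n \<subset> I"
  shows "prime_chain R (Suc n) (P(Suc n := I))"
  using assms by (auto simp: prime_chain_def less_Suc_eq le_Suc_eq)

lemma prime_chain_raise_top:
  assumes "prime_chain R (Suc n) P" "primeideal I R" "P (Suc n) \<subseteq> I"
  shows "prime_chain R (Suc n) (P(Suc n := I))"
proof (rule prime_chain_extend)
  show "prime_chain R n P" using assms(1) by (auto simp: prime_chain_def)
  show "P n \<subset> I" using assms by (auto simp: prime_chain_def)
qed fact

lemma (in ideal) I_minus_closed: "a \<in> I \<Longrightarrow> b \<in> I \<Longrightarrow> a \<ominus> b \<in> I"
  by (simp add: minus_eq a_inv_closed)

lemma (in ring) finsum_in_subgroup:
  assumes "additive_subgroup H R" "\<And>i. i \<in> A \<Longrightarrow> f i \<in> H"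
  shows "finsum R f A \<in> H"
proof (cases "finite A")
  case True
  interpret H: additive_subgroup H R by fact
  show ?thesis using True assms(2)
  proof (induction A rule: finite_induct)
    case (insert x F)
    then have "f \<in> F \<rightarrow> carrier R" "f x \<in> carrier R" using H.a_Hcarr by auto
    with insert show ?case by (simp add: finsum_insert)
  qed simp
qed (use assms(1) additive_subgroup.zero_closed in \<open>auto simp: finsum_infinite\<close>)

context graded_ring
begin

text \<open>The largest homogeneous ideal contained in \<open>P\<close>.\<close>

definition core :: "'a set \<Rightarrow> 'a set" where
  "core P = {x \<in> carrier R. \<forall>i. cmp i x \<in> P}"

lemma in_ideal_if_cmp:
  assumes "ideal P R" "x \<in> carrier R" "\<And>i. cmp i x \<in> P" shows "x \<in> P"
proof -
  interpret P: ideal P R by fact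
  show ?thesis using assms(2) by (induction rule: graded_induct) (use assms in auto)
qed

lemma core_subset: "ideal P R \<Longrightarrow> core P \<subseteq> P"
  using in_ideal_if_cmp by (auto simp: core_def)

text \<open>If neither \<open>a\<close> nor \<open>b\<close> lies in the core, their components of lowest degree outside \<open>P\<close> multiply
to an element outside \<open>P\<close>, and modulo \<open>P\<close> this product is a component of \<open>a b\<close>.\<close>

lemma core_primeideal:
  assumes "primeideal P R" shows "primeideal (core P) R"
proof (rule primeidealI)
  interpret P: primeideal P R by fact
  show "cring R" by unfold_locales
  have cmpP: "cmp i (x \<otimes> a) \<in> P" if "a \<in> core P" "x \<in> carrier R" for a x i
  proof -
    have "a \<in> carrier R" using that by (simp add: core_def)
    then have "cmp i (x \<otimes> a) = (\<Oplus>j\<in>{..i}. cmp j x \<otimes> cmp (i - j) a)"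
      by (rule cmp_mult[OF that(2)])
    also have "\<dots> \<in> P"
      by (rule finsum_in_subgroup[OF P.additive_subgroup_axioms]) (use that P.I_l_closed in \<open>auto simp: core_def\<close>)
    finally show ?thesis .
  qed
  show "ideal (core P) R"
  proof (rule idealI)
    show "ring R" by unfold_locales
    show "subgroup (core P) (add_monoid R)"
    proof (rule add.subgroupI)
      show "core P \<noteq> {}" by (auto simp: core_def intro!: exI[of _ \<zero>])
    qed (auto simp: core_def cmp_add cmp_uminus a_inv_def[symmetric] P.a_inv_closed)
    fix a x assume ax: "a \<in> core P" "x \<in> carrier R"
    show "x \<otimes> a \<in> core P" using cmpP ax by (auto simp: core_def)
    then show "a \<otimes> x \<in> core P" using ax by (simp add: m_comm core_def)
  qed
  show "carrier R \<noteq> core P" using core_subset[OF P.ideal_axioms] P.I_notcarr P.Icarr by blast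
  fix a b assume ab: "a \<in> carrier R" "b \<in> carrier R" "a \<otimes> b \<in> core P"
  show "a \<in> core P \<or> b \<in> core P"
  proof (rule ccontr)
    assume "\<not> ?thesis"
    then have ex: "\<exists>i. cmp i a \<notin> P" "\<exists>j. cmp j b \<notin> P" using ab by (auto simp: core_def)
    define i where "i = (LEAST i. cmp i a \<notin> P)"
    define j where "j = (LEAST j. cmp j b \<notin> P)"
    have i: "cmp i a \<notin> P" "\<And>k. k < i \<Longrightarrow> cmp k a \<in> P"
      using LeastI_ex[OF ex(1)] not_less_Least by (auto simp: i_def)
    have j: "cmp j b \<notin> P" "\<And>k. k < j \<Longrightarrow> cmp k b \<in> P"
      using LeastI_ex[OF ex(2)] not_less_Least by (auto simp: j_def)
    let ?f = "\<lambda>k. cmp k a \<otimes> cmp (i + j - k) b"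
    have fP: "?f k \<in> P" if "k \<in> {..i + j} - {i}" for k
    proof (cases "k < i")
      case True
      then show ?thesis using i ab by (simp add: P.I_r_closed)
    next
      case False
      then have "i + j - k < j" using that by auto
      then show ?thesis using j ab by (simp add: P.I_l_closed)
    qed
    have "cmp (i + j) (a \<otimes> b) = finsum R ?f (insert i ({..i + j} - {i}))"
      using cmp_mult[OF ab(1,2)] by (simp add: insert_absorb)
    also have "\<dots> = ?f i \<oplus> finsum R ?f ({..i + j} - {i})"
      by (rule finsum_insert) (use ab in auto)
    finally have sum: "cmp (i + j) (a \<otimes> b) = ?f i \<oplus> finsum R ?f ({..i + j} - {i})" .
    define u v where "u = ?f i" and "v = finsum R ?f ({..i + j} - {i})"
    have uv: "u \<in> carrier R" "v \<in> carrier R"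
      using ab by (auto simp: u_def v_def intro!: finsum_closed)
    have "cmp (i + j) (a \<otimes> b) \<in> P" using ab(3) by (auto simp: core_def)
    then have "u \<oplus> v \<in> P" unfolding sum u_def v_def .
    moreover have "v \<in> P" unfolding v_def by (rule finsum_in_subgroup[OF P.additive_subgroup_axioms]) (rule fP)
    ultimately have "(u \<oplus> v) \<ominus> v \<in> P" by (rule P.I_minus_closed)
    moreover have "(u \<oplus> v) \<ominus> v = u" using uv by algebra
    ultimately have "?f i \<in> P" by (simp add: u_def)
    then show False using P.I_prime[of "cmp i a" "cmp j b"] i j ab by simp
  qed
qed

text \<open>Modulo \<open>q\<close> the element \<open>x\<close> lives in the degrees from \<open>a\<close> to \<open>a + n\<close>. The number \<open>n\<close> serves as the
Euclidean size in the following division; it is not affected by multiplication with homogeneous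
elements.\<close>

definition windowed :: "'a set \<Rightarrow> 'a \<Rightarrow> nat \<Rightarrow> nat \<Rightarrow> bool" where
  "windowed q x a n \<longleftrightarrow> (\<forall>i. cmp i x \<notin> q \<longrightarrow> a \<le> i \<and> i \<le> a + n)"

text \<open>Division with remainder modulo \<open>q\<close>, as for polynomials over a field: a homogeneous factor \<open>c\<close> outside
\<open>q\<close> takes the place of division by the leading component of the divisor \<open>f\<close>, which has minimal width in \<open>p\<close>. The remainder is
narrower than \<open>f\<close>, hence in \<open>q\<close>. The quotient \<open>h\<close> has width at most the difference of the widths of
\<open>g\<close> and \<open>f\<close>; this is what the last conjunct records, after adding the degree offsets \<open>a\<close> and \<open>b\<close>.\<close>

lemma pseudo_division:
  assumes q: "primeideal q R" and qcore: "core q = q" and p: "ideal p R"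
    and f: "f \<in> p" "windowed q f a n" "cmp (a + n) f \<notin> q"
    and min: "\<And>g b m. g \<in> p \<Longrightarrow> windowed q g b m \<Longrightarrow> m < n \<Longrightarrow> g \<in> q"
    and g: "g \<in> p" "windowed q g b m"
  shows "\<exists>e c h. c \<in> G e \<and> c \<notin> q \<and> h \<in> carrier R \<and> c \<otimes> g \<ominus> h \<otimes> f \<in> q \<and>
    (\<forall>i. cmp i h \<notin> q \<longrightarrow> e + b \<le> i + a \<and> i + a + n \<le> e + b + m)"
  using g
proof (induction m arbitrary: g b rule: less_induct)
  case (less m g b)
  interpret q: primeideal q R by fact
  interpret p: ideal p R by fact
  have gc: "g \<in> carrier R" and fc: "f \<in> carrier R" using less.prems f p.Icarr by auto
  show ?case
  proof (cases "m < n")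
    case True
    then have "g \<in> q" using min less.prems by blast
    moreover have "\<one> \<notin> q" using q.I_notcarr q.one_imp_carrier by metis
    ultimately show ?thesis using one_G gc fc
      by (intro exI[of _ 0] exI[of _ \<one>] exI[of _ \<zero>]) (auto simp: minus_eq)
  next
    case False
    then have mn: "n \<le> m" by simp
    define s t where "s = cmp (a + n) f" and "t = cmp (b + m) g"
    have s: "s \<in> G (a + n)" "s \<notin> q" and t: "t \<in> G (b + m)"
      using fc gc f(3) cmp_G by (auto simp: s_def t_def)
    \<comment> \<open>One division step: both products have leading degree \<open>a + n + b + m\<close>, where they cancel.\<close>
    define g' where "g' = s \<otimes> g \<ominus> t \<otimes> f"
    have g'p: "g' \<in> p" unfolding g'_def using less.prems(1) f(1) s t
      by (simp add: minus_eq p.I_l_closed p.a_inv_closed)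
    have cg': "cmp i g' = (if a + n \<le> i then s \<otimes> cmp (i - (a + n)) g else \<zero>) \<ominus>
       (if b + m \<le> i then t \<otimes> cmp (i - (b + m)) f else \<zero>)" for i
      unfolding g'_def using s t gc fc by (simp add: cmp_minus cmp_mult_piece)
    have win: "a + n + b \<le> i \<and> i < a + n + b + m" if i: "cmp i g' \<notin> q" for i
    proof (rule ccontr)
      assume out: "\<not> ?thesis"
      show False
      proof (cases "i = a + n + b + m")
        case True
        then have "i - (a + n) = b + m" "i - (b + m) = a + n" "a + n \<le> i" "b + m \<le> i" by auto
        then have "cmp i g' = s \<otimes> t \<ominus> t \<otimes> s" using cg' by (simp add: s_def t_def)
        also have "\<dots> = \<zero>" using s t by (simp add: m_comm minus_eq r_neg)
        finally show False using i by simp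
      next
        case False
        have "(if a + n \<le> i then s \<otimes> cmp (i - (a + n)) g else \<zero>) \<in> q"
        proof (cases "a + n \<le> i")
          case True
          then have "cmp (i - (a + n)) g \<in> q"
          proof -
            have "\<not> (b \<le> i - (a + n) \<and> i - (a + n) \<le> b + m)" using out False True by auto
            then show ?thesis using less.prems(2) unfolding windowed_def by blast
          qed
          then show ?thesis using s by (simp add: q.I_l_closed)
        qed simp
        moreover have "(if b + m \<le> i then t \<otimes> cmp (i - (b + m)) f else \<zero>) \<in> q"
        proof (cases "b + m \<le> i")
          case True
          have "\<not> (a \<le> i - (b + m) \<and> i - (b + m) \<le> a + n)" using out False True mn by auto
          then have "cmp (i - (b + m)) f \<in> q"
            using f(2) unfolding windowed_def by blast
          then show ?thesis using t by (simp add: q.I_l_closed)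
        qed simp
        ultimately have "cmp i g' \<in> q" unfolding cg'
          by (rule q.I_minus_closed)
        then show False using i by simp
      qed
    qed
    have "\<exists>e c h. c \<in> G e \<and> c \<notin> q \<and> h \<in> carrier R \<and> c \<otimes> g' \<ominus> h \<otimes> f \<in> q \<and>
      (\<forall>i. cmp i h \<notin> q \<longrightarrow> e + (a + n + b) \<le> i + a \<and> i + a + n + 1 \<le> e + (a + n + b) + m)"
    proof (cases m)
      case 0
      then have "\<And>i. cmp i g' \<in> q" using win by fastforce
      then have "g' \<in> q" by (intro in_ideal_if_cmp[OF q.ideal_axioms p.Icarr[OF g'p]])
      moreover have "\<one> \<notin> q" using q.I_notcarr q.one_imp_carrier by metis
      ultimately show ?thesis using one_G p.Icarr[OF g'p] fc
        by (intro exI[of _ 0] exI[of _ \<one>] exI[of _ \<zero>]) (auto simp: minus_eq)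
    next
      case (Suc m')
      have "windowed q g' (a + n + b) m'" using win Suc by (fastforce simp: windowed_def)
      from less.IH[OF _ g'p this] Suc
      obtain e c h where h: "c \<in> G e" "c \<notin> q" "h \<in> carrier R" "c \<otimes> g' \<ominus> h \<otimes> f \<in> q"
        "\<forall>i. cmp i h \<notin> q \<longrightarrow> e + (a + n + b) \<le> i + a \<and> i + a + n \<le> e + (a + n + b) + m'"
        by blast
      then show ?thesis using Suc
        by (intro exI[of _ e] exI[of _ c] exI[of _ h]) simp
    qed
    then obtain e c h where h: "c \<in> G e" "c \<notin> q" "h \<in> carrier R" "c \<otimes> g' \<ominus> h \<otimes> f \<in> q"
      "\<And>i. cmp i h \<notin> q \<Longrightarrow> e + (a + n + b) \<le> i + a \<and> i + a + n + 1 \<le> e + (a + n + b) + m"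
      by blast
    have cc: "c \<in> carrier R" "s \<in> carrier R" "t \<in> carrier R" using h s t by auto
    show ?thesis
    proof (intro exI conjI allI impI)
      show "c \<otimes> s \<in> G (e + (a + n))" by (rule G_mult[OF h(1) s(1)])
      show "c \<otimes> s \<notin> q" using q.I_prime h s cc by blast
      show "c \<otimes> t \<oplus> h \<in> carrier R" using cc h by simp
      have "c \<otimes> s \<otimes> g \<ominus> (c \<otimes> t \<oplus> h) \<otimes> f = c \<otimes> g' \<ominus> h \<otimes> f"
        unfolding g'_def using cc h(3) gc fc by algebra
      then show "c \<otimes> s \<otimes> g \<ominus> (c \<otimes> t \<oplus> h) \<otimes> f \<in> q" using h(4) by simp
      fix i assume i: "cmp i (c \<otimes> t \<oplus> h) \<notin> q"
      have "cmp i (c \<otimes> t \<oplus> h) = (if i = e + (b + m) then c \<otimes> t else \<zero>) \<oplus> cmp i h"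
        using cc h(3) cmp_piece[OF G_mult[OF h(1) t]] by (simp add: cmp_add)
      then have "i = e + (b + m) \<or> cmp i h \<notin> q" using i q.a_closed by fastforce
      then have "e + (a + n) + b \<le> i + a \<and> i + a + n \<le> e + (a + n) + b + m"
        using h(5)[of i] mn by auto
      then show "e + (a + n) + b \<le> i + a" "i + a + n \<le> e + (a + n) + b + m" by auto
    qed
  qed
qed

lemma windowed_ex: "x \<in> carrier R \<Longrightarrow> ideal q R \<Longrightarrow> \<exists>n. windowed q x 0 n"
  unfolding windowed_def
  by (metis cmp_bounded additive_subgroup.zero_closed ideal.axioms(1) add_0 le0 nat_le_linear)

lemma exact_window:
  assumes q: "ideal q R" and x: "x \<in> carrier R" "windowed q x a n" "x \<notin> q"
  shows "\<exists>m\<le>n. windowed q x a m \<and> cmp (a + m) x \<notin> q"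
proof -
  have "\<exists>i. cmp i x \<notin> q" using in_ideal_if_cmp q x by blast
  then have "\<exists>m. windowed q x a m" using x by blast
  define m where "m = (LEAST m. windowed q x a m)"
  have m: "windowed q x a m" "\<And>k. windowed q x a k \<Longrightarrow> m \<le> k"
    unfolding m_def using x(2) by (auto intro: LeastI Least_le)
  have "cmp (a + m) x \<notin> q"
  proof
    assume "cmp (a + m) x \<in> q"
    then have *: "cmp i x \<notin> q \<Longrightarrow> a \<le> i \<and> i < a + m" for i
      using m(1) unfolding windowed_def by (metis le_neq_implies_less)
    have "m \<noteq> 0" using * \<open>\<exists>i. cmp i x \<notin> q\<close> by fastforce
    then have "windowed q x a (m - 1)" using * unfolding windowed_def by fastforce
    then show False using m(2) \<open>m \<noteq> 0\<close> by fastforce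
  qed
  then show ?thesis using m x(2) by blast
qed

text \<open>Modulo \<open>q\<close>, and after inverting homogeneous elements, the ring becomes a field or a Laurent polynomial
ring over a field, of dimension at most one. Without localizing: \<open>p\<close> is generated up to homogeneous factors by
an element \<open>f\<close> outside \<open>q\<close> of minimal width. It is not in \<open>p'\<close>, since otherwise \<open>p\<close> would be contained in \<open>p'\<close>.
An element \<open>f'\<close> of \<open>p'\<close> outside \<open>q\<close>, again of minimal width, then satisfies \<open>c f' = h f\<close> modulo \<open>q\<close>, so \<open>h \<in> p'\<close>, and
\<open>h\<close> is narrower than \<open>f'\<close>.\<close>

lemma no_intermediate_prime:
  assumes q: "primeideal q R" and p': "primeideal p' R" and p: "ideal p R"
    and core: "core p = q" and chain: "q \<subset> p'" "p' \<subset> p"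
  shows False
proof -
  interpret q: primeideal q R by fact
  interpret p': primeideal p' R by fact
  interpret p: ideal p R by fact
  have hom: "a \<in> q" if "a \<in> G i" "a \<in> p" for a i
  proof -
    have "a \<in> core p" using that by (auto simp: core_def cmp_piece)
    then show ?thesis using core by simp
  qed
  have "q \<subseteq> core q"
  proof
    fix x assume "x \<in> q"
    then have x: "x \<in> carrier R" "cmp i x \<in> p" for i using core by (auto simp: core_def)
    then show "x \<in> core q" using hom[OF cmp_G[OF x(1)] x(2)] by (simp add: core_def)
  qed
  then have qcore: "core q = q" using core_subset[OF q.ideal_axioms] by blast
  define wit where "wit P n \<longleftrightarrow> (\<exists>f a. f \<in> P \<and> f \<notin> q \<and> windowed q f a n)" for P n
  have exwit: "\<exists>n. wit P n" if "ideal P R" "q \<subset> P" for P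
    using that windowed_ex[OF _ q.ideal_axioms] ideal.Icarr unfolding wit_def by (metis psubset_imp_ex_mem DiffE)
  define n where "n = (LEAST n. wit p n)"
  define n' where "n' = (LEAST n. wit p' n)"
  have n: "wit p n" "\<And>k. k < n \<Longrightarrow> \<not> wit p k"
    unfolding n_def using LeastI_ex[OF exwit[OF p]] chain not_less_Least by auto
  have n': "wit p' n'" "\<And>k. k < n' \<Longrightarrow> \<not> wit p' k"
    unfolding n'_def using LeastI_ex[OF exwit[OF p'.ideal_axioms]] chain not_less_Least by auto
  obtain f a where f: "f \<in> p" "f \<notin> q" "windowed q f a n" using n(1) by (auto simp: wit_def)
  have fc: "f \<in> carrier R" using f by simp
  have top: "cmp (a + n) f \<notin> q"
    using exact_window[OF q.ideal_axioms fc f(3,2)] n(2) f unfolding wit_def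
    by (metis le_neq_implies_less)
  \<comment> \<open>A homogeneous \<open>f\<close> would lie in the core of \<open>p\<close>, that is, in \<open>q\<close>.\<close>
  have n0: "n > 0"
  proof (rule ccontr)
    assume "\<not> n > 0"
    then have "n = 0" by simp
    then have small: "cmp i f \<in> q" if "i \<noteq> a" for i using f(3) that unfolding windowed_def by fastforce
    have "f \<ominus> cmp a f \<in> q"
    proof (rule in_ideal_if_cmp[OF q.ideal_axioms])
      fix i show "cmp i (f \<ominus> cmp a f) \<in> q"
        using small[of i] fc cmp_piece[OF cmp_G[OF fc, of a], of i]
        by (cases "i = a") (auto simp: cmp_add cmp_uminus minus_eq r_neg)
    qed (use fc in auto)
    then have "f \<ominus> cmp a f \<in> p" using chain by blast
    then have "\<ominus> (f \<ominus> cmp a f \<ominus> f) \<in> p" using f(1)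
      by (rule p.a_inv_closed[OF p.I_minus_closed])
    moreover have "\<ominus> (f \<ominus> cmp a f \<ominus> f) = cmp a f" using fc cmp_closed[OF fc, of a] by algebra
    ultimately have "cmp a f \<in> p" by (simp only:)
    then have "cmp a f \<in> q" using hom[OF cmp_G[OF fc]] by simp
    then show False using top \<open>n = 0\<close> by simp
  qed
  have minp: "g \<in> q" if "g \<in> p" "windowed q g b m" "m < n" for g b m
    using n(2)[OF that(3)] that unfolding wit_def by blast
  have div: "\<exists>e c h. c \<in> G e \<and> c \<notin> q \<and> h \<in> carrier R \<and> c \<otimes> g \<ominus> h \<otimes> f \<in> q \<and>
    (\<forall>i. cmp i h \<notin> q \<longrightarrow> e + b \<le> i + a \<and> i + a + n \<le> e + b + m)"
    if "g \<in> p" "windowed q g b m" for g b m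
    by (rule pseudo_division[OF q qcore p f(1,3) top _ that]) (rule minp)
  have f_notin: "f \<notin> p'"
  proof
    assume fp': "f \<in> p'"
    have "g \<in> p'" if g: "g \<in> p" for g
    proof -
      have gc: "g \<in> carrier R" using g by simp
      obtain m where "windowed q g 0 m" using windowed_ex[OF gc q.ideal_axioms] by blast
      from div[OF g this]
      obtain e c h where c: "c \<in> G e" "c \<notin> q" "h \<in> carrier R" "c \<otimes> g \<ominus> h \<otimes> f \<in> q" by blast
      have cc: "c \<in> carrier R" using c by auto
      have "c \<otimes> g \<ominus> h \<otimes> f \<in> p'" "h \<otimes> f \<in> p'"
        using c chain fp' by (auto simp: p'.I_l_closed)
      then have "(c \<otimes> g \<ominus> h \<otimes> f) \<oplus> h \<otimes> f \<in> p'" by simp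
      moreover have "(c \<otimes> g \<ominus> h \<otimes> f) \<oplus> h \<otimes> f = c \<otimes> g" using cc c(3) gc fc by algebra
      ultimately have "c \<otimes> g \<in> p'" by simp
      moreover have "c \<notin> p'" using hom[OF c(1)] c(2) chain by blast
      ultimately show ?thesis using p'.I_prime[OF cc gc] by blast
    qed
    then show False using chain by blast
  qed
  obtain f' b where f': "f' \<in> p'" "f' \<notin> q" "windowed q f' b n'" using n'(1) by (auto simp: wit_def)
  have f'c: "f' \<in> carrier R" using f' by simp
  have f'p: "f' \<in> p" using f' chain by blast
  from div[OF f'p f'(3)]
  obtain e c h where c: "c \<in> G e" "c \<notin> q" "h \<in> carrier R" "c \<otimes> f' \<ominus> h \<otimes> f \<in> q"
    "\<And>i. cmp i h \<notin> q \<Longrightarrow> e + b \<le> i + a \<and> i + a + n \<le> e + b + n'" by blast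
  have cc: "c \<in> carrier R" using c by auto
  have "c \<otimes> f' \<ominus> (c \<otimes> f' \<ominus> h \<otimes> f) \<in> p'"
  proof (rule p'.I_minus_closed)
    show "c \<otimes> f' \<in> p'" using f'(1) cc by (rule p'.I_l_closed)
    show "c \<otimes> f' \<ominus> h \<otimes> f \<in> p'" using c(4) chain by blast
  qed
  moreover have "c \<otimes> f' \<ominus> (c \<otimes> f' \<ominus> h \<otimes> f) = h \<otimes> f" using cc c(3) f'c fc by algebra
  ultimately have "h \<in> p'" using p'.I_prime[OF c(3) fc] f_notin by auto
  moreover have "windowed q h (e + b - a) (n' - n)"
    unfolding windowed_def using c(5) by fastforce
  moreover have "n \<le> n'"
    using n'(1) n(2) chain unfolding wit_def by (metis leI psubsetD)
  ultimately have "h \<in> q" using n'(2)[of "n' - n"] n0 unfolding wit_def by force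
  then have "(c \<otimes> f' \<ominus> h \<otimes> f) \<oplus> h \<otimes> f \<in> q" using c(4) fc by (simp add: q.I_r_closed)
  moreover have "(c \<otimes> f' \<ominus> h \<otimes> f) \<oplus> h \<otimes> f = c \<otimes> f'" using cc c(3) f'c fc by algebra
  ultimately have "c \<otimes> f' \<in> q" by simp
  then show False using q.I_prime[OF cc f'c] c(2) f'(2) by blast
qed

text \<open>Passing from a prime that is not homogeneous to its core costs at most one step of a chain. The cores of
two neighbours in the chain stay distinct by \<open>no_intermediate_prime\<close>, unless the smaller prime
is itself homogeneous, in which case it can be kept.\<close>

lemma prime_chain_core:
  assumes "prime_chain R (Suc n) P" "core (P (Suc n)) \<noteq> P (Suc n)"
  shows "\<exists>P'. prime_chain R n P' \<and> P' n = core (P (Suc n))"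
  using assms
proof (induction n arbitrary: P)
  case 0
  then have "primeideal (core (P (Suc 0))) R" by (auto simp: prime_chain_def intro: core_primeideal)
  then show ?case by (intro exI[of _ "\<lambda>_. core (P (Suc 0))"]) (auto simp: prime_chain_def)
next
  case (Suc n P)
  let ?p = "P (Suc (Suc n))" and ?r = "P (Suc n)"
  have ch: "prime_chain R (Suc n) P" using Suc.prems by (auto simp: prime_chain_def)
  have pr: "primeideal ?p R" "primeideal ?r R" "?r \<subset> ?p" using Suc.prems by (auto simp: prime_chain_def)
  have cp: "primeideal (core ?p) R" "primeideal (core ?r) R" using pr core_primeideal by auto
  have sub: "core ?r \<subseteq> core ?p" using pr(3) by (auto simp: core_def)
  show ?case
  proof (cases "core ?r = ?r")
    case True
    then have "?r \<subseteq> core ?p" using sub by simp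
    from prime_chain_raise_top[OF ch cp(1) this] show ?thesis by (metis fun_upd_same)
  next
    case False
    from Suc.IH[OF ch this] obtain P' where P': "prime_chain R n P'" "P' n = core ?r" by blast
    have "core ?r \<noteq> core ?p"
    proof
      assume eq: "core ?r = core ?p"
      have "core ?p \<subset> ?r"
        using eq False core_subset[OF primeideal.axioms(1)[OF pr(2)]] by auto
      from no_intermediate_prime[OF cp(1) pr(2) primeideal.axioms(1)[OF pr(1)] refl this pr(3)]
      show False .
    qed
    then have "P' n \<subset> core ?p" using sub P' by auto
    from prime_chain_extend[OF P'(1) cp(1) this] show ?thesis by (metis fun_upd_same)
  qed
qed

definition positive_part :: "'a set" where
  "positive_part = {x \<in> carrier R. cmp 0 x = \<zero>}"

lemma positive_part_maximal:
  assumes field: "\<And>k. k \<in> G 0 \<Longrightarrow> k \<noteq> \<zero> \<Longrightarrow> k \<in> Units R" and nontrivial: "\<one> \<noteq> \<zero>"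
  shows "maximalideal positive_part R"
proof (rule maximalidealI)
  have "initial_in 0 {\<zero>} = positive_part" by (auto simp: initial_in_def positive_part_def)
  moreover have "ideal (initial_in 0 {\<zero>}) R"
    by (rule initial_in_ideal[OF ideal.axioms(1)[OF zeroideal]]) auto
  ultimately show I: "ideal positive_part R" by simp
  have "cmp 0 \<one> = \<one>" using cmp_piece[OF one_G, of 0] by simp
  then have "\<one> \<notin> positive_part" using nontrivial by (simp add: positive_part_def)
  then show "carrier R \<noteq> positive_part" by auto
  fix J assume J: "ideal J R" "positive_part \<subseteq> J" "J \<subseteq> carrier R"
  interpret J: ideal J R by fact
  show "J = positive_part \<or> J = carrier R"
  proof (cases "J \<subseteq> positive_part")
    case True then show ?thesis using J by auto
  next
    case False
    then obtain x where x: "x \<in> J" "x \<in> carrier R" "cmp 0 x \<noteq> \<zero>" using J by (auto simp: positive_part_def)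
    have "x \<ominus> cmp 0 x \<in> positive_part"
      using x cmp_piece[OF cmp_G[OF x(2), of 0], of 0]
      by (auto simp: positive_part_def cmp_add cmp_uminus minus_eq r_neg)
    then have "\<ominus> (x \<ominus> cmp 0 x) \<oplus> x \<in> J" using J x by (auto intro!: J.a_closed J.a_inv_closed)
    moreover have "\<ominus> (x \<ominus> cmp 0 x) \<oplus> x = cmp 0 x" using x cmp_closed[OF x(2), of 0] by algebra
    ultimately have "cmp 0 x \<in> J" by simp
    moreover have "cmp 0 x \<in> Units R" using field[OF cmp_G[OF x(2)]] x by simp
    ultimately have "\<one> \<in> J" by (metis J.I_l_closed Units_inv_closed Units_l_inv)
    then show ?thesis using J.one_imp_carrier by simp
  qed
qed

text \<open>The step lost in passing to the core is regained by adding the positive part on top: it is a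
maximal ideal and contains the core, so it differs from the core of a prime that is not homogeneous.\<close>

lemma prime_chain_to_positive_part:
  assumes field: "\<And>k. k \<in> G 0 \<Longrightarrow> k \<noteq> \<zero> \<Longrightarrow> k \<in> Units R" and nontrivial: "\<one> \<noteq> \<zero>"
    and chain: "prime_chain R n P"
  shows "\<exists>P'. prime_chain R n P' \<and> P' n = positive_part"
proof -
  have max: "maximalideal positive_part R" by (rule positive_part_maximal[OF field nontrivial])
  then have prime: "primeideal positive_part R" by (rule maximalideal_prime)
  show ?thesis
  proof (cases n)
    case 0
    then show ?thesis using prime by (intro exI[of _ "\<lambda>_. positive_part"]) (auto simp: prime_chain_def)
  next
    case (Suc m)
    let ?p = "P (Suc m)"
    have p: "primeideal ?p R" using chain Suc by (auto simp: prime_chain_def)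
    interpret p: primeideal ?p R by fact
    have core_le: "core ?p \<subseteq> positive_part"
    proof
      fix x assume x: "x \<in> core ?p"
      then have xc: "x \<in> carrier R" "cmp 0 x \<in> ?p" by (auto simp: core_def)
      have "cmp 0 x = \<zero>"
      proof (rule ccontr)
        assume "cmp 0 x \<noteq> \<zero>"
        then have "cmp 0 x \<in> Units R" using field[OF cmp_G[OF xc(1)]] by simp
        then have "\<one> \<in> ?p" using xc by (metis p.I_l_closed Units_inv_closed Units_l_inv)
        then show False using p.I_notcarr p.one_imp_carrier by metis
      qed
      then show "x \<in> positive_part" using xc by (simp add: positive_part_def)
    qed
    show ?thesis
    proof (cases "core ?p = ?p")
      case True
      then have "?p \<subseteq> positive_part" using core_le by simp
      from prime_chain_raise_top[OF chain[unfolded Suc] prime this] show ?thesis unfolding Suc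
        by (metis fun_upd_same)
    next
      case False
      from prime_chain_core[OF chain[unfolded Suc] this]
      obtain P' where P': "prime_chain R m P'" "P' m = core ?p" by blast
      have "core ?p \<noteq> positive_part"
      proof
        assume "core ?p = positive_part"
        then have "positive_part \<subseteq> ?p" "positive_part \<noteq> ?p" using core_subset[OF p.ideal_axioms] False by auto
        then show False
          using maximalideal.I_maximal[OF max p.ideal_axioms] p.I_notcarr p.Icarr by blast
      qed
      then have "P' m \<subset> positive_part" using core_le P' by auto
      from prime_chain_extend[OF P'(1) prime this] show ?thesis unfolding Suc by (metis fun_upd_same)
    qed
  qed
qed

end

section \<open>Linear algebra over the coefficient field\<close>

context ring
begin

definition subspace :: "'a set \<Rightarrow> 'a set \<Rightarrow> bool" where
  "subspace K W \<longleftrightarrow> additive_subgroup W R \<and> (\<forall>k\<in>K. \<forall>w\<in>W. k \<otimes> w \<in> W)"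

lemma Span_subspace:
  assumes "subfield K R" "set us \<subseteq> carrier R" shows "subspace K (Span K us)"
  using Span_is_add_subgroup[OF assms] Span_smult_closed[OF assms]
  by (auto simp: subspace_def additive_subgroup_def)

lemma Span_least:
  assumes "subfield K R" "subspace K W" "set us \<subseteq> W" shows "Span K us \<subseteq> W"
proof (rule Span_min[OF assms(1)])
  show "set us \<subseteq> carrier R" "subgroup W (add_monoid R)"
    using assms additive_subgroup.a_subset by (auto simp: subspace_def additive_subgroup_def dest: subgroup.subset)
  show "K <#> set us \<subseteq> W" using assms by (auto simp: subspace_def set_mult_def)
qed

lemma base_of_Span:
  assumes K: "subfield K R" and ts: "set ts \<subseteq> carrier R"
  shows "\<exists>us. set us \<subseteq> carrier R \<and> independent K us \<and> Span K us = Span K ts \<and> length us \<le> length ts"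
  using ts
proof (induction ts)
  case Nil
  then show ?case by (intro exI[of _ "[]"]) auto
next
  case (Cons t ts)
  then obtain us where us: "set us \<subseteq> carrier R" "independent K us" "Span K us = Span K ts"
    "length us \<le> length ts" by auto
  show ?case
  proof (cases "t \<in> Span K ts")
    case True
    then have "Span K (t # ts) \<subseteq> Span K ts"
      using mono_Span_subset[OF K, of "t # ts" ts] Span_base_incl[OF K, of ts] Cons.prems by auto
    moreover have "Span K ts \<subseteq> Span K (t # ts)" using mono_Span[OF K, of ts t] Cons.prems by auto
    ultimately have "Span K (t # ts) = Span K us" using us by auto
    then show ?thesis using us by (intro exI[of _ us]) auto
  next
    case False
    then have "independent K (t # us)" using us Cons.prems by (auto intro: li_Cons)
    moreover have "Span K (t # us) = Span K (t # ts)" using us(3) by simp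
    ultimately show ?thesis using us Cons.prems by (intro exI[of _ "t # us"]) auto
  qed
qed

lemma subspace_dimension:
  assumes K: "subfield K R" and W: "subspace K W" and us: "set us \<subseteq> carrier R" "W \<subseteq> Span K us"
  shows "\<exists>n. dimension n K W"
proof -
  obtain vs where vs: "set vs \<subseteq> carrier R" "independent K vs" "Span K vs = Span K us"
    using filter_base[OF K us(1)] by blast
  define good where "good ws \<longleftrightarrow> independent K ws \<and> set ws \<subseteq> W" for ws
  have "good []" by (simp add: good_def)
  moreover have "\<forall>ws. good ws \<longrightarrow> length ws < Suc (length vs)"
    using independent_length_le[OF K _ vs(2)] us(2) vs(3) by (auto simp: good_def le_imp_less_Suc)
  ultimately obtain ws where ws: "good ws" "\<forall>xs. good xs \<longrightarrow> length xs \<le> length ws"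
    using ex_has_greatest_nat[of good "[]" length] by blast
  have "W \<subseteq> Span K ws"
  proof (rule ccontr)
    assume "\<not> ?thesis"
    then obtain w where w: "w \<in> W" "w \<notin> Span K ws" by blast
    moreover have "w \<in> carrier R" using w W additive_subgroup.a_Hcarr by (auto simp: subspace_def)
    ultimately have "good (w # ws)" using ws(1) by (auto simp: good_def intro: li_Cons)
    then show False using ws(2) by fastforce
  qed
  moreover have "Span K ws \<subseteq> W" using Span_least[OF K W] ws(1) by (auto simp: good_def)
  ultimately have "Span K ws = W" by simp
  then show ?thesis using dimensionI[OF K, of ws W] ws(1) by (auto simp: good_def)
qed

lemma dimension_subspace:
  assumes "subfield K R" "dimension n K W" shows "subspace K W"
  using exists_base[OF assms] Span_subspace[OF assms(1)] by metis

end

context cring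
begin

lemma colon_subspace:
  assumes K: "subfield K R" and E: "subspace K E" and f: "f \<in> carrier R"
  shows "subspace K {v \<in> carrier R. f \<otimes> v \<in> E}"
proof -
  interpret E: additive_subgroup E R using E by (simp add: subspace_def)
  have "subgroup {v \<in> carrier R. f \<otimes> v \<in> E} (add_monoid R)"
    by (rule add.subgroupI)
      (use f in \<open>auto simp: r_distr r_minus a_inv_def[symmetric] intro!: exI[of _ \<zero>]\<close>)
  moreover have "k \<otimes> w \<in> carrier R \<and> f \<otimes> (k \<otimes> w) \<in> E"
    if "k \<in> K" "w \<in> carrier R" "f \<otimes> w \<in> E" for k w
  proof -
    have k: "k \<in> carrier R" using that(1) subfieldE(3)[OF K] by blast
    have "k \<otimes> (f \<otimes> w) \<in> E" using E that by (simp add: subspace_def)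
    then show ?thesis using that k f by (simp add: m_lcomm)
  qed
  ultimately show ?thesis by (auto simp: subspace_def additive_subgroup_def)
qed

text \<open>Multiplication by \<open>f\<close> induces an injection of \<open>V / Span K us\<close> into the quotient of the sum by \<open>E\<close>. In
terms of bases: complete \<open>us\<close> to a basis of \<open>V\<close> and adjoin the multiples by \<open>f\<close> of the new vectors.\<close>

lemma dimension_add_multiples:
  assumes K: "subfield K R" and E: "dimension e K E" and V: "dimension m K V" and f: "f \<in> carrier R"
    and us: "independent K us" "set us \<subseteq> V"
    and iff: "\<And>v. v \<in> V \<Longrightarrow> f \<otimes> v \<in> E \<longleftrightarrow> v \<in> Span K us"
  shows "dimension (e + (m - length us)) K {a \<oplus> f \<otimes> v | a v. a \<in> E \<and> v \<in> V}"
proof -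
  have Kc: "K \<subseteq> carrier R" using subfieldE(3)[OF K] by simp
  have Ec: "E \<subseteq> carrier R" by (rule space_subgroup_props(1)[OF K E])
  obtain ws where ws: "length (ws @ us) = m" "independent K (ws @ us)" "Span K (ws @ us) = V"
    using complete_base[OF K V us] by blast
  define T where "T vs = {a \<oplus> f \<otimes> v | a v. a \<in> E \<and> v \<in> Span K (vs @ us)}" for vs
  have "dimension (e + length vs) K (T vs)"
    if "independent K (vs @ us)" "Span K (vs @ us) \<subseteq> V" for vs
    using that
  proof (induction vs)
    case Nil
    have usc: "set us \<subseteq> carrier R" using independent_in_carrier[OF us(1)] .
    have "T [] = E"
    proof
      show "T [] \<subseteq> E" using iff Nil space_subgroup_props(3)[OF K E] by (auto simp: T_def)
      show "E \<subseteq> T []"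
      proof
        fix a assume a: "a \<in> E"
        then have "a = a \<oplus> f \<otimes> \<zero>" using Ec f by auto
        then show "a \<in> T []" using a Span_subgroup_props(2)[OF K usc] by (auto simp: T_def)
      qed
    qed
    then show ?case using E by simp
  next
    case (Cons v vs)
    let ?S = "Span K (vs @ us)"
    have ind: "independent K (v # vs @ us)" using Cons.prems by simp
    have vc: "v \<in> carrier R" "set (vs @ us) \<subseteq> carrier R" using independent_in_carrier[OF ind] by auto
    have Sc: "?S \<subseteq> carrier R" by (rule Span_subgroup_props(1)[OF K vc(2)])
    have sub: "?S \<subseteq> V" "v \<in> V"
    proof -
      show "?S \<subseteq> V" using mono_Span[OF K vc(2,1)] Cons.prems by auto
      show "v \<in> V" using Span_base_incl[OF K, of "v # vs @ us"] vc Cons.prems by auto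
    qed
    have dim: "dimension (e + length vs) K (T vs)"
      using Cons.IH independent_backwards(2)[OF ind] sub by blast
    have "f \<otimes> v \<notin> T vs"
    proof
      assume "f \<otimes> v \<in> T vs"
      then obtain a w where aw: "a \<in> E" "w \<in> ?S" "f \<otimes> v = a \<oplus> f \<otimes> w" by (auto simp: T_def)
      have wc: "w \<in> carrier R" "a \<in> carrier R" using aw Sc Ec by auto
      have "v \<ominus> w \<in> V"
        using sub aw space_subgroup_props(3,4)[OF K V] unfolding minus_eq by blast
      moreover have "f \<otimes> (v \<ominus> w) = f \<otimes> v \<ominus> f \<otimes> w" using f vc(1) wc by algebra
      then have "f \<otimes> (v \<ominus> w) = a" using aw(3) wc f by (simp add: minus_eq a_assoc r_neg)
      ultimately have "v \<ominus> w \<in> Span K us" using iff aw(1) by metis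
      then have "v \<ominus> w \<in> ?S" using mono_Span_append(2)[OF K, of us vs] vc by auto
      then have "(v \<ominus> w) \<oplus> w \<in> ?S" using aw(2) by (rule Span_subgroup_props(3)[OF K vc(2)])
      moreover have "(v \<ominus> w) \<oplus> w = v" using vc(1) wc by algebra
      ultimately show False using independent_backwards(1)[OF ind] by simp
    qed
    then have "dimension (Suc (e + length vs)) K (line_extension K (f \<otimes> v) (T vs))"
      using Suc_dim[OF _ _ dim] f vc by simp
    moreover have "line_extension K (f \<otimes> v) (T vs) = T (v # vs)"
    proof (intro equalityI subsetI)
      fix x assume "x \<in> line_extension K (f \<otimes> v) (T vs)"
      then obtain k a w where x: "k \<in> K" "a \<in> E" "w \<in> ?S" "x = k \<otimes> (f \<otimes> v) \<oplus> (a \<oplus> f \<otimes> w)"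
        by (auto simp: line_extension_mem_iff T_def)
      have c: "k \<in> carrier R" "a \<in> carrier R" "w \<in> carrier R" using x Kc Ec Sc by auto
      have "x = a \<oplus> f \<otimes> (k \<otimes> v \<oplus> w)" unfolding x(4) using c vc(1) f by algebra
      moreover have "k \<otimes> v \<oplus> w \<in> Span K ((v # vs) @ us)"
        using x by (auto simp: line_extension_mem_iff)
      ultimately show "x \<in> T (v # vs)" using x unfolding T_def by blast
    next
      fix x assume "x \<in> T (v # vs)"
      then obtain a u where u: "a \<in> E" "u \<in> Span K ((v # vs) @ us)" "x = a \<oplus> f \<otimes> u"
        by (auto simp: T_def)
      then obtain k w where x: "k \<in> K" "w \<in> ?S" "u = k \<otimes> v \<oplus> w"
        by (auto simp: line_extension_mem_iff)
      have c: "k \<in> carrier R" "a \<in> carrier R" "w \<in> carrier R" using x u Kc Ec Sc by auto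
      have "x = k \<otimes> (f \<otimes> v) \<oplus> (a \<oplus> f \<otimes> w)" unfolding u(3) x(3) using c vc(1) f by algebra
      then show "x \<in> line_extension K (f \<otimes> v) (T vs)"
        using x u unfolding line_extension_mem_iff T_def by blast
    qed
    ultimately show ?case by simp
  qed
  then show ?thesis using ws by (force simp: T_def)
qed

lemma dot_append:
  assumes "length rs = length xs" "set xs \<subseteq> carrier R" "set rs \<subseteq> carrier R"
    "set ys \<subseteq> carrier R" "set ss \<subseteq> carrier R"
  shows "dot (xs @ ys) (rs @ ss) = dot xs rs \<oplus> dot ys ss"
  using assms
proof (induction xs arbitrary: rs)
  case (Cons x xs)
  then obtain r rs' where "rs = r # rs'" by (cases rs) auto
  with Cons show ?case by (simp add: a_assoc)
qed simp

lemma dot_zero: "set xs \<subseteq> carrier R \<Longrightarrow> set rs \<subseteq> {\<zero>} \<Longrightarrow> dot xs rs = \<zero>"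
  by (induction xs arbitrary: rs) (auto split: list.split)

lemma combine_eq_dot:
  "set xs \<subseteq> carrier R \<Longrightarrow> set ks \<subseteq> carrier R \<Longrightarrow> combine ks xs = dot xs ks"
proof (induction xs arbitrary: ks)
  case (Cons x xs)
  then show ?case by (cases ks) (auto simp: m_comm)
qed simp

lemma dot_in_Span:
  assumes K: "subfield K R" and xs: "set xs \<subseteq> carrier R" and rs: "set rs \<subseteq> K"
  shows "dot xs rs \<in> Span K xs"
proof -
  have "dot xs rs = combine rs xs" using combine_eq_dot[OF xs, of rs] rs subfieldE(3)[OF K] by auto
  then show ?thesis unfolding Span_eq_combine_set[OF K xs] using rs by blast
qed

lemma dot_in_Span_take:
  assumes K: "subfield K R" and xs: "set xs \<subseteq> carrier R" and rs: "set rs \<subseteq> K" "length rs = length xs"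
    and zero: "\<And>j. i \<le> j \<Longrightarrow> j < length xs \<Longrightarrow> rs ! j = \<zero>"
  shows "dot xs rs \<in> Span K (take i xs)"
proof -
  have c: "set (take i xs) \<subseteq> carrier R" "set (drop i xs) \<subseteq> carrier R"
     "set (take i rs) \<subseteq> K" "set (drop i rs) \<subseteq> K" "K \<subseteq> carrier R"
    using xs rs subfieldE(3)[OF K] set_take_subset set_drop_subset by (metis subset_trans)+
  have "set (drop i rs) \<subseteq> {\<zero>}"
  proof
    fix r assume "r \<in> set (drop i rs)"
    then obtain j where "j < length (drop i rs)" "r = drop i rs ! j" by (metis in_set_conv_nth)
    then show "r \<in> {\<zero>}" using zero[of "i + j"] rs(2) by simp
  qed
  then have "dot (drop i xs) (drop i rs) = \<zero>" by (rule dot_zero[OF c(2)])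
  moreover have "dot (take i xs @ drop i xs) (take i rs @ drop i rs)
    = dot (take i xs) (take i rs) \<oplus> dot (drop i xs) (drop i rs)"
    by (rule dot_append) (use c rs(2) in auto)
  moreover have "dot (take i xs) (take i rs) \<in> Span K (take i xs)" by (rule dot_in_Span[OF K c(1,3)])
  ultimately show ?thesis using Span_subgroup_props(1)[OF K c(1)] by auto
qed

lemma dot_in_ideal:
  assumes "ideal J R" "set xs \<subseteq> J" "set rs \<subseteq> carrier R" shows "dot xs rs \<in> J"
proof -
  interpret J: ideal J R by fact
  show ?thesis using assms(2,3)
    by (induction xs arbitrary: rs) (auto split: list.split simp: J.I_r_closed)
qed

lemma dot_subring:
  assumes "subring A R"
  shows "cring.dot (R\<lparr>carrier := A\<rparr>) = dot"
proof (intro ext)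
  interpret A: cring "R\<lparr>carrier := A\<rparr>"
    using assms subring_is_ring ring.axioms cring_def subcringI' subcring_iff subringE(1) is_cring
    by metis
  fix xs rs show "A.dot xs rs = dot xs rs"
    by (induction xs arbitrary: rs) (auto split: list.split)
qed

text \<open>The space \<open>f\<^sub>1 V + \<dots> + f\<^sub>l V\<close>.\<close>

definition combos :: "'a list \<Rightarrow> 'a set \<Rightarrow> 'a set" where
  "combos fs V = {dot fs vs | vs. length vs = length fs \<and> set vs \<subseteq> V}"

lemma dot_snoc:
  assumes "length vs = length fs" "set fs \<subseteq> carrier R" "set vs \<subseteq> carrier R" "f \<in> carrier R" "v \<in> carrier R"
  shows "dot (fs @ [f]) (vs @ [v]) = dot fs vs \<oplus> f \<otimes> v"
  using dot_append[of vs fs "[f]" "[v]"] assms by simp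

lemma combos_snoc:
  assumes "set fs \<subseteq> carrier R" "f \<in> carrier R" "V \<subseteq> carrier R"
  shows "combos (fs @ [f]) V = {a \<oplus> f \<otimes> v | a v. a \<in> combos fs V \<and> v \<in> V}"
proof (intro equalityI subsetI)
  fix x assume "x \<in> combos (fs @ [f]) V"
  then obtain us where us: "length us = Suc (length fs)" "set us \<subseteq> V" "x = dot (fs @ [f]) us"
    by (auto simp: combos_def)
  then obtain vs v where "us = vs @ [v]" by (metis length_Suc_conv_rev)
  then have vs: "length vs = length fs" "set vs \<subseteq> V" "v \<in> V" "x = dot (fs @ [f]) (vs @ [v])" using us by auto
  then have "x = dot fs vs \<oplus> f \<otimes> v" using dot_snoc assms by blast
  then show "x \<in> {a \<oplus> f \<otimes> v | a v. a \<in> combos fs V \<and> v \<in> V}" using vs by (auto simp: combos_def)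
next
  fix x assume "x \<in> {a \<oplus> f \<otimes> v | a v. a \<in> combos fs V \<and> v \<in> V}"
  then obtain vs v where vs: "length vs = length fs" "set vs \<subseteq> V" "v \<in> V" "x = dot fs vs \<oplus> f \<otimes> v"
    by (auto simp: combos_def)
  then have "x = dot (fs @ [f]) (vs @ [v])"
    using dot_snoc[OF vs(1) assms(1) subset_trans[OF vs(2) assms(3)] assms(2) subsetD[OF assms(3) vs(3)]]
    by simp
  then show "x \<in> combos (fs @ [f]) V" using vs by (auto simp: combos_def intro!: exI[of _ "vs @ [v]"])
qed

lemma multiple_in_combos:
  assumes "set fs \<subseteq> carrier R" "subspace K V" "g \<in> set fs" "v \<in> V"
  shows "g \<otimes> v \<in> combos fs V"
  using assms(1,3)
proof (induction fs rule: rev_induct)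
  case (snoc f fs)
  interpret V: additive_subgroup V R using assms(2) by (simp add: subspace_def)
  have zero: "\<zero> \<in> combos fs V"
  proof -
    have "set hs \<subseteq> carrier R \<Longrightarrow> dot hs (replicate (length hs) \<zero>) = \<zero>" for hs
      by (induction hs) auto
    then have "dot fs (replicate (length fs) \<zero>) = \<zero>" using snoc.prems by simp
    then show ?thesis unfolding combos_def using V.zero_closed
      by (auto intro!: exI[of _ "replicate (length fs) \<zero>"])
  qed
  have eq: "combos (fs @ [f]) V = {a \<oplus> f \<otimes> v | a v. a \<in> combos fs V \<and> v \<in> V}"
    using combos_snoc snoc.prems V.a_subset by auto
  have gv: "g \<otimes> v \<in> carrier R" "f \<in> carrier R" using snoc.prems assms(4) by auto
  show ?case
  proof (cases "g = f")
    case True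
    then have "g \<otimes> v = \<zero> \<oplus> f \<otimes> v" using gv by simp
    then show ?thesis unfolding eq using zero assms(4) by blast
  next
    case False
    then have "g \<otimes> v \<in> combos fs V" using snoc by auto
    moreover have "g \<otimes> v = g \<otimes> v \<oplus> f \<otimes> \<zero>" using gv by simp
    ultimately show ?thesis unfolding eq using V.zero_closed by blast
  qed
qed simp

text \<open>The vectors \<open>v\<close> with \<open>f\<^sub>i v\<close> in the previous space include the previous \<open>f\<^sub>j\<close>, because
\<open>f\<^sub>i f\<^sub>j = f\<^sub>j f\<^sub>i\<close>. The hypothesis says that there are no others outside their span, so the
\<open>i\<close>-th step (counted from zero) adds \<open>m - i\<close> dimensions.\<close>

lemma dimension_combos:
  assumes K: "subfield K R" and V: "dimension m K V"
    and fs: "independent K fs" "set fs \<subseteq> V"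
    and rel: "\<And>i v. i < length fs \<Longrightarrow> v \<in> V \<Longrightarrow> fs ! i \<otimes> v \<in> combos (take i fs) V \<Longrightarrow> v \<in> Span K (take i fs)"
  shows "dimension (\<Sum>i<length fs. m - i) K (combos fs V)"
  using fs rel
proof (induction fs rule: rev_induct)
  case Nil
  have "combos [] V = {\<zero>}" by (auto simp: combos_def)
  then show ?case by simp
next
  case (snoc f fs)
  have Vs: "subspace K V" by (rule dimension_subspace[OF K V])
  have Vc: "V \<subseteq> carrier R" by (rule space_subgroup_props(1)[OF K V])
  have ind: "independent K fs" using independent_split(2)[OF K snoc.prems(1)] .
  have fc: "set fs \<subseteq> carrier R" "f \<in> carrier R" "f \<in> V" "set fs \<subseteq> V" using snoc.prems Vc by auto
  have IH: "dimension (\<Sum>i<length fs. m - i) K (combos fs V)"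
  proof (rule snoc.IH[OF ind fc(4)])
    fix i v assume "i < length fs" "v \<in> V" "fs ! i \<otimes> v \<in> combos (take i fs) V"
    then show "v \<in> Span K (take i fs)" using snoc.prems(3)[of i v] by (simp add: nth_append)
  qed
  have "Span K fs \<subseteq> {v \<in> carrier R. f \<otimes> v \<in> combos fs V}"
  proof (rule Span_least[OF K])
    show "set fs \<subseteq> {v \<in> carrier R. f \<otimes> v \<in> combos fs V}"
    proof
      fix g assume g: "g \<in> set fs"
      then have "g \<otimes> f \<in> combos fs V" using multiple_in_combos[OF fc(1) Vs _ fc(3)] by simp
      then show "g \<in> {v \<in> carrier R. f \<otimes> v \<in> combos fs V}" using g fc by (auto simp: m_comm)
    qed
    show "subspace K {v \<in> carrier R. f \<otimes> v \<in> combos fs V}"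
      by (rule colon_subspace[OF K dimension_subspace[OF K IH] fc(2)])
  qed
  then have iff: "f \<otimes> v \<in> combos fs V \<longleftrightarrow> v \<in> Span K fs" if "v \<in> V" for v
    using snoc.prems(3)[of "length fs" v] that by auto
  have "dimension ((\<Sum>i<length fs. m - i) + (m - length fs)) K (combos (fs @ [f]) V)"
    unfolding combos_snoc[OF fc(1,2) Vc]
    by (rule dimension_add_multiples[OF K IH V fc(2) ind fc(4) iff])
  then show ?case by simp
qed

lemma sum_falling:
  assumes "l \<le> m" shows "int (\<Sum>i<l. m - i) = int l * int m - int (l choose 2)"
  using assms
proof (induction l)
  case (Suc l)
  have "Suc l choose 2 = l + (l choose 2)" by (simp add: numeral_2_eq_2)
  then show ?case using Suc by (simp add: of_nat_diff algebra_simps)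
qed simp

end

section \<open>Standard graded rings\<close>

context standard_graded_ring
begin

definition decomposes :: "'a \<Rightarrow> (nat \<Rightarrow> 'a) \<Rightarrow> bool" where
  "decomposes x c \<longleftrightarrow> (\<forall>i. c i \<in> G i) \<and> finite {i. c i \<noteq> \<zero>} \<and> x = (\<Oplus>i\<in>{i. c i \<noteq> \<zero>}. c i)"

definition cmp :: "nat \<Rightarrow> 'a \<Rightarrow> 'a" where
  "cmp i x = (THE c. decomposes x c) i"

lemma piece_carrier: "a \<in> G i \<Longrightarrow> a \<in> carrier R"
  using piece_subgroup additive_subgroup.a_Hcarr by metis

lemma decomposes_cmp: "x \<in> carrier R \<Longrightarrow> decomposes x (\<lambda>i. cmp i x)"
  using theI'[OF piece_decomp[of x]] unfolding decomposes_def cmp_def by simp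

lemma cmp_unique: "x \<in> carrier R \<Longrightarrow> decomposes x c \<Longrightarrow> cmp i x = c i"
proof -
  assume x: "x \<in> carrier R" and c: "decomposes x c"
  have "(THE c. decomposes x c) = c"
    by (rule the1_equality) (use piece_decomp[OF x] c in \<open>simp_all add: decomposes_def\<close>)
  then show ?thesis by (simp add: cmp_def)
qed

lemma finsum_support:
  assumes "finite F" "\<And>i. c i \<in> carrier R" "{i. c i \<noteq> \<zero>} \<subseteq> F"
  shows "(\<Oplus>i\<in>{i. c i \<noteq> \<zero>}. c i) = (\<Oplus>i\<in>F. c i)"
  by (rule add.finprod_mono_neutral_cong_left) (use assms in auto)

lemma graded_ring: "graded_ring R G cmp"
proof (intro graded_ring.intro graded_ring_axioms.intro)
  show "cring R" by unfold_locales
  have Gz: "\<zero> \<in> G i" for i using piece_subgroup additive_subgroup.zero_closed by metis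
  have K: "subring K R" using subfield_K subfieldE(1) by blast
  then show "\<one> \<in> G 0" using piece_0 subringE(3) by simp
  show "additive_subgroup (G i) R" for i by (rule piece_subgroup)
  show "a \<otimes> b \<in> G (i + j)" if "a \<in> G i" "b \<in> G j" for i j a b using piece_mult that .
  show "cmp i x \<in> G i" if "x \<in> carrier R" for i x
    using decomposes_cmp[OF that] by (simp add: decomposes_def)
  show "cmp i (x \<oplus> y) = cmp i x \<oplus> cmp i y" if xy: "x \<in> carrier R" "y \<in> carrier R" for i x y
  proof -
    note x = decomposes_cmp[OF xy(1), unfolded decomposes_def]
      and y = decomposes_cmp[OF xy(2), unfolded decomposes_def]
    let ?F = "{i. cmp i x \<noteq> \<zero>} \<union> {i. cmp i y \<noteq> \<zero>}"
    have fin: "finite ?F" using x y by simp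
    have c: "cmp i x \<in> carrier R" "cmp i y \<in> carrier R" for i using x y piece_carrier by blast+
    have "x = (\<Oplus>i\<in>?F. cmp i x)" using x finsum_support[OF fin, of "\<lambda>i. cmp i x"] c by auto
    moreover have "y = (\<Oplus>i\<in>?F. cmp i y)" using y finsum_support[OF fin, of "\<lambda>i. cmp i y"] c by auto
    ultimately have "x \<oplus> y = (\<Oplus>i\<in>?F. cmp i x) \<oplus> (\<Oplus>i\<in>?F. cmp i y)" by simp
    also have "\<dots> = (\<Oplus>i\<in>?F. cmp i x \<oplus> cmp i y)" using c by (simp add: finsum_addf)
    also have "\<dots> = (\<Oplus>i\<in>{i. cmp i x \<oplus> cmp i y \<noteq> \<zero>}. cmp i x \<oplus> cmp i y)"
      by (rule finsum_support[OF fin, of "\<lambda>i. cmp i x \<oplus> cmp i y", symmetric]) (use c in auto)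
    finally have "x \<oplus> y = (\<Oplus>i\<in>{i. cmp i x \<oplus> cmp i y \<noteq> \<zero>}. cmp i x \<oplus> cmp i y)" .
    moreover have "finite {i. cmp i x \<oplus> cmp i y \<noteq> \<zero>}"
      by (rule finite_subset[OF _ fin]) (use c in auto)
    moreover have "cmp i x \<oplus> cmp i y \<in> G i" for i
      using x y additive_subgroup.a_closed[OF piece_subgroup] by blast
    ultimately have "decomposes (x \<oplus> y) (\<lambda>i. cmp i x \<oplus> cmp i y)" by (simp add: decomposes_def)
    then show ?thesis using cmp_unique[of "x \<oplus> y"] xy by simp
  qed
  show "cmp j x = (if j = i then x else \<zero>)" if x: "x \<in> G i" for i j x
  proof -
    have xc: "x \<in> carrier R" using x piece_carrier by blast
    let ?c = "\<lambda>j. if j = i then x else \<zero>"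
    have "(\<Oplus>j\<in>{j. ?c j \<noteq> \<zero>}. ?c j) = (\<Oplus>j\<in>{i}. ?c j)"
      by (rule finsum_support[of "{i}" ?c]) (use xc in auto)
    also have "\<dots> = x" using xc by simp
    finally have "decomposes x ?c"
      using x Gz by (auto simp: decomposes_def intro: finite_subset[of _ "{i}"])
    then show ?thesis using cmp_unique[OF xc] by simp
  qed
  show "\<exists>N. \<forall>i\<ge>N. cmp i x = \<zero>" if "x \<in> carrier R" for x
  proof -
    have "finite {i. cmp i x \<noteq> \<zero>}" using decomposes_cmp[OF that] by (simp add: decomposes_def)
    then obtain N where "{i. cmp i x \<noteq> \<zero>} \<subseteq> {..<N}" using finite_nat_iff_bounded by blast
    then show ?thesis by (intro exI[of _ N]) (auto simp: subset_iff)
  qed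
  show "x = \<zero>" if "x \<in> carrier R" "\<And>i. cmp i x = \<zero>" for x
    using decomposes_cmp[OF that(1)] that(2) by (simp add: decomposes_def)
qed

end

sublocale standard_graded_ring \<subseteq> graded_ring R G cmp
  by (rule graded_ring)

context standard_graded_ring
begin

lemma K_carrier: "K \<subseteq> carrier R"
  using subfield_K subfieldE(3) by blast

lemma nontrivial: "\<one> \<noteq> \<zero>"
  by (rule subfieldE(6)[OF subfield_K])

lemma K_units: "k \<in> K \<Longrightarrow> k \<noteq> \<zero> \<Longrightarrow> \<exists>l\<in>K. k \<otimes> l = \<one>"
  using subfield_m_inv(1,2)[OF subfield_K, of k] by blast

lemma piece_subspace: "subspace K (G n)"
  using piece_subgroup piece_mult[of _ 0 _ n] piece_0 by (auto simp: subspace_def)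

lemma minus_cmp0_irrelevant:
  assumes x: "x \<in> carrier R" shows "x \<ominus> cmp 0 x \<in> irrelevant_ideal R G"
proof -
  obtain B where B: "B \<subseteq> G 1" "carrier R = generate_ring R (K \<union> B)" using generated_deg1 by blast
  have G1: "G 1 \<subseteq> carrier R" using piece_carrier by blast
  have "B \<subseteq> irrelevant_ideal R G"
    unfolding irrelevant_ideal_def using genideal_self[OF G1] B(1) by blast
  moreover have "ideal (irrelevant_ideal R G) R"
    unfolding irrelevant_ideal_def by (rule genideal_ideal[OF G1])
  moreover have "cmp 0 b = \<zero>" if "b \<in> B" for b using cmp_piece[of b 1 0] that B(1) by auto
  ultimately show ?thesis using minus_cmp0_generated x B(2) piece_0 by metis
qed

lemma irrelevant_subset: "irrelevant_ideal R G \<subseteq> initial_in 0 {\<zero>}"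
proof -
  have "ideal (initial_in 0 {\<zero>}) R"
    by (rule initial_in_ideal[OF ideal.axioms(1)[OF zeroideal]]) auto
  moreover have "G 1 \<subseteq> initial_in 0 {\<zero>}" by (auto simp: initial_in_def cmp_piece)
  ultimately show ?thesis unfolding irrelevant_ideal_def by (rule genideal_minimal)
qed

text \<open>Each graded piece is spanned by the monomials of its degree in the generators.\<close>

lemma piece_finite_dimensional:
  assumes W: "subspace K W" "W \<subseteq> G n"
  shows "\<exists>m. dimension m K W"
proof -
  obtain B where B: "finite B" "B \<subseteq> G 1" "carrier R = generate_ring R (K \<union> B)" using generated_deg1 by blast
  obtain bs where bs: "set bs = B" using finite_list[OF B(1)] by blast
  have Bc: "b \<in> carrier R" if "b \<in> B" for b using B(2) that piece_carrier by blast
  define mons where "mons = rec_nat [\<one>] (\<lambda>n ms. concat (map (\<lambda>b. map (\<lambda>u. b \<otimes> u) ms) bs))"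
  have mons0: "mons 0 = [\<one>]" and monsS: "mons (Suc n) = concat (map (\<lambda>b. map (\<lambda>u. b \<otimes> u) (mons n)) bs)" for n
    by (simp_all add: mons_def)
  have mc: "set (mons n) \<subseteq> carrier R" for n
  proof (induction n)
    case 0 show ?case by (simp add: mons0)
  next
    case (Suc n) then show ?case using bs Bc by (auto simp: monsS)
  qed
  define S where "S n = Span K (mons n)" for n
  have Ssub: "subspace K (S n)" for n unfolding S_def by (rule Span_subspace[OF subfield_K mc])
  then have Sadd: "additive_subgroup (S n) R" for n by (simp add: subspace_def)
  have SK: "k \<otimes> u \<in> S n" if "k \<in> K" "u \<in> S n" for k u n using Ssub that by (auto simp: subspace_def)
  have Sc: "S n \<subseteq> carrier R" for n using Sadd additive_subgroup.a_subset by blast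
  have SB: "b \<otimes> u \<in> S (Suc n)" if b: "b \<in> B" and u: "u \<in> S n" for b u n
  proof -
    have bc: "b \<in> carrier R" using b Bc by blast
    have "S n \<subseteq> {u \<in> carrier R. b \<otimes> u \<in> S (Suc n)}" unfolding S_def[of n]
    proof (rule Span_least[OF subfield_K])
      have "set (mons (Suc n)) \<subseteq> S (Suc n)" unfolding S_def by (rule Span_base_incl[OF subfield_K mc])
      moreover have "b \<otimes> u \<in> set (mons (Suc n))" if "u \<in> set (mons n)" for u
        using b bs that by (auto simp: monsS)
      ultimately show "set (mons n) \<subseteq> {u \<in> carrier R. b \<otimes> u \<in> S (Suc n)}" using mc[of n] by blast
      show "subspace K {u \<in> carrier R. b \<otimes> u \<in> S (Suc n)}"
        by (rule colon_subspace[OF subfield_K Ssub bc])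
    qed
    then show ?thesis using u by blast
  qed
  define T where "T = {x \<in> carrier R. \<forall>n. cmp n x \<in> S n}"
  have Tadd: "x \<oplus> y \<in> T" if "x \<in> T" "y \<in> T" for x y
    using that additive_subgroup.a_closed[OF Sadd] by (auto simp: T_def cmp_add)
  have Tmin: "\<ominus> x \<in> T" if "x \<in> T" for x
    using that additive_subgroup.a_inv_closed[OF Sadd] by (auto simp: T_def cmp_uminus)
  \<comment> \<open>\<open>T\<close> contains 1 and is stable under the generators of the ring, hence is everything.\<close>
  have T1: "\<one> \<in> T"
  proof -
    have "\<one> \<in> S 0" unfolding S_def using Span_base_incl[OF subfield_K mc, of 0] by (auto simp: mons0)
    then show ?thesis using cmp_piece[OF one_G] additive_subgroup.zero_closed[OF Sadd] by (auto simp: T_def)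
  qed
  have TK: "k \<otimes> y \<in> T" if "k \<in> K" "y \<in> T" for k y
    using that SK K_carrier cmp_mult_piece[of k 0 y] piece_0 by (auto simp: T_def)
  have TB: "b \<otimes> y \<in> T" if "b \<in> B" "y \<in> T" for b y
  proof -
    have yc: "y \<in> carrier R" using that by (simp add: T_def)
    have "cmp n (b \<otimes> y) \<in> S n" for n
    proof (cases n)
      case 0
      then show ?thesis using cmp_mult_piece[of b 1 y 0] that yc B(2) additive_subgroup.zero_closed[OF Sadd] by auto
    next
      case (Suc m)
      then show ?thesis using cmp_mult_piece[of b 1 y n] that yc B(2) SB[OF that(1), of "cmp m y" m]
        by (auto simp: T_def)
    qed
    then show ?thesis using yc Bc[OF that(1)] by (simp add: T_def)
  qed
  have "x \<in> carrier R \<and> (\<forall>y\<in>T. x \<otimes> y \<in> T)" if "x \<in> generate_ring R (K \<union> B)" for x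
    using that
  proof (induction rule: generate_ring.induct)
    case one
    then show ?case by (auto simp: T_def)
  next
    case (incl h)
    then show ?case using TK TB K_carrier Bc by blast
  next
    case (a_inv h)
    then show ?case using Tmin by (auto simp: T_def l_minus)
  next
    case (eng_add h1 h2)
    then have "(h1 \<oplus> h2) \<otimes> y = h1 \<otimes> y \<oplus> h2 \<otimes> y" if "y \<in> T" for y
      using that by (auto simp: T_def l_distr)
    then show ?case using Tadd eng_add by auto
  next
    case (eng_mult h1 h2)
    then have "(h1 \<otimes> h2) \<otimes> y = h1 \<otimes> (h2 \<otimes> y)" if "y \<in> T" for y
      using that by (auto simp: T_def m_assoc)
    then show ?case using eng_mult by auto
  qed
  then have "x \<in> T" if "x \<in> carrier R" for x
  proof -
    have "x \<otimes> \<one> \<in> T" using \<open>x \<in> carrier R\<close> T1 B(3) \<open>\<And>x. x \<in> generate_ring R (K \<union> B) \<Longrightarrow> _\<close> by blast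
    then show ?thesis using \<open>x \<in> carrier R\<close> by simp
  qed
  then have "cmp n x \<in> S n" if "x \<in> G n" for x using that piece_carrier by (auto simp: T_def)
  then have "G n \<subseteq> S n" using cmp_piece[of _ n n] by auto
  then have "W \<subseteq> Span K (mons n)" using W by (auto simp: S_def)
  then show ?thesis by (rule subspace_dimension[OF subfield_K W(1) mc])
qed

lemma initial_in_subspace_ideal: "subspace K W \<Longrightarrow> ideal (initial_in e W) R"
  using initial_in_ideal piece_0 by (simp add: subspace_def)

lemma genideal_initial_in:
  assumes "subspace K W" "M \<subseteq> W" "M \<subseteq> G e"
  shows "Idl M \<subseteq> initial_in e W"
  by (rule genideal_minimal[OF initial_in_subspace_ideal[OF assms(1)]])
    (use assms piece_in_initial_in in blast)

text \<open>A graded Nakayama argument. The competing generators are not assumed homogeneous, but every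
element of the ideal has order at least \<open>e\<close>, so their components of degree \<open>e\<close> must span \<open>W\<close>.\<close>

lemma min_gens_genideal:
  assumes W: "dimension n K W" "W \<subseteq> G e"
  shows "min_gens R (Idl W) = n"
  unfolding min_gens_def
proof (rule Least_equality)
  have Ws: "subspace K W" by (rule dimension_subspace[OF subfield_K W(1)])
  have Wc: "W \<subseteq> carrier R" using W piece_carrier by blast
  obtain vs where vs: "set vs \<subseteq> carrier R" "independent K vs" "length vs = n" "Span K vs = W"
    using exists_base[OF subfield_K W(1)] by blast
  have "Idl W = Idl (set vs)"
  proof
    have "set vs \<subseteq> W" using Span_base_incl[OF subfield_K vs(1)] vs(4) by simp
    then show "Idl (set vs) \<subseteq> Idl W" by (rule subset_Idl_subset[OF Wc])
    interpret J: ideal "Idl (set vs)" R by (rule genideal_ideal[OF vs(1)])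
    have "subspace K (Idl (set vs))"
      using J.I_l_closed K_carrier J.additive_subgroup_axioms by (auto simp: subspace_def)
    from Span_least[OF subfield_K this genideal_self[OF vs(1)]]
    have "W \<subseteq> Idl (set vs)" using vs(4) by simp
    then show "Idl W \<subseteq> Idl (set vs)" by (rule genideal_minimal[OF J.ideal_axioms])
  qed
  moreover have "card (set vs) = n" using independent_distinct[OF subfield_K vs(2)] vs(3) distinct_card by blast
  ultimately show "\<exists>B. B \<subseteq> carrier R \<and> finite B \<and> card B = n \<and> Idl W = Idl B"
    using vs(1) by (intro exI[of _ "set vs"]) auto
  fix k assume "\<exists>B. B \<subseteq> carrier R \<and> finite B \<and> card B = k \<and> Idl W = Idl B"
  then obtain B where B: "B \<subseteq> carrier R" "finite B" "card B = k" "Idl W = Idl B" by blast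
  obtain bs where bs: "set bs = B" "distinct bs" using finite_distinct_list[OF B(2)] by blast
  let ?ts = "map (cmp e) bs"
  have tsc: "set ?ts \<subseteq> carrier R" using bs B by auto
  have IW: "Idl W \<subseteq> initial_in e W" using genideal_initial_in[OF Ws _ W(2)] by simp
  have "B \<subseteq> initial_in e (Span K ?ts)"
  proof
    fix b assume b: "b \<in> B"
    have "B \<subseteq> initial_in e W" using IW B(4) genideal_self[OF B(1)] by auto
    then have "b \<in> carrier R" "\<forall>i<e. cmp i b = \<zero>" using b by (auto simp: initial_in_def)
    moreover have "cmp e b \<in> Span K ?ts" using Span_base_incl[OF subfield_K tsc] b bs by auto
    ultimately show "b \<in> initial_in e (Span K ?ts)" by (simp add: initial_in_def)
  qed
  then have "Idl W \<subseteq> initial_in e (Span K ?ts)" unfolding B(4)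
    by (rule genideal_minimal[OF initial_in_subspace_ideal[OF Span_subspace[OF subfield_K tsc]]])
  then have "W \<subseteq> Span K ?ts" using genideal_self[OF Wc] piece_initial_in_iff W(2) by blast
  moreover obtain us where us: "set us \<subseteq> carrier R" "independent K us" "Span K us = Span K ?ts" "length us \<le> length ?ts"
    using base_of_Span[OF subfield_K tsc] by blast
  ultimately have "n \<le> length us"
    using independent_length_le[OF subfield_K vs(2) us(2)] Span_base_incl[OF subfield_K vs(1)] vs(3,4) by simp
  then show "n \<le> k" using us(4) bs B(3) distinct_card by fastforce
qed

end

section \<open>The algebra generated by the forms of lowest degree\<close>

locale equigenerated_ideal = standard_graded_ring +
  fixes I :: "'a set" and d :: nat
  assumes equigenerated: "equigenerated R G d I"
begin

definition V :: "'a set" where "V = I \<inter> G d"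

abbreviation Alg :: "('a, 'b) ring_scheme" where "Alg \<equiv> fiber_subalgebra R K G d I"

lemma I_ideal: "ideal I R"
  using equigenerated by (simp add: equigenerated_def homogeneous_ideal_def)

sublocale I: ideal I R by (rule I_ideal)

lemma I_eq: "I = Idl V"
  using equigenerated by (simp add: equigenerated_def V_def)

lemma V_piece: "V \<subseteq> G d" by (simp add: V_def)

lemma V_carrier: "V \<subseteq> carrier R" using V_piece G_carrier by blast

lemma V_subspace: "subspace K V"
proof -
  have "additive_subgroup V R"
    using add.subgroups_Inter_pair[OF I.a_subgroup additive_subgroup.a_subgroup[OF piece_subgroup]]
    by (simp add: V_def additive_subgroup_def)
  then show ?thesis
    using piece_subspace[of d] I.I_l_closed K_carrier by (auto simp: subspace_def V_def)
qed

lemma V_positive: "V \<subseteq> positive_part"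
  using irrelevant_subset equigenerated by (auto simp: equigenerated_def V_def positive_part_def initial_in_def)

lemma V_dimension: "\<exists>m. dimension m K V"
  by (rule piece_finite_dimensional[OF V_subspace V_piece])

lemma min_gens_I: "dimension m K V \<Longrightarrow> min_gens R I = m"
  using min_gens_genideal[OF _ V_piece] by (simp only: I_eq[symmetric])

lemma dot_piece:
  assumes "set fs \<subseteq> G i" "set vs \<subseteq> G j" shows "dot fs vs \<in> G (i + j)"
  using assms
proof (induction fs arbitrary: vs)
  case (Cons f fs)
  then show ?case using additive_subgroup.a_closed[OF G_subgroup] G_mult by (auto split: list.split)
qed simp

lemma prod_genideal:
  assumes fs: "set fs \<subseteq> V"
  shows "I \<cdot> (Idl (set fs)) = Idl (combos fs V)"
proof
  have fc: "set fs \<subseteq> carrier R" using fs V_carrier by blast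
  interpret J: ideal "Idl (set fs)" R by (rule genideal_ideal[OF fc])
  interpret P: ideal "I \<cdot> (Idl (set fs))" R by (rule ideal_prod_is_ideal[OF I_ideal J.ideal_axioms])
  have cc: "combos fs V \<subseteq> carrier R" using fc V_carrier by (auto simp: combos_def)
  interpret W: ideal "Idl (combos fs V)" R by (rule genideal_ideal[OF cc])
  show "Idl (combos fs V) \<subseteq> I \<cdot> (Idl (set fs))"
  proof (rule genideal_minimal[OF P.ideal_axioms], rule subsetI)
    fix x assume "x \<in> combos fs V"
    then obtain vs where vs: "set vs \<subseteq> V" "x = dot fs vs" by (auto simp: combos_def)
    have "dot gs vs \<in> I \<cdot> (Idl (set fs))" if "set gs \<subseteq> set fs" "set vs \<subseteq> V" for gs vs
      using that
    proof (induction gs arbitrary: vs)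
      case (Cons g gs)
      have "g \<in> Idl (set fs)" using Cons genideal_self[OF fc] by auto
      then have "g \<otimes> v \<in> I \<cdot> (Idl (set fs))" if "v \<in> V" for v
        using ideal_prod.prod[of v I g "Idl (set fs)" R] that J.Icarr V_carrier
        by (auto simp: m_comm V_def)
      then show ?case using Cons by (auto split: list.split)
    qed simp
    then show "x \<in> I \<cdot> (Idl (set fs))" using vs by blast
  qed
  have step: "f \<otimes> r \<in> Idl (combos fs V)" if f: "f \<in> set fs" and r: "r \<in> I" for f r
  proof -
    have fcc: "f \<in> carrier R" using f fc by blast
    have "ideal {r \<in> carrier R. f \<otimes> r \<in> Idl (combos fs V)} R"
      by (rule colon_ideal[OF W.ideal_axioms fcc])
    moreover have "V \<subseteq> {r \<in> carrier R. f \<otimes> r \<in> Idl (combos fs V)}"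
      using multiple_in_combos[OF fc V_subspace f] genideal_self[OF cc] V_carrier by blast
    ultimately have "Idl V \<subseteq> {r \<in> carrier R. f \<otimes> r \<in> Idl (combos fs V)}"
      by (rule genideal_minimal)
    then have "I \<subseteq> {r \<in> carrier R. f \<otimes> r \<in> Idl (combos fs V)}" by (simp only: I_eq[symmetric])
    then show ?thesis using r by blast
  qed
  have step2: "s \<otimes> r \<in> Idl (combos fs V)" if s: "s \<in> Idl (set fs)" and r: "r \<in> I" for s r
  proof -
    have rc: "r \<in> carrier R" using r by simp
    obtain ts where ts: "set ts \<subseteq> carrier R" "s = dot fs ts"
      using genideal_finite_dot[OF fc s] by blast
    have "dot gs ts \<otimes> r \<in> Idl (combos fs V)" if "set gs \<subseteq> set fs" "set ts \<subseteq> carrier R" for gs ts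
      using that
    proof (induction gs arbitrary: ts)
      case (Cons g gs)
      show ?case
      proof (cases ts)
        case (Cons t ts')
        have c: "g \<in> carrier R" "t \<in> carrier R" "dot gs ts' \<in> carrier R"
          using Cons.prems Cons fc by auto
        have "(g \<otimes> t \<oplus> dot gs ts') \<otimes> r = t \<otimes> (g \<otimes> r) \<oplus> dot gs ts' \<otimes> r"
          using c rc by algebra
        moreover have "t \<otimes> (g \<otimes> r) \<in> Idl (combos fs V)"
          using step[OF _ r, of g] Cons.prems c by (simp add: W.I_l_closed)
        moreover have "dot gs ts' \<otimes> r \<in> Idl (combos fs V)" using Cons.IH Cons.prems Cons by auto
        ultimately show ?thesis using Cons by simp
      qed (use rc in simp)
    qed (use rc in simp)
    then show ?thesis using ts by blast
  qed
  show "I \<cdot> (Idl (set fs)) \<subseteq> Idl (combos fs V)"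
  proof
    fix x assume "x \<in> I \<cdot> (Idl (set fs))"
    then show "x \<in> Idl (combos fs V)"
    proof (induction rule: ideal_prod.induct)
      case (prod i j)
      then show ?case using step2[of j i] J.Icarr by (simp add: m_comm)
    qed simp
  qed
qed

text \<open>The hypothesis on relations depends only on degree \<open>d\<close> data. It follows from regularity as well as
from the vanishing of Koszul homology.\<close>

lemma adjusted_if_no_extra_relations:
  assumes fs: "independent K fs" "set fs \<subseteq> V"
    and rel: "\<And>i v. i < length fs \<Longrightarrow> v \<in> V \<Longrightarrow> fs ! i \<otimes> v \<in> combos (take i fs) V \<Longrightarrow>
      v \<in> Span K (take i fs)"
  shows "adjusted R K G d I (length fs) (set fs)"
proof -
  obtain m where m: "dimension m K V" using V_dimension by blast
  have dist: "distinct fs" by (rule independent_distinct[OF subfield_K fs(1)])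
  have le: "length fs \<le> m" by (rule independent_length_le_dimension[OF subfield_K m fs])
  have "dimension (\<Sum>i<length fs. m - i) K (combos fs V)"
    by (rule dimension_combos[OF subfield_K m fs rel])
  moreover have "combos fs V \<subseteq> G (d + d)" using dot_piece fs V_piece unfolding combos_def by blast
  ultimately have "min_gens R (I \<cdot> (Idl (set fs))) = (\<Sum>i<length fs. m - i)"
    unfolding prod_genideal[OF fs(2)] by (rule min_gens_genideal)
  then have "int (min_gens R (I \<cdot> (Idl (set fs)))) = int (length fs) * int (min_gens R I) - int (length fs choose 2)"
    using sum_falling[OF le] min_gens_I[OF m] by simp
  moreover have "independent_set R K (set fs)" using fs(1) dist by (auto simp: independent_set_def)
  ultimately show ?thesis using dist fs by (simp add: adjusted_def distinct_card V_def)
qed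

lemma Alg_gens: "K \<union> V \<subseteq> carrier R" using K_carrier V_carrier by blast

lemma Alg_simps [simp]:
  "carrier Alg = generate_ring R (K \<union> V)" "\<zero>\<^bsub>Alg\<^esub> = \<zero>" "\<one>\<^bsub>Alg\<^esub> = \<one>" "x \<oplus>\<^bsub>Alg\<^esub> y = x \<oplus> y" "x \<otimes>\<^bsub>Alg\<^esub> y = x \<otimes> y"
  by (simp_all add: fiber_subalgebra_def V_def)

lemma Alg_subring: "subring (carrier Alg) R"
  using generate_ring_is_subring[OF Alg_gens] by simp

lemma Alg_carrier: "x \<in> carrier Alg \<Longrightarrow> x \<in> carrier R"
  using subringE(1)[OF Alg_subring] by blast

lemma V_Alg: "V \<subseteq> carrier Alg" and K_Alg: "K \<subseteq> carrier Alg"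
  by (auto intro: generate_ring.incl)

lemma Alg_cring: "cring Alg"
proof -
  have "Alg = R\<lparr>carrier := carrier Alg\<rparr>" by (simp add: fiber_subalgebra_def)
  then show ?thesis using subcring_iff[OF subringE(1)[OF Alg_subring]] subcringI'[OF Alg_subring] by metis
qed

lemma Alg_uminus:
  assumes a: "a \<in> carrier Alg" shows "\<ominus>\<^bsub>Alg\<^esub> a = \<ominus> a"
proof -
  interpret A: cring Alg by (rule Alg_cring)
  have "\<ominus> a \<in> carrier Alg" using subringE(5)[OF Alg_subring] a by blast
  moreover have "\<ominus> a \<oplus>\<^bsub>Alg\<^esub> a = \<zero>\<^bsub>Alg\<^esub>" using Alg_carrier[OF a] by (simp add: l_neg)
  ultimately show ?thesis using A.minus_equality a by blast
qed

lemma Alg_dot: "cring.dot Alg = dot"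
proof -
  have "Alg = R\<lparr>carrier := carrier Alg\<rparr>" by (simp add: fiber_subalgebra_def)
  then show ?thesis using dot_subring[OF Alg_subring] by metis
qed

lemma Alg_additive: "additive_subgroup (carrier Alg) R"
  using Alg_subring subring.axioms(1) by (auto simp: additive_subgroup_def)

lemma cmp_Alg: "x \<in> carrier Alg \<Longrightarrow> cmp i x \<in> carrier Alg"
proof -
  assume "x \<in> carrier Alg"
  then have "x \<in> generate_ring R (K \<union> V)" by simp
  then show ?thesis
  proof (induction arbitrary: i rule: generate_ring.induct)
    case one
    then show ?case using cmp_piece[OF one_G] subringE(2,3)[OF Alg_subring] by simp
  next
    case (incl h)
    then have "h \<in> G 0 \<or> h \<in> G d" using piece_0 V_piece by blast
    then have "cmp i h = h \<or> cmp i h = \<zero>" using cmp_piece by metis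
    then show ?case using incl subringE(2)[OF Alg_subring] by (auto intro: generate_ring.incl)
  next
    case (a_inv h)
    then show ?case using Alg_carrier by (auto simp: cmp_uminus intro: generate_ring.a_inv)
  next
    case (eng_add h1 h2)
    then show ?case using Alg_carrier by (auto simp: cmp_add intro: generate_ring.eng_add)
  next
    case (eng_mult h1 h2)
    then have "cmp i (h1 \<otimes> h2) = (\<Oplus>j\<in>{..i}. cmp j h1 \<otimes> cmp (i - j) h2)" using Alg_carrier cmp_mult by simp
    also have "\<dots> \<in> carrier Alg"
      by (rule finsum_in_subgroup[OF Alg_additive]) (use eng_mult in \<open>auto intro: generate_ring.eng_mult\<close>)
    finally show ?case .
  qed
qed

lemma Alg_Int_additive_subgroup:
  assumes H: "additive_subgroup H R"
  shows "additive_subgroup (carrier Alg \<inter> H) Alg"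
proof -
  interpret A: cring Alg by (rule Alg_cring)
  interpret H: additive_subgroup H R by fact
  have "subgroup (carrier Alg \<inter> H) (add_monoid Alg)"
  proof (rule A.add.subgroupI)
    fix a assume a: "a \<in> carrier Alg \<inter> H"
    then have "\<ominus>\<^bsub>Alg\<^esub> a = \<ominus> a" using Alg_uminus[of a] by blast
    then show "\<ominus>\<^bsub>Alg\<^esub> a \<in> carrier Alg \<inter> H"
      using a subringE(5)[OF Alg_subring] H.a_inv_closed by auto
  next
    have "\<zero> \<in> carrier Alg \<inter> H" using zero_in_generate H.zero_closed by simp
    then show "carrier Alg \<inter> H \<noteq> {}" by blast
  qed (use generate_ring.eng_add in auto)
  then show ?thesis by (simp add: additive_subgroup_def)
qed

lemma Alg_graded: "graded_ring Alg (\<lambda>i. carrier Alg \<inter> G i) cmp"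
proof (intro graded_ring.intro graded_ring_axioms.intro)
  show "cring Alg" by (rule Alg_cring)
  interpret A: cring Alg by (rule Alg_cring)
  show "additive_subgroup (carrier Alg \<inter> G i) Alg" for i
    by (rule Alg_Int_additive_subgroup[OF G_subgroup])
  show "\<exists>N. \<forall>i\<ge>N. cmp i x = \<zero>\<^bsub>Alg\<^esub>" if "x \<in> carrier Alg" for x
    using cmp_bounded Alg_carrier that by simp
  show "x = \<zero>\<^bsub>Alg\<^esub>" if "x \<in> carrier Alg" "\<And>i. cmp i x = \<zero>\<^bsub>Alg\<^esub>" for x
    using cmp_eq_zero[of x] Alg_carrier that by simp
qed (use G_mult one_G cmp_G cmp_Alg Alg_carrier cmp_add cmp_piece in
      \<open>auto intro: generate_ring.eng_mult generate_ring.one\<close>)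

sublocale A: graded_ring Alg "\<lambda>i. carrier Alg \<inter> G i" cmp
  by (rule Alg_graded)

lemma A_G0: "carrier Alg \<inter> G 0 = K" using K_Alg piece_0 by blast

lemma A_genideal_subset:
  assumes M: "M \<subseteq> carrier Alg" shows "genideal Alg M \<subseteq> Idl M"
proof -
  have Mc: "M \<subseteq> carrier R" using M Alg_carrier by blast
  interpret J: ideal "Idl M" R by (rule genideal_ideal[OF Mc])
  have "ideal (carrier Alg \<inter> Idl M) Alg"
  proof (rule idealI)
    show "ring Alg" by unfold_locales
    show "subgroup (carrier Alg \<inter> Idl M) (add_monoid Alg)"
      by (rule additive_subgroup.a_subgroup[OF Alg_Int_additive_subgroup[OF J.additive_subgroup_axioms]])
  qed (use J.I_l_closed J.I_r_closed Alg_carrier in \<open>auto intro: generate_ring.eng_mult\<close>)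
  moreover have "M \<subseteq> carrier Alg \<inter> Idl M" using M genideal_self[OF Mc] by blast
  ultimately have "genideal Alg M \<subseteq> carrier Alg \<inter> Idl M" by (rule A.genideal_minimal)
  then show ?thesis by blast
qed

lemma Span_A_genideal:
  assumes fs: "set fs \<subseteq> carrier Alg" shows "Span K fs \<subseteq> genideal Alg (set fs)"
proof
  have fc: "set fs \<subseteq> carrier R" using fs Alg_carrier by blast
  fix x assume "x \<in> Span K fs"
  then obtain ks where ks: "set ks \<subseteq> K" "x = combine ks fs"
    using Span_eq_combine_set[OF subfield_K fc] by auto
  then have "x = A.dot fs ks" using combine_eq_dot[OF fc] K_carrier by (simp add: Alg_dot)
  then show "x \<in> genideal Alg (set fs)"
    using A.dot_in_ideal[OF A.genideal_ideal[OF fs] A.genideal_self[OF fs]] ks K_Alg by blast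
qed

lemma combos_A_genideal:
  assumes fs: "set fs \<subseteq> carrier Alg" shows "combos fs V \<subseteq> genideal Alg (set fs)"
  using A.dot_in_ideal[OF A.genideal_ideal[OF fs] A.genideal_self[OF fs]] V_Alg
  unfolding combos_def Alg_dot by blast

text \<open>An element of degree \<open>d\<close> in the ideal generated by forms of degree \<open>d\<close> is a combination with
coefficients of degree zero.\<close>

lemma A_genideal_linear_part:
  assumes fs: "set fs \<subseteq> V" and v: "v \<in> V" "v \<in> genideal Alg (set fs)"
  shows "v \<in> Span K fs"
proof -
  have fc: "set fs \<subseteq> carrier R" using fs V_carrier by blast
  have "v \<in> Idl (set fs)" using A_genideal_subset[of "set fs"] fs V_Alg v by blast
  moreover have "Idl (set fs) \<subseteq> initial_in d (Span K fs)"
    by (rule genideal_initial_in[OF Span_subspace[OF subfield_K fc] Span_base_incl[OF subfield_K fc]])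
      (use fs V_piece in blast)
  ultimately show ?thesis using piece_initial_in_iff v V_piece by blast
qed

text \<open>Independence holds because a dependent \<open>f\<^sub>j\<close> would be zero modulo its predecessors; as it is
a nonzerodivisor there, the predecessors would generate the unit ideal.\<close>

theorem regular_sequence_adjusted:
  assumes fs: "set fs \<subseteq> V" and reg: "regular_sequence Alg fs" and i: "i \<le> length fs"
  shows "adjusted R K G d I i (set (take i fs))"
proof -
  have tA: "set (take j fs) \<subseteq> carrier Alg" "set (take j fs) \<subseteq> V" for j
    using fs V_Alg set_take_subset[of j fs] by blast+
  have fA: "set fs \<subseteq> carrier Alg" using fs V_Alg by blast
  have nzd: "x \<in> genideal Alg (set (take j fs))"
    if "j < length fs" "x \<in> carrier Alg" "fs ! j \<otimes> x \<in> genideal Alg (set (take j fs))" for j x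
    using reg that unfolding regular_sequence_def by simp
  have notin: "fs ! j \<notin> Span K (take j fs)" if j: "j < length fs" for j
  proof
    assume "fs ! j \<in> Span K (take j fs)"
    then have "fs ! j \<in> genideal Alg (set (take j fs))" using Span_A_genideal[OF tA(1)] by blast
    moreover have "fs ! j \<in> carrier R" using nth_mem[OF j] fs V_carrier by blast
    ultimately have "fs ! j \<otimes> \<one> \<in> genideal Alg (set (take j fs))" by simp
    then have "\<one> \<in> genideal Alg (set (take j fs))" using nzd[OF j] A.one_closed by simp
    moreover have "genideal Alg (set (take j fs)) \<subseteq> genideal Alg (set fs)"
      by (rule A.subset_Idl_subset[OF fA set_take_subset])
    ultimately have "\<one>\<^bsub>Alg\<^esub> \<in> genideal Alg (set fs)" by auto
    then have "genideal Alg (set fs) = carrier Alg"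
      using ideal.one_imp_carrier[OF A.genideal_ideal[OF fA]] by blast
    then show False using reg by (simp add: regular_sequence_def)
  qed
  have ind: "independent K (rev (take j fs))" if "j \<le> length fs" for j
    using that
  proof (induction j)
    case (Suc j)
    have "Span K (rev (take j fs)) = Span K (take j fs)"
      by (rule Span_same_set[OF subfield_K]) (use subset_trans[OF tA(2) V_carrier] in auto)
    then have "independent K (fs ! j # rev (take j fs))"
      using Suc notin[of j] nth_mem[of j fs] subset_trans[OF fs V_carrier] by (intro li_Cons) auto
    then show ?case using Suc.prems by (simp add: take_Suc_conv_app_nth)
  qed simp
  have "adjusted R K G d I (length (take i fs)) (set (take i fs))"
  proof (rule adjusted_if_no_extra_relations)
    show "independent K (take i fs)"
      using independent_same_set[OF subfield_K _ _ ind[OF i]] by simp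
    fix j v assume j: "j < length (take i fs)" and v: "v \<in> V"
      and "take i fs ! j \<otimes> v \<in> combos (take j (take i fs)) V"
    then have "fs ! j \<otimes> v \<in> combos (take j fs) V" by (simp add: min_absorb1)
    then have "v \<in> genideal Alg (set (take j fs))"
      using nzd[of j v] combos_A_genideal[OF tA(1)] j v V_Alg by auto
    then show "v \<in> Span K (take j (take i fs))"
      using A_genideal_linear_part[OF tA(2) v] j by (simp add: min_absorb1)
  qed (use tA in auto)
  then show ?thesis using i by simp
qed

end

section \<open>Parameters of the algebra\<close>

context cring
begin

definition radical :: "'a set \<Rightarrow> 'a set" where
  "radical J = {x \<in> carrier R. \<exists>n::nat. x [^] n \<in> J}"

lemma radical_ideal:
  assumes "ideal J R"
  shows "ideal (radical J) R"
proof -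
  interpret J: ideal J R by fact
  \<comment> \<open>The factor \<open>u\<close> lets the induction replace the binomial theorem: one factor \<open>x + y\<close> is distributed
    into \<open>u\<close>, which lowers one of the exponents.\<close>
  have binom: "(x \<oplus> y) [^] (a + b) \<otimes> u \<in> J"
    if "x \<in> carrier R" "y \<in> carrier R" "u \<in> carrier R" "x [^] a \<otimes> u \<in> J" "y [^] b \<otimes> u \<in> J"
    for x y u and a b :: nat
    using that
  proof (induction "a + b" arbitrary: a b u)
    case 0
    then show ?case by simp
  next
    case (Suc n)
    note c = Suc.prems(1-3)
    show ?case
    proof (cases "a = 0 \<or> b = 0")
      case True
      then have "u \<in> J" using Suc.prems by auto
      then show ?thesis using c by (simp add: J.I_l_closed)
    next
      case False
      then obtain a' b' where ab: "a = Suc a'" "b = Suc b'" by (metis not0_implies_Suc)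
      have "x [^] a' \<otimes> (x \<otimes> u) \<in> J" "y [^] b' \<otimes> (y \<otimes> u) \<in> J"
        using Suc.prems ab by (simp_all add: m_assoc)
      moreover have "y [^] b \<otimes> (x \<otimes> u) \<in> J" "x [^] a \<otimes> (y \<otimes> u) \<in> J"
        using J.I_l_closed[OF Suc.prems(5) c(1)] J.I_l_closed[OF Suc.prems(4) c(2)] c
        by (simp_all add: m_lcomm)
      ultimately have "(x \<oplus> y) [^] (a' + b) \<otimes> (x \<otimes> u) \<in> J" "(x \<oplus> y) [^] (a + b') \<otimes> (y \<otimes> u) \<in> J"
        using Suc.hyps(1)[of a' b "x \<otimes> u"] Suc.hyps(1)[of a b' "y \<otimes> u"] Suc.hyps(2) c ab by auto
      then have "(x \<oplus> y) [^] (a' + b) \<otimes> (x \<otimes> u) \<oplus> (x \<oplus> y) [^] (a' + b) \<otimes> (y \<otimes> u) \<in> J"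
        using ab by simp
      moreover have "(x \<oplus> y) [^] (a + b) = (x \<oplus> y) [^] (a' + b) \<otimes> (x \<oplus> y)" using ab by simp
      moreover have "p \<otimes> (x \<oplus> y) \<otimes> u = p \<otimes> (x \<otimes> u) \<oplus> p \<otimes> (y \<otimes> u)" if "p \<in> carrier R" for p
        using that c by algebra
      ultimately show ?thesis using c by simp
    qed
  qed
  show ?thesis
  proof (rule idealI)
    show "ring R" by unfold_locales
    have mult: "x \<otimes> a \<in> radical J"
      if a: "a \<in> radical J" and x: "x \<in> carrier R" for a x
    proof -
      obtain n :: nat where n: "a [^] n \<in> J" "a \<in> carrier R" using a by (auto simp: radical_def)
      have "(x \<otimes> a) [^] n = x [^] n \<otimes> a [^] n" using x n by (simp add: nat_pow_distrib)
      then have "(x \<otimes> a) [^] n \<in> J" using n x by (simp add: J.I_l_closed)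
      then show ?thesis using n x by (auto simp: radical_def)
    qed
    show "subgroup (radical J) (add_monoid R)"
    proof (rule add.subgroupI)
      have "\<zero> [^] (1::nat) \<in> J" by simp
      then show "radical J \<noteq> {}" unfolding radical_def by blast
    next
      fix a assume a: "a \<in> radical J"
      then show "\<ominus> a \<in> radical J"
        using mult[OF a, of "\<ominus> \<one>"] a by (simp add: l_minus radical_def)
    next
      fix a b assume ab: "a \<in> radical J" "b \<in> radical J"
      then obtain n m :: nat where "a [^] n \<in> J" "b [^] m \<in> J" by (auto simp: radical_def)
      then have "(a \<oplus> b) [^] (n + m) \<otimes> \<one> \<in> J" using ab by (intro binom) (auto simp: radical_def)
      then show "a \<oplus> b \<in> radical J" using ab by (auto simp: radical_def)
    qed (auto simp: radical_def)
    fix a x assume ax: "a \<in> radical J" "x \<in> carrier R"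
    show "x \<otimes> a \<in> radical J" by (rule mult[OF ax])
    then show "a \<otimes> x \<in> radical J" using ax by (simp add: m_comm radical_def)
  qed
qed

end

context equigenerated_ideal
begin

lemma Alg_nat_pow: "x \<in> carrier Alg \<Longrightarrow> x [^]\<^bsub>Alg\<^esub> (n::nat) = x [^] n"
  using Alg_carrier by (induction n) (simp_all add: A.nat_pow_Suc)

lemma A_positive_part: "A.positive_part = {x \<in> carrier Alg. cmp 0 x = \<zero>}"
  by (simp add: A.positive_part_def)

lemma A_Units: "k \<in> K \<Longrightarrow> k \<noteq> \<zero> \<Longrightarrow> k \<in> Units Alg"
proof -
  assume k: "k \<in> K" "k \<noteq> \<zero>"
  obtain l where l: "l \<in> K" "k \<otimes> l = \<one>" using K_units[OF k] by blast
  have "l \<otimes> k = \<one>" using l k K_carrier m_comm[of l k] by auto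
  then show ?thesis using l k K_Alg by (auto simp: Units_def)
qed

lemma A_positive_part_maximal: "maximalideal A.positive_part Alg"
  by (rule A.positive_part_maximal) (use A_G0 A_Units nontrivial in auto)

lemma A_positive_part_eq: "A.positive_part = genideal Alg V"
proof
  interpret Q: maximalideal A.positive_part Alg by (rule A_positive_part_maximal)
  interpret J: ideal "genideal Alg V" Alg by (rule A.genideal_ideal[OF V_Alg])
  have VQ: "V \<subseteq> A.positive_part" using V_positive V_Alg A_positive_part by (auto simp: positive_part_def)
  then show sub: "genideal Alg V \<subseteq> A.positive_part" by (rule A.genideal_minimal[OF Q.ideal_axioms])
  have gen: "x \<in> generate_ring Alg (K \<union> V)" if "x \<in> carrier Alg" for x
  proof -
    have "x \<in> generate_ring R (K \<union> V)" using that by simp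
    then show ?thesis
    proof (induction rule: generate_ring.induct)
      case (a_inv h)
      then show ?case using generate_ring.a_inv[OF a_inv(2)] Alg_uminus[of h] by simp
    qed (use generate_ring.one[of Alg] generate_ring.eng_add[of _ Alg] generate_ring.eng_mult[of _ Alg] in
        \<open>auto intro: generate_ring.incl\<close>)
  qed
  show "A.positive_part \<subseteq> genideal Alg V"
  proof
    fix x assume x: "x \<in> A.positive_part"
    then have xA: "x \<in> carrier Alg" "cmp 0 x = \<zero>\<^bsub>Alg\<^esub>" by (auto simp: A_positive_part)
    have "x \<ominus>\<^bsub>Alg\<^esub> cmp 0 x \<in> genideal Alg V"
    proof (rule A.minus_cmp0_generated[OF J.ideal_axioms A.genideal_self[OF V_Alg]])
      show "cmp 0 h = \<zero>\<^bsub>Alg\<^esub>" if "h \<in> V" for h using VQ that by (auto simp: A_positive_part)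
      show "x \<in> generate_ring Alg (carrier Alg \<inter> G 0 \<union> V)" unfolding A_G0 by (rule gen[OF xA(1)])
    qed
    moreover have "x \<ominus>\<^bsub>Alg\<^esub> cmp 0 x = x" unfolding xA(2) using xA(1) by (simp only: A.minus_eq A.minus_zero A.r_zero)
    ultimately show "x \<in> genideal Alg V" by (simp only:)
  qed
qed

lemma ideal_power_ideal: "ideal (ideal_power R I n) R"
  by (induction n) (auto intro: ideal_prod_is_ideal I_ideal oneideal)

lemma ideal_prod_initial_in:
  assumes J: "J \<subseteq> initial_in e U" and L: "L \<subseteq> initial_in f W" and id: "ideal (initial_in (e + f) Z) R"
    and UW: "\<And>a b. a \<in> U \<Longrightarrow> b \<in> W \<Longrightarrow> a \<otimes> b \<in> Z"
  shows "J \<cdot> L \<subseteq> initial_in (e + f) Z"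
proof
  interpret Z: ideal "initial_in (e + f) Z" R by fact
  fix x assume "x \<in> J \<cdot> L"
  then show "x \<in> initial_in (e + f) Z"
  proof (induction rule: ideal_prod.induct)
    case (prod i j)
    then show ?case using initial_in_mult[OF _ _ UW] J L by blast
  qed simp
qed

lemma A_subspace: "subspace K (carrier Alg)"
  using Alg_additive K_Alg by (auto simp: subspace_def intro: generate_ring.eng_mult)

text \<open>Ideals of the algebra can thus be used as spaces of leading forms in the ambient ring.\<close>

lemma ideal_A_subspace:
  assumes "ideal J Alg" shows "subspace K J"
proof -
  interpret J: ideal J Alg by fact
  have "subgroup J (add_monoid R)"
  proof (rule add.subgroupI)
    show "J \<subseteq> carrier R" using J.a_Hcarr Alg_carrier by blast
    show "J \<noteq> {}" using J.zero_closed by blast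
    show "\<ominus> a \<in> J" if "a \<in> J" for a
      using J.a_inv_closed[OF that] Alg_uminus[OF J.a_Hcarr[OF that]] by simp
    show "a \<oplus> b \<in> J" if "a \<in> J" "b \<in> J" for a b
      using J.a_closed[OF that] by simp
  qed
  moreover have "k \<otimes> w \<in> J" if "k \<in> K" "w \<in> J" for k w
    using J.I_l_closed[OF that(2), of k] that K_Alg by auto
  ultimately show ?thesis by (auto simp: subspace_def additive_subgroup_def)
qed

lemma I_initial_in: "I \<subseteq> initial_in d V"
  using genideal_initial_in[OF V_subspace _ V_piece] by (simp only: I_eq[symmetric])

lemma ideal_power_initial_in: "ideal_power R I n \<subseteq> initial_in (n * d) (carrier Alg)"
proof (induction n)
  case 0
  have "\<And>x. x \<in> carrier R \<Longrightarrow> cmp 0 x \<in> carrier Alg" using cmp_G[of _ 0] piece_0 K_Alg by blast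
  then show ?case by (auto simp: initial_in_def)
next
  case (Suc n)
  have "I \<cdot> ideal_power R I n \<subseteq> initial_in (d + n * d) (carrier Alg)"
    by (rule ideal_prod_initial_in[OF I_initial_in Suc initial_in_subspace_ideal[OF A_subspace]])
      (use V_Alg in \<open>auto intro: generate_ring.eng_mult\<close>)
  then show ?case by simp
qed

lemma pow_V:
  assumes v: "v \<in> V" shows "v [^] n \<in> ideal_power R I n \<inter> G (n * d)"
proof (induction n)
  case 0
  then show ?case using one_G by simp
next
  case (Suc n)
  have c: "v \<in> carrier R" "v \<in> I" "v \<in> G d" using v V_carrier by (auto simp: V_def)
  have "v [^] Suc n = v \<otimes> v [^] n" using c by (simp add: m_comm)
  then show ?case using Suc c G_mult[of v d "v [^] n" "n * d"] ideal_prod.prod[of v I "v [^] n" "ideal_power R I n" R]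
    by simp
qed

text \<open>From \<open>I\<^sup>n\<^sup>+\<^sup>1 = J I\<^sup>n\<close>, comparing components of degree \<open>(n + 1) d\<close> shows that
the power \<open>v\<^sup>n\<^sup>+\<^sup>1\<close> of any \<open>v \<in> V\<close> lies in the ideal generated by \<open>xs\<close> in the algebra. So \<open>V\<close>, and with it the
ideal \<open>A\<^sub>+\<close> that it generates, is contained in the radical of that ideal.\<close>

lemma positive_part_nilpotent_mod_reduction:
  assumes xs: "set xs \<subseteq> V" and red: "reduction R I (Idl (set xs))" and y: "y \<in> A.positive_part"
  shows "\<exists>n::nat. y [^]\<^bsub>Alg\<^esub> n \<in> genideal Alg (set xs)"
proof -
  have xA: "set xs \<subseteq> carrier Alg" and xc: "set xs \<subseteq> carrier R" using xs V_Alg V_carrier by blast+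
  interpret J: ideal "genideal Alg (set xs)" Alg by (rule A.genideal_ideal[OF xA])
  obtain n where n: "ideal_power R I (Suc n) = (Idl (set xs)) \<cdot> ideal_power R I n"
    using red by (auto simp: reduction_def)
  have Js: "subspace K (genideal Alg (set xs))" by (rule ideal_A_subspace[OF J.ideal_axioms])
  have "Idl (set xs) \<subseteq> initial_in d (genideal Alg (set xs))"
    by (rule genideal_initial_in[OF Js A.genideal_self[OF xA]]) (use xs V_piece in blast)
  from ideal_prod_initial_in[OF this ideal_power_initial_in[of n] initial_in_subspace_ideal[OF Js]]
  have sub: "ideal_power R I (Suc n) \<subseteq> initial_in (d + n * d) (genideal Alg (set xs))"
    unfolding n using J.I_r_closed by simp
  have "V \<subseteq> A.radical (genideal Alg (set xs))"
  proof
    fix v assume v: "v \<in> V"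
    have "v [^] Suc n \<in> ideal_power R I (Suc n)" "v [^] Suc n \<in> G (d + n * d)"
      using pow_V[OF v, of "Suc n"] by auto
    then have "v [^] Suc n \<in> genideal Alg (set xs)" using sub piece_initial_in_iff by blast
    then have "v [^]\<^bsub>Alg\<^esub> Suc n \<in> genideal Alg (set xs)" using Alg_nat_pow[of v "Suc n"] v V_Alg by auto
    then show "v \<in> A.radical (genideal Alg (set xs))" using v V_Alg unfolding A.radical_def by blast
  qed
  then have "genideal Alg V \<subseteq> A.radical (genideal Alg (set xs))"
    by (rule A.genideal_minimal[OF A.radical_ideal[OF J.ideal_axioms]])
  then show ?thesis using y A_positive_part_eq unfolding A.radical_def by blast
qed

text \<open>All relations among the \<open>xs\<close> are Koszul relations. If the coefficients of a
relation are constants, they lie in \<open>(xs)\<close> and so vanish. A relation that expresses \<open>x\<^sub>i v\<close> through the earlier \<open>x\<^sub>j\<close> extends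
by zeros, so \<open>v\<close> is a combination of the \<open>x\<^sub>j\<close> with constant coefficients given by the \<open>i\<close>-th row
of an alternating matrix. The later rows give relations with constant coefficients; they vanish, and so
do the entries of the \<open>i\<close>-th row to the right of the diagonal.\<close>

theorem parameters_adjusted:
  assumes xs: "set xs \<subseteq> V" and ys: "regular_sequence Alg ys" "set ys \<subseteq> A.positive_part"
    and len: "length xs \<le> length ys"
    and pow: "\<And>y. y \<in> A.positive_part \<Longrightarrow> \<exists>n::nat. y [^]\<^bsub>Alg\<^esub> n \<in> genideal Alg (set xs)"
  shows "independent K xs \<and> adjusted R K G d I (length xs) (set xs)"
proof -
  let ?l = "length xs"
  have xA: "set xs \<subseteq> carrier Alg" and xc: "set xs \<subseteq> carrier R" using xs V_Alg V_carrier by blast+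
  interpret Q: maximalideal A.positive_part Alg by (rule A_positive_part_maximal)
  have relation: "\<exists>c. (\<forall>i j. c i j \<in> carrier Alg) \<and> (\<forall>i. c i i = \<zero>) \<and> (\<forall>i j. c i j = \<ominus>\<^bsub>Alg\<^esub> c j i) \<and>
    (\<forall>i < ?l. as ! i = dot xs (map (c i) [0..<?l]))"
    if "set as \<subseteq> carrier Alg" "length as = ?l" "dot xs as = \<zero>" for as
    using A.regular_sequence_koszul_relation[OF ys(1) len xA _ that(1,2)] pow ys(2) that(3)
    unfolding Alg_dot by auto
  have xQ: "set xs \<subseteq> A.positive_part" using xs V_Alg V_positive A_positive_part by (auto simp: positive_part_def)
  have scalars: "as ! i = \<zero>" if as: "set as \<subseteq> K" "length as = ?l" "dot xs as = \<zero>" and i: "i < ?l" for as i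
  proof -
    obtain c where c: "\<forall>i j. c i j \<in> carrier Alg" "\<forall>i < ?l. as ! i = dot xs (map (c i) [0..<?l])"
      using relation[of as] as K_Alg by blast
    have "A.dot xs (map (c i) [0..<?l]) \<in> A.positive_part"
      by (rule A.dot_in_ideal[OF Q.ideal_axioms xQ]) (use c(1) in auto)
    then have "cmp 0 (as ! i) = \<zero>" using c(2) i by (simp add: Alg_dot A_positive_part)
    moreover have "as ! i \<in> G 0" using as i piece_0 nth_mem by fastforce
    ultimately show ?thesis using cmp_piece[of "as ! i" 0 0] by simp
  qed
  have ind: "independent K xs"
  proof (rule ccontr)
    assume dep: "\<not> independent K xs"
    obtain ks where ks: "length ks = ?l" "combine ks xs = \<zero>" "set ks \<subseteq> K" "set ks \<noteq> {\<zero>}"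
      using dependent_imp_non_trivial_combine[OF subfield_K xc dep] by blast
    have "dot xs ks = \<zero>" using combine_eq_dot[OF xc] ks K_carrier by auto
    then have "ks ! i = \<zero>" if "i < ?l" for i using scalars ks that by blast
    then have "set ks \<subseteq> {\<zero>}" using ks(1) by (auto simp: in_set_conv_nth)
    then have "xs = []" using ks(1,4) by (cases ks) auto
    then show False using dep by simp
  qed
  have "adjusted R K G d I ?l (set xs)"
  proof (rule adjusted_if_no_extra_relations[OF ind xs])
    fix i v assume i: "i < ?l" and v: "v \<in> V" and "xs ! i \<otimes> v \<in> combos (take i xs) V"
    then obtain vs where vs: "length vs = i" "set vs \<subseteq> V" "xs ! i \<otimes> v = dot (take i xs) vs"
      by (auto simp: combos_def)
    interpret V: additive_subgroup V R using V_subspace by (simp add: subspace_def)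
    have vc: "v \<in> carrier R" "set vs \<subseteq> carrier R" using v vs V_carrier by auto
    define as where "as = vs @ (\<ominus> v) # replicate (?l - Suc i) \<zero>"
    have asV: "set as \<subseteq> V" using vs v by (auto simp: as_def)
    have asl: "length as = ?l" using vs i by (simp add: as_def)
    have xi: "xs = take i xs @ xs ! i # drop (Suc i) xs" using i by (simp add: id_take_nth_drop)
    have tc: "set (take i xs) \<subseteq> carrier R" "set (drop (Suc i) xs) \<subseteq> carrier R" "xs ! i \<in> carrier R"
      using xc set_take_subset set_drop_subset nth_mem[OF i] by (metis subset_trans, metis subset_trans, blast)
    have "dot xs as = dot (take i xs) vs \<oplus> dot (xs ! i # drop (Suc i) xs) ((\<ominus> v) # replicate (?l - Suc i) \<zero>)"
      unfolding as_def by (subst xi, rule dot_append) (use vs vc tc i in auto)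
    also have "\<dots> = xs ! i \<otimes> v \<oplus> xs ! i \<otimes> (\<ominus> v)"
      using dot_zero[OF tc(2), of "replicate (?l - Suc i) \<zero>"] tc vc vs(3)
      by (auto simp: set_replicate_conv_if)
    also have "\<dots> = \<zero>" using tc vc by (simp add: r_minus r_neg)
    finally have "dot xs as = \<zero>" .
    then obtain c where c: "\<forall>i j. c i j \<in> carrier Alg" "\<forall>i. c i i = \<zero>" "\<forall>i j. c i j = \<ominus>\<^bsub>Alg\<^esub> c j i"
      "\<forall>i < ?l. as ! i = dot xs (map (c i) [0..<?l])"
      using relation[of as] asV asl V_Alg by blast
    \<comment> \<open>Both sides of the equations for \<open>as\<close> have degree \<open>d\<close>, so the entries of \<open>c\<close> may be replaced by
      their constant terms.\<close>
    define e where "e i j = cmp 0 (c i j)" for i j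
    have cmp_dot: "cmp d (dot zs (map f js)) = dot zs (map (\<lambda>j. cmp 0 (f j)) js)"
      if "set zs \<subseteq> V" "\<And>j. f j \<in> carrier R" for zs and f :: "nat \<Rightarrow> 'a" and js
      using that
    proof (induction zs arbitrary: js)
      case (Cons z zs)
      show ?case
      proof (cases js)
        case (Cons j js')
        have z: "z \<in> G d" "z \<in> carrier R" "set zs \<subseteq> carrier R" using Cons.prems(1) V_piece V_carrier by auto
        have "dot zs (map f js') \<in> carrier R" using Cons.prems(2) by (intro dot_closed[OF z(3)]) auto
        then show ?thesis using Cons Cons.IH[of js'] Cons.prems z
          by (simp add: cmp_add cmp_mult_piece)
      qed simp
    qed simp
    have eK: "e i j \<in> K" for i j using cmp_G[of "c i j" 0] c(1) Alg_carrier piece_0 by (simp add: e_def)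
    have ase: "as ! k = dot xs (map (e k) [0..<?l])" if k: "k < ?l" for k
    proof -
      have "as ! k \<in> G d" using asV asl k V_piece nth_mem by fastforce
      then have "as ! k = cmp d (as ! k)" using cmp_piece by simp
      also have "\<dots> = cmp d (dot xs (map (c k) [0..<?l]))" using c(4) k by simp
      also have "\<dots> = dot xs (map (e k) [0..<?l])"
        unfolding e_def by (rule cmp_dot[OF xs]) (use c(1) Alg_carrier in blast)
      finally show ?thesis .
    qed
    have zero: "e k j = \<zero>" if k: "i < k" "k < ?l" and j: "j < ?l" for k j
    proof -
      have "as ! k = \<zero>" using k vs(1) by (simp add: as_def nth_append nth_Cons')
      then have "dot xs (map (e k) [0..<?l]) = \<zero>" using ase[OF k(2)] by simp
      then have "map (e k) [0..<?l] ! j = \<zero>" by (intro scalars) (use eK j in auto)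
      then show ?thesis using j by simp
    qed
    have zero': "e i j = \<zero>" if "i \<le> j" "j < ?l" for j
    proof (cases "j = i")
      case True
      then show ?thesis using c(2) by (simp add: e_def)
    next
      case False
      have "cmp 0 (c j i) = \<zero>" using zero[of j i] that False i by (simp add: e_def)
      then have "cmp 0 (\<ominus>\<^bsub>Alg\<^esub> c j i) = \<ominus>\<^bsub>Alg\<^esub> \<zero>\<^bsub>Alg\<^esub>" using A.cmp_uminus[of "c j i" 0] c(1) by simp
      then have "cmp 0 (\<ominus>\<^bsub>Alg\<^esub> c j i) = \<zero>" using A.minus_zero by simp
      moreover have "c i j = \<ominus>\<^bsub>Alg\<^esub> c j i" using c(3) by blast
      ultimately show ?thesis unfolding e_def by metis
    qed
    have "dot xs (map (e i) [0..<?l]) \<in> Span K (take i xs)"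
      by (rule dot_in_Span_take[OF subfield_K xc]) (use eK zero' in auto)
    then have "as ! i \<in> Span K (take i xs)" using ase[OF i] by simp
    moreover have "as ! i = \<ominus> v" using vs(1) by (simp add: as_def nth_append)
    ultimately have "\<ominus> (\<ominus> v) \<in> Span K (take i xs)"
      using Span_subgroup_props(4)[OF subfield_K tc(1)] by metis
    then show "v \<in> Span K (take i xs)" using vc by simp
  qed
  then show ?thesis using ind by blast
qed

end

section \<open>The special fiber\<close>

lemma carrier_UP: "carrier (UP R) = up R"
  by (simp add: UP_def)

lemma coeff_UP: "p \<in> up R \<Longrightarrow> up_ring.coeff (UP R) p = p"
  by (simp add: UP_def)

context equigenerated_ideal
begin

lemma ideal_power_mult:
  assumes "a \<in> ideal_power R I i" "b \<in> ideal_power R I j"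
  shows "a \<otimes> b \<in> ideal_power R I (i + j)"
  using assms(1)
proof (induction i arbitrary: a)
  case 0
  then show ?case using ideal.I_l_closed[OF ideal_power_ideal assms(2)] by simp
next
  case (Suc i)
  have bc: "b \<in> carrier R" using ideal.Icarr[OF ideal_power_ideal assms(2)] .
  have sub: "ideal_power R I n \<subseteq> carrier R" for n using ideal.Icarr[OF ideal_power_ideal] by blast
  have "a \<in> I \<cdot> ideal_power R I i" using Suc.prems by simp
  then show ?case
  proof (induction rule: ideal_prod.induct)
    case (prod x y)
    then have "x \<in> carrier R" "y \<in> carrier R" using sub by auto
    then have "x \<otimes> y \<otimes> b = x \<otimes> (y \<otimes> b)" using bc by (simp add: m_assoc)
    then show ?case using ideal_prod.prod[OF prod(1) Suc.IH[OF prod(2)], of R] by simp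
  next
    case (sum s1 s2)
    have "s1 \<in> carrier R" "s2 \<in> carrier R"
      using sum(1,2) ideal.Icarr[OF ideal_power_ideal[of "Suc i"]] by auto
    then show ?case using sum(3,4) ideal_prod.sum[of _ R I] bc by (simp add: l_distr)
  qed
qed

abbreviation "mm \<equiv> irrelevant_ideal R G"

lemma mm_ideal: "ideal mm R"
  unfolding irrelevant_ideal_def by (rule genideal_ideal) auto

sublocale mm: ideal mm R by (rule mm_ideal)

text \<open>A ring element is a constant plus an element of the irrelevant ideal, so multiplication moves the
summand in \<open>W\<close> only within \<open>W\<close>, up to an error in the product with the irrelevant ideal.\<close>

lemma split_ideal:
  assumes N: "ideal N R" and W: "subspace K W" "W \<subseteq> N"
  shows "ideal {x. \<exists>y\<in>mm \<cdot> N. \<exists>w\<in>W. x = y \<oplus> w} R"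
proof -
  let ?S = "{x. \<exists>y\<in>mm \<cdot> N. \<exists>w\<in>W. x = y \<oplus> w}"
  interpret N: ideal N R by fact
  interpret M: ideal "mm \<cdot> N" R by (rule ideal_prod_is_ideal[OF mm_ideal N])
  interpret W: additive_subgroup W R using W by (simp add: subspace_def)
  have mult: "r \<otimes> x \<in> ?S"
    if rx: "r \<in> carrier R" "x \<in> ?S" for r x
  proof -
    obtain y w where y: "y \<in> mm \<cdot> N" "w \<in> W" "x = y \<oplus> w" using rx(2) by blast
    let ?k = "cmp 0 r"
    have c: "?k \<in> carrier R" "y \<in> carrier R" "w \<in> carrier R" using that y M.a_Hcarr W.a_Hcarr by auto
    have "r \<otimes> x = (r \<otimes> y \<oplus> (r \<ominus> ?k) \<otimes> w) \<oplus> ?k \<otimes> w" unfolding y(3) using c that(1) by algebra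
    moreover have "(r \<ominus> ?k) \<otimes> w \<in> mm \<cdot> N"
      by (rule ideal_prod.prod[OF minus_cmp0_irrelevant[OF that(1)] subsetD[OF W(2) y(2)]])
    then have "r \<otimes> y \<oplus> (r \<ominus> ?k) \<otimes> w \<in> mm \<cdot> N" using M.I_l_closed[OF y(1) that(1)] by simp
    moreover have "?k \<otimes> w \<in> W" using W(1) y(2) cmp_G[OF that(1), of 0] piece_0 by (simp add: subspace_def)
    ultimately show ?thesis by blast
  qed
  have carr: "x \<in> carrier R" if "x \<in> ?S" for x
    using that M.a_Hcarr W.a_Hcarr by auto
  show ?thesis
  proof (rule idealI)
    show "ring R" by unfold_locales
    show "subgroup ?S (add_monoid R)"
    proof (rule add.subgroupI)
      show "?S \<noteq> {}" using M.zero_closed W.zero_closed by blast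
      show "?S \<subseteq> carrier R" using carr by blast
      show "\<ominus> a \<in> ?S" if "a \<in> ?S" for a
        using mult[of "\<ominus> \<one>" a] that carr[OF that] by (simp add: l_minus)
      show "a \<oplus> b \<in> ?S"
        if ab: "a \<in> ?S" "b \<in> ?S" for a b
      proof -
        obtain y w y' w' where y: "y \<in> mm \<cdot> N" "w \<in> W" "a = y \<oplus> w" "y' \<in> mm \<cdot> N" "w' \<in> W" "b = y' \<oplus> w'"
          using ab by blast
        then have "a \<oplus> b = (y \<oplus> y') \<oplus> (w \<oplus> w')" using M.a_Hcarr W.a_Hcarr by (simp add: a_ac)
        then show ?thesis using M.a_closed[OF y(1,4)] W.a_closed[OF y(2,5)] by blast
      qed
    qed
    fix a x assume ax: "a \<in> ?S" "x \<in> carrier R"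
    show "x \<otimes> a \<in> ?S" by (rule mult[OF ax(2,1)])
    then show "a \<otimes> x \<in> ?S" using m_comm[OF carr[OF ax(1)] ax(2)] by simp
  qed
qed

text \<open>Modulo the irrelevant ideal, \<open>I\<^sup>n\<close> is spanned by its forms of degree \<open>n d\<close>.\<close>

lemma ideal_power_split:
  "ideal_power R I n \<subseteq> {x. \<exists>y\<in>mm \<cdot> ideal_power R I n. \<exists>w\<in>ideal_power R I n \<inter> G (n * d). x = y \<oplus> w}"
proof (induction n)
  case 0
  show ?case
  proof
    fix x assume "x \<in> ideal_power R I 0"
    then have x: "x \<in> carrier R" by simp
    have "(x \<ominus> cmp 0 x) \<otimes> \<one> \<in> mm \<cdot> carrier R"
      by (rule ideal_prod.prod[OF minus_cmp0_irrelevant[OF x] one_closed])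
    then have "x \<ominus> cmp 0 x \<in> mm \<cdot> carrier R" using x by simp
    moreover have "x = (x \<ominus> cmp 0 x) \<oplus> cmp 0 x" using x cmp_closed[OF x, of 0] by algebra
    moreover have "cmp 0 x \<in> carrier R \<inter> G 0" using x cmp_G by simp
    ultimately show "x \<in> {x. \<exists>y\<in>mm \<cdot> ideal_power R I 0. \<exists>w\<in>ideal_power R I 0 \<inter> G (0 * d). x = y \<oplus> w}"
      by auto
  qed
next
  case (Suc n)
  let ?N = "ideal_power R I (Suc n)" and ?W = "ideal_power R I (Suc n) \<inter> G (Suc n * d)"
  let ?D = "{x. \<exists>y\<in>mm \<cdot> ?N. \<exists>w\<in>?W. x = y \<oplus> w}"
  interpret N: ideal ?N R by (rule ideal_power_ideal)
  interpret N': ideal "ideal_power R I n" R by (rule ideal_power_ideal)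
  have Ws: "subspace K ?W"
    using add.subgroups_Inter_pair[OF N.a_subgroup additive_subgroup.a_subgroup[OF piece_subgroup]]
      piece_subspace[of "Suc n * d"] N.I_l_closed K_carrier
    by (auto simp: subspace_def additive_subgroup_def)
  interpret D: ideal ?D R by (rule split_ideal[OF N.ideal_axioms Ws]) blast
  interpret M: ideal "mm \<cdot> ?N" R by (rule ideal_prod_is_ideal[OF mm_ideal N.ideal_axioms])
  have MD: "y \<in> ?D" if "y \<in> mm \<cdot> ?N" for y
  proof -
    have "y = y \<oplus> \<zero>" using M.a_Hcarr[OF that] by simp
    moreover have "\<zero> \<in> ?W" using N.zero_closed by simp
    ultimately show ?thesis using that by blast
  qed
  have aM: "a \<otimes> y \<in> mm \<cdot> ?N" if a: "a \<in> I" and y: "y \<in> mm \<cdot> ideal_power R I n" for a y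
    using y
  proof (induction rule: ideal_prod.induct)
    case (prod i j)
    have "a \<otimes> j \<in> ?N" using ideal_prod.prod[OF a prod(2), of R] by simp
    then have "i \<otimes> (a \<otimes> j) \<in> mm \<cdot> ?N" by (rule ideal_prod.prod[OF prod(1)])
    then show ?case using prod a N'.a_Hcarr I.Icarr mm.Icarr by (simp add: m_lcomm)
  next
    case (sum s1 s2)
    have "s1 \<in> carrier R" "s2 \<in> carrier R"
      using sum(1,2) ideal.Icarr[OF ideal_prod_is_ideal[OF mm_ideal N'.ideal_axioms]] by auto
    then have "a \<otimes> (s1 \<oplus> s2) = a \<otimes> s1 \<oplus> a \<otimes> s2" using a by (simp add: r_distr)
    then show ?case using M.a_closed[OF sum(3,4)] by (simp only:)
  qed
  have aW: "a \<otimes> u \<in> ?D" if a: "a \<in> I" and u: "u \<in> ideal_power R I n \<inter> G (n * d)" for a u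
  proof -
    have uc: "u \<in> carrier R" using u by auto
    have "ideal {a \<in> carrier R. u \<otimes> a \<in> ?D} R" by (rule colon_ideal[OF D.ideal_axioms uc])
    moreover have "V \<subseteq> {a \<in> carrier R. u \<otimes> a \<in> ?D}"
    proof
      fix v assume v: "v \<in> V"
      then have v': "v \<in> I" "v \<in> G d" "u \<otimes> v = v \<otimes> u" using uc by (auto simp: V_def m_comm)
      have "v \<otimes> u \<in> ?W" using ideal_prod.prod[OF v'(1), of u "ideal_power R I n" R] G_mult[OF v'(2), of u "n * d"] u
        by simp
      moreover have "v \<otimes> u = \<zero> \<oplus> v \<otimes> u" using v' uc by simp
      ultimately have "v \<otimes> u \<in> ?D" using M.zero_closed by blast
      then show "v \<in> {a \<in> carrier R. u \<otimes> a \<in> ?D}" using v' by (simp only: mem_Collect_eq G_carrier)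
    qed
    ultimately have "Idl V \<subseteq> {a \<in> carrier R. u \<otimes> a \<in> ?D}" by (rule genideal_minimal)
    then have "I \<subseteq> {a \<in> carrier R. u \<otimes> a \<in> ?D}" by (simp only: I_eq[symmetric])
    then have "u \<otimes> a \<in> ?D" using a by blast
    moreover have "a \<otimes> u = u \<otimes> a" using a uc by (simp add: m_comm)
    ultimately show ?thesis by (simp only:)
  qed
  show ?case
  proof
    fix x assume "x \<in> ?N"
    then have "x \<in> I \<cdot> ideal_power R I n" by simp
    then show "x \<in> ?D"
    proof (induction rule: ideal_prod.induct)
      case (prod a b)
      obtain y w where b: "y \<in> mm \<cdot> ideal_power R I n" "w \<in> ideal_power R I n \<inter> G (n * d)" "b = y \<oplus> w"
        using Suc.IH prod(2) by blast
      have c: "a \<in> carrier R" "y \<in> carrier R" "w \<in> carrier R"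
        using prod(1) b ideal.Icarr[OF ideal_prod_is_ideal[OF mm_ideal N'.ideal_axioms]] by auto
      have "a \<otimes> y \<oplus> a \<otimes> w \<in> ?D" using MD[OF aM[OF prod(1) b(1)]] aW[OF prod(1) b(2)] by (rule D.a_closed)
      moreover have "a \<otimes> b = a \<otimes> y \<oplus> a \<otimes> w" using c b(3) by (simp add: r_distr)
      ultimately show ?case by (simp only:)
    next
      case (sum s1 s2)
      show ?case using sum(3,4) by (rule D.a_closed)
    qed
  qed
qed

lemma ideal_power_cmp_zero:
  assumes x: "x \<in> ideal_power R I n" and zero: "cmp (n * d) x = \<zero>"
  shows "x \<in> mm \<cdot> ideal_power R I n"
proof -
  obtain y w where y: "y \<in> mm \<cdot> ideal_power R I n" "w \<in> ideal_power R I n \<inter> G (n * d)" "x = y \<oplus> w"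
    using ideal_power_split x by blast
  have "ideal (initial_in (0 + n * d) {\<zero>}) R"
    by (rule initial_in_ideal[OF ideal.axioms(1)[OF zeroideal]]) auto
  then have "mm \<cdot> ideal_power R I n \<subseteq> initial_in (0 + n * d) {\<zero>}"
    by (rule ideal_prod_initial_in[OF irrelevant_subset ideal_power_initial_in]) (use Alg_carrier in auto)
  then have "cmp (n * d) y = \<zero>" "y \<in> carrier R" using y(1) by (auto simp: initial_in_def)
  moreover have "cmp (n * d) w = w" "w \<in> carrier R" using y(2) cmp_piece by auto
  ultimately have "w = \<zero>" using zero y(3) by (simp add: cmp_add)
  then show ?thesis using y(1,3) \<open>y \<in> carrier R\<close> by simp
qed

abbreviation "P \<equiv> UP R"
abbreviation "Rees \<equiv> rees_algebra R I"
abbreviation "cf \<equiv> up_ring.coeff P"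
abbreviation "mnm \<equiv> up_ring.monom P"

sublocale P: UP_cring R P by unfold_locales

lemma Rees_simps [simp]:
  "\<zero>\<^bsub>Rees\<^esub> = \<zero>\<^bsub>P\<^esub>" "\<one>\<^bsub>Rees\<^esub> = \<one>\<^bsub>P\<^esub>" "x \<oplus>\<^bsub>Rees\<^esub> y = x \<oplus>\<^bsub>P\<^esub> y" "x \<otimes>\<^bsub>Rees\<^esub> y = x \<otimes>\<^bsub>P\<^esub> y"
  by (simp_all add: rees_algebra_def)

lemma Rees_carrier:
  "carrier Rees = {p \<in> carrier P. \<forall>i. cf p i \<in> ideal_power R I i}"
  by (simp add: rees_algebra_def)

lemma Rees_subring: "subring (carrier Rees) P"
proof (rule ring.subringI[OF P.UP_ring])
  have Z: "\<zero> \<in> ideal_power R I i" for i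
    using ideal_power_ideal additive_subgroup.zero_closed ideal.axioms(1) by metis
  show "carrier Rees \<subseteq> carrier P" by (auto simp: Rees_carrier)
  show "\<one>\<^bsub>P\<^esub> \<in> carrier Rees" using Z by (auto simp: Rees_carrier)
  show "\<ominus>\<^bsub>P\<^esub> h \<in> carrier Rees" if "h \<in> carrier Rees" for h
    using that additive_subgroup.a_inv_closed[OF ideal.axioms(1)[OF ideal_power_ideal]] by (auto simp: Rees_carrier)
  show "h1 \<otimes>\<^bsub>P\<^esub> h2 \<in> carrier Rees" if h: "h1 \<in> carrier Rees" "h2 \<in> carrier Rees" for h1 h2
  proof -
    have "(\<Oplus>i\<in>{..n}. cf h1 i \<otimes> cf h2 (n - i)) \<in> ideal_power R I n" for n
    proof (rule finsum_in_subgroup[OF ideal.axioms(1)[OF ideal_power_ideal]])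
      fix i assume "i \<in> {..n}"
      then show "cf h1 i \<otimes> cf h2 (n - i) \<in> ideal_power R I n"
        using ideal_power_mult[of "cf h1 i" i "cf h2 (n - i)" "n - i"] h
        by (simp add: Rees_carrier)
    qed
    then show ?thesis using h by (auto simp: Rees_carrier)
  qed
  show "h1 \<oplus>\<^bsub>P\<^esub> h2 \<in> carrier Rees" if "h1 \<in> carrier Rees" "h2 \<in> carrier Rees" for h1 h2
    using that additive_subgroup.a_closed[OF ideal.axioms(1)[OF ideal_power_ideal]] by (auto simp: Rees_carrier)
qed

lemma Rees_cring: "cring Rees"
proof -
  have "Rees = P\<lparr>carrier := carrier Rees\<rparr>" by (simp add: rees_algebra_def)
  then show ?thesis using ring.subcring_iff[OF P.UP_ring subringE(1)[OF Rees_subring]] cring.subcringI'[OF P.UP_cring Rees_subring] by metis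
qed

sublocale Rees: cring Rees by (rule Rees_cring)

lemma coeff_bound: "p \<in> carrier P \<Longrightarrow> \<exists>n. bound \<zero> n (cf p)"
  using bound_upD[of p] coeff_UP[of p R] unfolding carrier_UP by metis

text \<open>Multiplicative on the Rees algebra because \<open>I\<^sup>i\<close> has order at least \<open>i d\<close>, so that components of
degree \<open>i d\<close> are lowest degree parts.\<close>

definition initial_form :: "(nat \<Rightarrow> 'a) \<Rightarrow> (nat \<Rightarrow> 'a)" where
  "initial_form p = (\<lambda>i. cmp (i * d) (cf p i))"

lemma initial_form_closed:
  assumes "p \<in> carrier P"
  shows "initial_form p \<in> carrier P" "cf (initial_form p) i = cmp (i * d) (cf p i)"
proof -
  have "initial_form p \<in> up R"
  proof (rule mem_upI)
    show "initial_form p n \<in> carrier R" for n using assms by (simp add: initial_form_def)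
    obtain n where "bound \<zero> n (cf p)" using coeff_bound[OF assms] by blast
    then have "bound \<zero> n (initial_form p)" by (auto simp: bound_def initial_form_def)
    then show "\<exists>n. bound \<zero> n (initial_form p)" by blast
  qed
  note up = this
  show "initial_form p \<in> carrier P" unfolding carrier_UP by (rule up)
  show "cf (initial_form p) i = cmp (i * d) (cf p i)"
    unfolding coeff_UP[OF up] by (simp only: initial_form_def)
qed

lemma initial_form_add:
  assumes "p \<in> carrier P" "q \<in> carrier P"
  shows "initial_form (p \<oplus>\<^bsub>P\<^esub> q) = initial_form p \<oplus>\<^bsub>P\<^esub> initial_form q"
  by (rule P.up_eqI) (use assms in \<open>simp_all add: initial_form_closed cmp_add\<close>)

lemma initial_form_mult:
  assumes p: "p \<in> carrier Rees" and q: "q \<in> carrier Rees"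
  shows "initial_form (p \<otimes>\<^bsub>P\<^esub> q) = initial_form p \<otimes>\<^bsub>P\<^esub> initial_form q"
proof (rule P.up_eqI)
  have pq: "p \<in> carrier P" "q \<in> carrier P" using p q by (auto simp: Rees_carrier)
  show "initial_form (p \<otimes>\<^bsub>P\<^esub> q) \<in> carrier P" "initial_form p \<otimes>\<^bsub>P\<^esub> initial_form q \<in> carrier P"
    using pq by (simp_all add: initial_form_closed)
  fix n
  have top: "cmp (n * d) (cf p i \<otimes> cf q (n - i))
     = cmp (i * d) (cf p i) \<otimes> cmp ((n - i) * d) (cf q (n - i))" if i: "i \<le> n" for i
  proof -
    let ?a = "cf p i" and ?b = "cf q (n - i)"
    have "?a \<in> initial_in (i * d) (carrier Alg)" "?b \<in> initial_in ((n - i) * d) (carrier Alg)"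
      using p q ideal_power_initial_in by (auto simp: Rees_carrier)
    then have "?a \<in> initial_in (i * d) {cmp (i * d) ?a}" "?b \<in> initial_in ((n - i) * d) {cmp ((n - i) * d) ?b}"
      by (auto simp: initial_in_def)
    then have "?a \<otimes> ?b \<in> initial_in (i * d + (n - i) * d) {cmp (i * d) ?a \<otimes> cmp ((n - i) * d) ?b}"
      by (rule initial_in_mult) auto
    moreover have "i * d + (n - i) * d = n * d" using i by (metis add_mult_distrib le_add_diff_inverse)
    ultimately show ?thesis by (simp add: initial_in_def)
  qed
  have "cf (initial_form (p \<otimes>\<^bsub>P\<^esub> q)) n
     = (\<Oplus>i\<in>{..n}. cmp (n * d) (cf p i \<otimes> cf q (n - i)))"
    using pq by (simp add: initial_form_closed cmp_finsum)
  also have "\<dots> = (\<Oplus>i\<in>{..n}. cmp (i * d) (cf p i) \<otimes> cmp ((n - i) * d) (cf q (n - i)))"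
    by (rule add.finprod_cong') (use top pq in auto)
  also have "\<dots> = cf (initial_form p \<otimes>\<^bsub>P\<^esub> initial_form q) n"
    using pq by (simp add: initial_form_closed)
  finally show "cf (initial_form (p \<otimes>\<^bsub>P\<^esub> q)) n = cf (initial_form p \<otimes>\<^bsub>P\<^esub> initial_form q) n" .
qed

sublocale ev: UP_pre_univ_prop R R id P
  by (intro UP_pre_univ_prop.intro ring_hom_cring.intro ring_hom_cring_axioms.intro)
    (unfold_locales, auto simp: ring_hom_def)

text \<open>Setting \<open>t = 1\<close> after taking initial forms maps the Rees algebra onto \<open>k[V]\<close>.\<close>

definition to_Alg :: "(nat \<Rightarrow> 'a) \<Rightarrow> 'a" where
  "to_Alg p = UnivPoly.eval R R id \<one> (initial_form p)"

lemma to_Alg_eq: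
  assumes "p \<in> carrier P"
  shows "to_Alg p = (\<Oplus>i\<in>{..deg R (initial_form p)}. cmp (i * d) (cf p i))"
proof -
  have "to_Alg p = (\<Oplus>i\<in>{..deg R (initial_form p)}. id (cf (initial_form p) i) \<otimes> \<one> [^] i)"
    unfolding to_Alg_def by (rule P.eval_on_carrier[OF initial_form_closed(1)[OF assms]])
  then show ?thesis using assms by (simp add: initial_form_closed)
qed

lemma coeff_initial_Alg:
  assumes "p \<in> carrier Rees" shows "cmp (i * d) (cf p i) \<in> carrier Alg"
proof -
  have "cf p i \<in> initial_in (i * d) (carrier Alg)"
    using assms ideal_power_initial_in by (auto simp: Rees_carrier)
  then show ?thesis by (simp add: initial_in_def)
qed

lemma to_Alg_hom: "ring_hom_ring Rees Alg to_Alg"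
proof (rule ring_hom_ringI)
  show "ring Rees" "ring Alg" by unfold_locales
  have hom: "UnivPoly.eval R R id \<one> \<in> ring_hom P R" by (rule ev.eval_ring_hom[OF one_closed])
  show "to_Alg p \<in> carrier Alg" if p: "p \<in> carrier Rees" for p
  proof -
    have "p \<in> carrier P" using p by (simp add: Rees_carrier)
    then show ?thesis unfolding to_Alg_eq[OF \<open>p \<in> carrier P\<close>]
      by (intro finsum_in_subgroup[OF Alg_additive] coeff_initial_Alg[OF p])
  qed
  show "to_Alg (p \<otimes>\<^bsub>Rees\<^esub> q) = to_Alg p \<otimes>\<^bsub>Alg\<^esub> to_Alg q" if "p \<in> carrier Rees" "q \<in> carrier Rees" for p q
    using that ring_hom_mult[OF hom] by (simp add: to_Alg_def initial_form_mult initial_form_closed Rees_carrier)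
  show "to_Alg (p \<oplus>\<^bsub>Rees\<^esub> q) = to_Alg p \<oplus>\<^bsub>Alg\<^esub> to_Alg q" if "p \<in> carrier Rees" "q \<in> carrier Rees" for p q
    using that ring_hom_add[OF hom] by (simp add: to_Alg_def initial_form_add initial_form_closed Rees_carrier)
  have "initial_form \<one>\<^bsub>P\<^esub> = \<one>\<^bsub>P\<^esub>"
    by (rule P.up_eqI) (auto simp: initial_form_closed cmp_piece[OF one_G])
  then show "to_Alg \<one>\<^bsub>Rees\<^esub> = \<one>\<^bsub>Alg\<^esub>" using ring_hom_one[OF hom] by (simp add: to_Alg_def)
qed

sublocale to_Alg: ring_hom_ring Rees Alg to_Alg by (rule to_Alg_hom)

lemma monom_Rees: "a \<in> ideal_power R I n \<Longrightarrow> mnm a n \<in> carrier Rees"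
  using ideal.Icarr[OF ideal_power_ideal] additive_subgroup.zero_closed[OF ideal.axioms(1)[OF ideal_power_ideal]]
  by (auto simp: Rees_carrier)

lemma to_Alg_monom:
  assumes a: "a \<in> carrier R" shows "to_Alg (mnm a n) = cmp (n * d) a"
proof -
  have "initial_form (mnm a n) = mnm (cmp (n * d) a) n"
    by (rule P.up_eqI) (use a in \<open>auto simp: initial_form_closed\<close>)
  then show ?thesis unfolding to_Alg_def using ev.eval_monom[of "cmp (n * d) a" \<one> n] a by simp
qed

lemma to_Alg_surj: "to_Alg ` carrier Rees = carrier Alg"
proof
  show "to_Alg ` carrier Rees \<subseteq> carrier Alg" using to_Alg.hom_closed by blast
  have V1: "v \<in> ideal_power R I 1" if "v \<in> V" for v
    using ideal_prod.prod[of v I \<one> "carrier R" R] that V_carrier by (auto simp: V_def)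
  have "x \<in> to_Alg ` carrier Rees" if "x \<in> generate_ring R (K \<union> V)" for x
    using that
  proof (induction rule: generate_ring.induct)
    case one
    then show ?case using to_Alg.hom_one Rees.one_closed by (metis Alg_simps(3) imageI)
  next
    case (incl h)
    then show ?case
    proof
      assume h: "h \<in> K"
      then have "to_Alg (mnm h 0) = h"
        using to_Alg_monom[of h 0] K_carrier cmp_piece[of h 0] piece_0 by auto
      then show ?thesis using monom_Rees[of h 0] h K_carrier by force
    next
      assume h: "h \<in> V"
      then have "to_Alg (mnm h 1) = h"
        using to_Alg_monom[of h 1] V_carrier cmp_piece[of h d] V_piece by auto
      then show ?thesis using monom_Rees[OF V1[OF h]] by force
    qed
  next
    case (a_inv h)
    then obtain p where p: "p \<in> carrier Rees" "h = to_Alg p" by blast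
    then have "to_Alg (\<ominus>\<^bsub>Rees\<^esub> p) = \<ominus> h" using to_Alg.hom_a_inv[OF p(1)] Alg_uminus[OF to_Alg.hom_closed[OF p(1)]] by simp
    then show ?case using Rees.a_inv_closed[OF p(1)] by (metis imageI)
  next
    case (eng_add h1 h2)
    then obtain p q where p: "p \<in> carrier Rees" "h1 = to_Alg p" "q \<in> carrier Rees" "h2 = to_Alg q" by blast
    then have "to_Alg (p \<oplus>\<^bsub>Rees\<^esub> q) = h1 \<oplus> h2" using to_Alg.hom_add by simp
    then show ?case using p Rees.a_closed by (metis imageI)
  next
    case (eng_mult h1 h2)
    then obtain p q where p: "p \<in> carrier Rees" "h1 = to_Alg p" "q \<in> carrier Rees" "h2 = to_Alg q" by blast
    then have "to_Alg (p \<otimes>\<^bsub>Rees\<^esub> q) = h1 \<otimes> h2" using to_Alg.hom_mult by simp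
    then show ?case using p Rees.m_closed by (metis imageI)
  qed
  then show "carrier Alg \<subseteq> to_Alg ` carrier Rees" by auto
qed

text \<open>For \<open>d > 0\<close> the summands have distinct degrees and can be separated. For \<open>d = 0\<close> the ideal is
generated by constants; it contains no nonzero ones, so it is zero and only the summand \<open>j = 0\<close> is present.\<close>

lemma to_Alg_zero_coeffs:
  assumes p: "p \<in> carrier Rees" and zero: "to_Alg p = \<zero>"
  shows "cmp (j * d) (cf p j) = \<zero>"
proof -
  have pP: "p \<in> carrier P" using p by (simp add: Rees_carrier)
  let ?N = "deg R (initial_form p)" and ?f = "\<lambda>i. cmp (i * d) (cf p i)"
  have above: "?f j = \<zero>" if "?N < j" for j
    using P.deg_aboveD[OF that initial_form_closed(1)[OF pP]] initial_form_closed(2)[OF pP] by simp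
  have fc: "?f i \<in> carrier R" for i using pP by simp
  have sum: "(\<Oplus>i\<in>{..?N}. ?f i) = \<zero>" using zero to_Alg_eq[OF pP] by simp
  have d0: "?f i = \<zero>" if di: "d = 0" "i > 0" for i
  proof -
    obtain i' where "i = Suc i'" using di(2) gr0_conv_Suc by blast
    moreover have "cf p (Suc i') \<in> ideal_power R I (Suc i')"
      using p unfolding Rees_carrier by blast
    ultimately have "cf p i \<in> I \<cdot> ideal_power R I i'" by simp
    then have "cf p i \<in> I" using ideal_prod_inter[OF I_ideal ideal_power_ideal] by blast
    then have "cf p i \<in> initial_in 0 {\<zero>}"
      using irrelevant_subset equigenerated by (auto simp: equigenerated_def)
    then show ?thesis using di by (simp add: initial_in_def)
  qed
  show ?thesis
  proof (cases "j \<le> ?N \<and> (d > 0 \<or> j = 0)")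
    case True
    have "cmp (j * d) (?f i) = (if j = i then ?f j else \<zero>)" for i
    proof (cases "d = 0")
      case d: True
      then show ?thesis using True d0[of i] cmp_piece[OF cmp_G, of "cf p 0" 0 0] pP by (cases "i = 0") auto
    next
      case False
      then show ?thesis using cmp_piece[OF cmp_G, of "cf p i" "j * d" "i * d"] pP by auto
    qed
    then have "(\<Oplus>i\<in>{..?N}. if j = i then ?f j else \<zero>) = (\<Oplus>i\<in>{..?N}. cmp (j * d) (?f i))"
      by (intro add.finprod_cong') (use fc in auto)
    also have "\<dots> = cmp (j * d) (\<Oplus>i\<in>{..?N}. ?f i)" by (rule cmp_finsum[symmetric]) (use fc in auto)
    finally show ?thesis
      using add.finprod_singleton[of j "{..?N}" "\<lambda>i. ?f j"] True fc sum by simp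
  qed (use above[of j] d0[of j] in force)
qed

lemma irrelevant_Rees: "(\<lambda>a. mnm a 0) ` mm \<subseteq> carrier Rees"
  using monom_Rees[of _ 0] mm.Icarr by auto

lemma to_Alg_kernel_iff: "x \<in> a_kernel Rees Alg to_Alg \<longleftrightarrow> x \<in> carrier Rees \<and> to_Alg x = \<zero>"
  unfolding a_kernel_def' by (simp only: mem_Collect_eq Alg_simps(2))

text \<open>A coefficient in \<open>I\<^sup>i\<close> whose component of degree \<open>i d\<close> vanishes lies in the product of the irrelevant
ideal with \<open>I\<^sup>i\<close>, so a polynomial in the kernel is a sum of monomials in the ideal on the right.\<close>

lemma to_Alg_kernel:
  "a_kernel Rees Alg to_Alg = genideal Rees ((\<lambda>a. mnm a 0) ` mm)"
proof
  let ?N = "genideal Rees ((\<lambda>a. mnm a 0) ` mm)"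
  interpret N: ideal ?N Rees by (rule Rees.genideal_ideal[OF irrelevant_Rees])
  show "?N \<subseteq> a_kernel Rees Alg to_Alg"
  proof (rule Rees.genideal_minimal[OF to_Alg.kernel_is_ideal], rule subsetI)
    fix x assume "x \<in> (\<lambda>a. mnm a 0) ` mm"
    then obtain a where a: "a \<in> mm" "x = mnm a 0" by blast
    then have "to_Alg x = \<zero>" using to_Alg_monom[of a 0] irrelevant_subset mm.Icarr by (auto simp: initial_in_def)
    moreover have "x \<in> carrier Rees" using a irrelevant_Rees by blast
    ultimately show "x \<in> a_kernel Rees Alg to_Alg" by (simp only: to_Alg_kernel_iff)
  qed
  have monomN: "mnm x n \<in> ?N" if "x \<in> mm \<cdot> ideal_power R I n" for x n
    using that
  proof (induction rule: ideal_prod.induct)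
    case (prod a u)
    have c: "a \<in> carrier R" "u \<in> carrier R" using prod mm.Icarr ideal.Icarr[OF ideal_power_ideal] by auto
    have "mnm a 0 \<in> ?N" using Rees.genideal_self[OF irrelevant_Rees] prod by blast
    then have "mnm a 0 \<otimes>\<^bsub>Rees\<^esub> mnm u n \<in> ?N" by (rule N.I_r_closed[OF _ monom_Rees[OF prod(2)]])
    moreover have "mnm a 0 \<otimes>\<^bsub>P\<^esub> mnm u n = mnm (a \<otimes> u) n"
      using P.monom_mult[OF c, of 0 n] by simp
    ultimately show ?case by simp
  next
    case (sum s1 s2)
    have "s1 \<in> carrier R" "s2 \<in> carrier R"
      using sum(1,2) ideal.Icarr[OF ideal_prod_is_ideal[OF mm_ideal ideal_power_ideal]] by auto
    then have "mnm (s1 \<oplus> s2) n = mnm s1 n \<oplus>\<^bsub>Rees\<^esub> mnm s2 n" by simp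
    then show ?case using N.a_closed[OF sum(3,4)] by simp
  qed
  have inN: "p \<in> ?N" if "p \<in> carrier P" "\<And>i. cf p i \<in> mm \<cdot> ideal_power R I i"
     "\<And>i. i \<ge> n \<Longrightarrow> cf p i = \<zero>" for p n
    using that
  proof (induction n arbitrary: p)
    case 0
    then have "p = \<zero>\<^bsub>Rees\<^esub>" by (auto intro: P.up_eqI)
    then show ?case using N.zero_closed by simp
  next
    case (Suc n p)
    let ?m = "mnm (cf p n) n"
    have cc: "cf p n \<in> carrier R" using Suc.prems(1) by simp
    let ?q = "p \<ominus>\<^bsub>P\<^esub> ?m"
    have coeff: "cf ?q i = (if i = n then \<zero> else cf p i)" for i
      using Suc.prems(1) cc by (simp add: a_minus_def r_neg)
    have zero: "\<zero> \<in> mm \<cdot> ideal_power R I i" for i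
      using additive_subgroup.zero_closed[OF ideal.axioms(1)[OF ideal_prod_is_ideal[OF mm_ideal ideal_power_ideal]]] .
    have "?q \<in> ?N"
      by (rule Suc.IH) (use Suc.prems cc coeff zero in \<open>auto simp: le_Suc_eq\<close>)
    then have "?q \<oplus>\<^bsub>Rees\<^esub> ?m \<in> ?N" using monomN[OF Suc.prems(2)] by (rule N.a_closed)
    moreover have "?q \<oplus>\<^bsub>P\<^esub> ?m = p"
      by (rule P.up_eqI) (use Suc.prems(1) cc coeff in auto)
    ultimately show ?case by simp
  qed
  show "a_kernel Rees Alg to_Alg \<subseteq> ?N"
  proof
    fix p assume "p \<in> a_kernel Rees Alg to_Alg"
    then have p: "p \<in> carrier Rees" "to_Alg p = \<zero>" by (simp_all only: to_Alg_kernel_iff)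
    then have pP: "p \<in> carrier P" by (simp add: Rees_carrier)
    obtain n where "bound \<zero> n (cf p)" using coeff_bound[OF pP] by blast
    then have "cf p i = \<zero>" if "i \<ge> Suc n" for i using that by (auto simp: bound_def)
    moreover have "cf p i \<in> mm \<cdot> ideal_power R I i" for i
      using ideal_power_cmp_zero to_Alg_zero_coeffs[OF p] p(1) by (auto simp: Rees_carrier)
    ultimately show "p \<in> ?N" using inN[OF pP] by blast
  qed
qed

theorem special_fiber_iso: "\<exists>\<phi>. \<phi> \<in> ring_iso (special_fiber R G I) Alg"
  using to_Alg.FactRing_iso_set[OF to_Alg_surj] unfolding to_Alg_kernel special_fiber_def by blast

end

section \<open>Invariance under ring isomorphisms\<close>

lemma ring_iso_hom_ring:
  assumes "\<phi> \<in> ring_iso F A" "ring F" "ring A" shows "ring_hom_ring F A \<phi>"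
  using assms by (intro ring_hom_ringI2) (auto simp: ring_iso_def)

lemma ring_iso_genideal:
  assumes iso: "\<phi> \<in> ring_iso F A" and F: "ring F" and A: "ring A"
    and M: "M \<subseteq> carrier F" and x: "x \<in> carrier F"
  shows "\<phi> x \<in> genideal A (\<phi> ` M) \<longleftrightarrow> x \<in> genideal F M"
proof
  let ?\<psi> = "inv_into (carrier F) \<phi>"
  interpret F: ring F by fact
  interpret A: ring A by fact
  interpret \<phi>: ring_hom_ring F A \<phi> by (rule ring_iso_hom_ring[OF iso F A])
  interpret \<psi>: ring_hom_ring A F ?\<psi>
    by (rule ring_iso_hom_ring[OF ring_iso_set_sym[OF F.ring_axioms iso] A F])
  have inj: "inj_on \<phi> (carrier F)" using iso by (auto simp: ring_iso_def bij_betw_def)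
  have MA: "\<phi> ` M \<subseteq> carrier A" using M by auto
  show "x \<in> genideal F M" if "\<phi> x \<in> genideal A (\<phi> ` M)"
  proof -
    have "\<phi> ` M \<subseteq> {a \<in> carrier A. ?\<psi> a \<in> genideal F M}"
      using M MA inj F.genideal_self[OF M] by (auto simp: inv_into_f_f subset_iff)
    then have "genideal A (\<phi> ` M) \<subseteq> {a \<in> carrier A. ?\<psi> a \<in> genideal F M}"
      by (rule A.genideal_minimal[OF \<psi>.ideal_vimage[OF F.genideal_ideal[OF M]]])
    then show ?thesis using that inj x by (auto simp: inv_into_f_f)
  qed
  show "\<phi> x \<in> genideal A (\<phi> ` M)" if "x \<in> genideal F M"
  proof -
    have "M \<subseteq> {r \<in> carrier F. \<phi> r \<in> genideal A (\<phi> ` M)}"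
      using M A.genideal_self[OF MA] by blast
    then have "genideal F M \<subseteq> {r \<in> carrier F. \<phi> r \<in> genideal A (\<phi> ` M)}"
      by (rule F.genideal_minimal[OF \<phi>.ideal_vimage[OF A.genideal_ideal[OF MA]]])
    then show ?thesis using that by blast
  qed
qed

lemma ring_iso_regular_sequence:
  assumes iso: "\<phi> \<in> ring_iso F A" and F: "ring F" and A: "ring A" and reg: "regular_sequence F fs"
  shows "regular_sequence A (map \<phi> fs)"
proof -
  interpret F: ring F by fact
  interpret A: ring A by fact
  have bij: "\<phi> ` carrier F = carrier A" and inj: "inj_on \<phi> (carrier F)"
    using iso by (auto simp: ring_iso_def bij_betw_def)
  have fs: "set fs \<subseteq> carrier F" using reg by (simp add: regular_sequence_def)
  have tk: "set (take i fs) \<subseteq> carrier F" for i using fs set_take_subset[of i fs] by blast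
  note gen = ring_iso_genideal[OF iso F A]
  have "y \<in> genideal A (set (take i (map \<phi> fs)))"
    if i: "i < length (map \<phi> fs)" and y: "y \<in> carrier A"
      and m: "(map \<phi> fs ! i) \<otimes>\<^bsub>A\<^esub> y \<in> genideal A (set (take i (map \<phi> fs)))" for i y
  proof -
    obtain x where x: "x \<in> carrier F" "y = \<phi> x" using y bij by blast
    have fi: "fs ! i \<in> carrier F" using i fs by auto
    have "\<phi> (fs ! i \<otimes>\<^bsub>F\<^esub> x) \<in> genideal A (\<phi> ` set (take i fs))"
      using m i x fi ring_iso_memE(2)[OF iso] by (simp add: take_map)
    then have "fs ! i \<otimes>\<^bsub>F\<^esub> x \<in> genideal F (set (take i fs))"
      using gen[OF tk] fi x F.m_closed by blast
    then have "x \<in> genideal F (set (take i fs))" using reg i x by (simp add: regular_sequence_def)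
    then show ?thesis using gen[OF tk x(1)] x by (simp add: take_map)
  qed
  moreover have "genideal A (set (map \<phi> fs)) \<noteq> carrier A"
  proof
    assume "genideal A (set (map \<phi> fs)) = carrier A"
    then have "carrier F \<subseteq> genideal F (set fs)" using gen[OF fs] bij by auto
    then show False using reg ideal.Icarr[OF F.genideal_ideal[OF fs]] by (auto simp: regular_sequence_def)
  qed
  moreover have "set (map \<phi> fs) \<subseteq> carrier A" using fs bij by auto
  ultimately show ?thesis by (simp add: regular_sequence_def)
qed

lemma ring_iso_prime_chain:
  assumes iso: "\<phi> \<in> ring_iso F A" and F: "cring F" and A: "cring A" and chain: "prime_chain A n P"
  shows "prime_chain F n (\<lambda>i. {x \<in> carrier F. \<phi> x \<in> P i})"
proof -
  interpret F: cring F by fact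
  interpret A: cring A by fact
  interpret \<phi>: ring_hom_ring F A \<phi> by (rule ring_iso_hom_ring[OF iso F.ring_axioms A.ring_axioms])
  have bij: "\<phi> ` carrier F = carrier A" using iso by (auto simp: ring_iso_def bij_betw_def)
  have "{x \<in> carrier F. \<phi> x \<in> P i} \<subset> {x \<in> carrier F. \<phi> x \<in> P (Suc i)}" if i: "i < n" for i
  proof -
    have sub: "P i \<subset> P (Suc i)" using chain i by (simp add: prime_chain_def)
    then obtain a where a: "a \<in> P (Suc i)" "a \<notin> P i" by blast
    have "primeideal (P (Suc i)) A" using chain i by (simp add: prime_chain_def)
    then have "ideal (P (Suc i)) A" by (rule primeideal.axioms(1))
    then have "a \<in> carrier A" using a ideal.Icarr by metis
    then obtain x where "x \<in> carrier F" "a = \<phi> x" using bij by blast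
    then show ?thesis using sub a by blast
  qed
  moreover have "primeideal {x \<in> carrier F. \<phi> x \<in> P i} F" if "i \<le> n" for i
    using \<phi>.primeideal_vimage[OF F] chain that by (simp add: prime_chain_def)
  ultimately show ?thesis by (simp add: prime_chain_def)
qed

lemma ring_iso_maximalideal:
  assumes iso: "\<phi> \<in> ring_iso F A" and F: "ring F" and A: "ring A" and max: "maximalideal Q A"
  shows "maximalideal {x \<in> carrier F. \<phi> x \<in> Q} F"
proof (rule maximalidealI)
  let ?\<psi> = "inv_into (carrier F) \<phi>"
  interpret F: ring F by fact
  interpret A: ring A by fact
  interpret \<phi>: ring_hom_ring F A \<phi> by (rule ring_iso_hom_ring[OF iso F A])
  interpret \<psi>: ring_hom_ring A F ?\<psi>
    by (rule ring_iso_hom_ring[OF ring_iso_set_sym[OF F.ring_axioms iso] A F])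
  interpret Q: maximalideal Q A by fact
  have bij: "\<phi> ` carrier F = carrier A" and inj: "inj_on \<phi> (carrier F)"
    using iso by (auto simp: ring_iso_def bij_betw_def)
  have inv: "?\<psi> (\<phi> x) = x" if "x \<in> carrier F" for x using inj that by (rule inv_into_f_f)
  have inv': "\<phi> (?\<psi> a) = a" "?\<psi> a \<in> carrier F" if "a \<in> carrier A" for a
    using that bij f_inv_into_f[of a \<phi> "carrier F"] inv_into_into[of a \<phi> "carrier F"] by auto
  show "ideal {x \<in> carrier F. \<phi> x \<in> Q} F" by (rule \<phi>.ideal_vimage[OF Q.ideal_axioms])
  have "\<one>\<^bsub>A\<^esub> \<notin> Q" using Q.I_notcarr Q.one_imp_carrier by metis
  then have "\<one>\<^bsub>F\<^esub> \<notin> {x \<in> carrier F. \<phi> x \<in> Q}" using \<phi>.hom_one by simp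
  then show "carrier F \<noteq> {x \<in> carrier F. \<phi> x \<in> Q}" using F.one_closed by blast
  fix J assume J: "ideal J F" "{x \<in> carrier F. \<phi> x \<in> Q} \<subseteq> J" "J \<subseteq> carrier F"
  have "ideal {a \<in> carrier A. ?\<psi> a \<in> J} A" by (rule \<psi>.ideal_vimage[OF J(1)])
  moreover have "Q \<subseteq> {a \<in> carrier A. ?\<psi> a \<in> J}"
    using J(2) Q.Icarr inv' by auto
  ultimately have "{a \<in> carrier A. ?\<psi> a \<in> J} = Q \<or> {a \<in> carrier A. ?\<psi> a \<in> J} = carrier A"
    by (intro Q.I_maximal) auto
  then show "J = {x \<in> carrier F. \<phi> x \<in> Q} \<or> J = carrier F"
  proof
    assume eq: "{a \<in> carrier A. ?\<psi> a \<in> J} = Q"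
    have "J \<subseteq> {x \<in> carrier F. \<phi> x \<in> Q}"
    proof
      fix x assume "x \<in> J"
      then have "x \<in> carrier F" "\<phi> x \<in> carrier A" "?\<psi> (\<phi> x) \<in> J" using J(3) inv by auto
      then show "x \<in> {x \<in> carrier F. \<phi> x \<in> Q}" using eq by blast
    qed
    then show ?thesis using J by blast
  next
    assume eq: "{a \<in> carrier A. ?\<psi> a \<in> J} = carrier A"
    have "carrier F \<subseteq> J"
    proof
      fix x assume x: "x \<in> carrier F"
      then have "\<phi> x \<in> {a \<in> carrier A. ?\<psi> a \<in> J}" using eq by auto
      then show "x \<in> J" using inv[OF x] by auto
    qed
    then show ?thesis using J by blast
  qed
qed

section \<open>The proposition\<close>

lemma Sup_enat_ge_obtain:
  assumes "enat l \<le> Sup {enat n | n. Q n}" "Q 0"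
  shows "\<exists>n\<ge>l. Q n"
proof (cases l)
  case (Suc k)
  have "enat k < enat l" using Suc by simp
  then have "enat k < Sup {enat n | n. Q n}" using assms(1) by (rule less_le_trans)
  then obtain n where "Q n" "k < n" unfolding less_Sup_iff by auto
  then show ?thesis using Suc Suc_leI by blast
qed (use assms in auto)

context equigenerated_ideal
begin

text \<open>The special fiber is Cohen--Macaulay, so the depth of the ideal corresponding to \<open>A\<^sub>+\<close> is its
height, and this is the full dimension by \<open>prime_chain_to_positive_part\<close>.\<close>

lemma regular_sequence_in_positive_part:
  assumes cm: "cohen_macaulay (special_fiber R G I)" and l: "enat l = krull_dim (special_fiber R G I)"
  shows "\<exists>ys. regular_sequence Alg ys \<and> set ys \<subseteq> A.positive_part \<and> l \<le> length ys"
proof -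
  let ?F = "special_fiber R G I"
  have F: "cring ?F" using cm by (simp add: cohen_macaulay_def)
  interpret F: cring ?F by fact
  obtain \<phi> where iso: "\<phi> \<in> ring_iso ?F Alg" using special_fiber_iso by blast
  interpret \<phi>: ring_hom_ring ?F Alg \<phi> by (rule ring_iso_hom_ring[OF iso F.ring_axioms A.ring_axioms])
  have iso': "inv_into (carrier ?F) \<phi> \<in> ring_iso Alg ?F" by (rule ring_iso_set_sym[OF F.ring_axioms iso])
  let ?Q = "{x \<in> carrier ?F. \<phi> x \<in> A.positive_part}"
  have "maximalideal ?Q ?F"
    by (rule ring_iso_maximalideal[OF iso F.ring_axioms A.ring_axioms A_positive_part_maximal])
  then have dh: "depth ?F ?Q = height ?F ?Q" using cm by (simp add: cohen_macaulay_def)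
  have field: "\<And>k. k \<in> carrier Alg \<inter> G 0 \<Longrightarrow> k \<noteq> \<zero>\<^bsub>Alg\<^esub> \<Longrightarrow> k \<in> Units Alg"
    using A_Units unfolding A_G0 by simp
  have nontrivial': "\<one>\<^bsub>Alg\<^esub> \<noteq> \<zero>\<^bsub>Alg\<^esub>" using nontrivial by simp
  have "krull_dim ?F \<le> height ?F ?Q" unfolding krull_dim_def
  proof (rule Sup_least)
    fix e assume "e \<in> {enat n | n. \<exists>P. prime_chain ?F n P}"
    then obtain n P where P: "e = enat n" "prime_chain ?F n P" by blast
    have "prime_chain Alg n (\<lambda>i. {x \<in> carrier Alg. inv_into (carrier ?F) \<phi> x \<in> P i})"
      by (rule ring_iso_prime_chain[OF iso' A.is_cring F P(2)])
    then obtain P' where P': "prime_chain Alg n P'" "P' n = A.positive_part"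
      using A.prime_chain_to_positive_part[OF field nontrivial'] by blast
    have "prime_chain ?F n (\<lambda>i. {x \<in> carrier ?F. \<phi> x \<in> P' i})"
      by (rule ring_iso_prime_chain[OF iso F A.is_cring P'(1)])
    then have "\<exists>P. prime_chain ?F n P \<and> P n = ?Q" using P'(2)
      by (intro exI[of _ "\<lambda>i. {x \<in> carrier ?F. \<phi> x \<in> P' i}"]) simp
    then show "e \<le> height ?F ?Q" unfolding height_def P(1) by (intro Sup_upper) blast
  qed
  then have le: "enat l \<le> depth ?F ?Q" using dh l by simp
  have depth: "depth ?F ?Q = Sup {enat n | n. \<exists>fs. length fs = n \<and> set fs \<subseteq> ?Q \<and> regular_sequence ?F fs}"
    unfolding depth_def by (rule arg_cong[of _ _ Sup]) blast
  have one: "\<one>\<^bsub>?F\<^esub> \<noteq> \<zero>\<^bsub>?F\<^esub>"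
  proof
    assume "\<one>\<^bsub>?F\<^esub> = \<zero>\<^bsub>?F\<^esub>"
    then have "\<phi> \<one>\<^bsub>?F\<^esub> = \<phi> \<zero>\<^bsub>?F\<^esub>" by simp
    moreover have "\<phi> \<zero>\<^bsub>?F\<^esub> = \<zero>"
      using \<phi>.hom_zero by simp
    ultimately show False using ring_iso_memE(4)[OF iso] nontrivial by simp
  qed
  have "genideal ?F {} = {\<zero>\<^bsub>?F\<^esub>}"
    using F.genideal_minimal[OF F.zeroideal, of "{}"]
      additive_subgroup.zero_closed[OF ideal.axioms(1)[OF F.genideal_ideal[of "{}"]]] by auto
  then have "regular_sequence ?F []" using one F.one_closed by (auto simp: regular_sequence_def)
  then have "\<exists>fs. length fs = 0 \<and> set fs \<subseteq> ?Q \<and> regular_sequence ?F fs" by (intro exI[of _ "[]"]) simp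
  from Sup_enat_ge_obtain[OF le[unfolded depth] this]
  obtain fs where fs: "length fs \<ge> l" "set fs \<subseteq> ?Q" "regular_sequence ?F fs" by blast
  show ?thesis
  proof (intro exI conjI)
    show "regular_sequence Alg (map \<phi> fs)"
      by (rule ring_iso_regular_sequence[OF iso F.ring_axioms A.ring_axioms fs(3)])
  qed (use fs in auto)
qed

end

theorem proposition2p22:
  fixes R :: "('a, 'm) ring_scheme" and K I :: "'a set" and G :: "nat \<Rightarrow> 'a set" and d :: nat
  assumes "standard_graded_ring R K G"
    and "infinite K"
    and "equigenerated R G d I"
  shows "(\<forall>fs. set fs \<subseteq> I \<inter> G d \<and> regular_sequence (fiber_subalgebra R K G d I) fs \<longrightarrow>
            (\<forall>i. 1 \<le> i \<and> i \<le> length fs \<longrightarrow> adjusted R K G d I i (set (take i fs)))) \<and>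
         (cohen_macaulay (special_fiber R G I) \<longrightarrow>
            (\<forall>S. S \<subseteq> I \<inter> G d \<and> finite S \<and> enat (card S) = analytic_spread R G I \<and>
                 minimal_reduction R G I (Idl\<^bsub>R\<^esub> S) \<longrightarrow>
               analytically_adjusted R K G d I S))"
proof -
  interpret equigenerated_ideal R K G I d
    using assms by (intro equigenerated_ideal.intro equigenerated_ideal_axioms.intro)
  show ?thesis
  proof (intro conjI allI impI)
    fix fs i assume "set fs \<subseteq> I \<inter> G d \<and> regular_sequence Alg fs" "1 \<le> i \<and> i \<le> length fs"
    then show "adjusted R K G d I i (set (take i fs))"
      using regular_sequence_adjusted by (simp add: V_def)
  next
    fix S assume cm: "cohen_macaulay (special_fiber R G I)"
      and S: "S \<subseteq> I \<inter> G d \<and> finite S \<and> enat (card S) = analytic_spread R G I \<and>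
        minimal_reduction R G I (Idl\<^bsub>R\<^esub> S)"
    obtain xs where xs: "set xs = S" "distinct xs" using finite_distinct_list S by blast
    have xV: "set xs \<subseteq> V" using xs S by (simp add: V_def)
    have red: "reduction R I (Idl\<^bsub>R\<^esub> (set xs))" using S xs by (simp add: minimal_reduction_def)
    have len: "length xs = card S" using xs distinct_card by fastforce
    have "enat (length xs) = krull_dim (special_fiber R G I)" using S len by (simp add: analytic_spread_def)
    from regular_sequence_in_positive_part[OF cm this]
    obtain ys where ys: "regular_sequence Alg ys" "set ys \<subseteq> A.positive_part" "length xs \<le> length ys" by blast
    have "adjusted R K G d I (length xs) (set xs)"
      using parameters_adjusted[OF xV ys] positive_part_nilpotent_mod_reduction[OF xV red] by blast
    then show "analytically_adjusted R K G d I S"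
      using S xs len by (auto simp: analytically_adjusted_def)
  qed
qed

end
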